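(* Let $N\ge2$. For all $u\in C_c^\infty(\mathbb{H}^N\setminus\{x_0\})$, $$\begin{aligned}\int_{\mathbb{H}^N}|\Delta_{r,\mathbb{H}^N}u|^2\,dv_{\mathbb{H}^N}={}&\frac{N^2}{4}\left(\frac{N-4}{2}\right)^2\int_{\mathbb{H}^N}\frac{u^2}{r^4}\,dv_{\mathbb{H}^N}+\frac{N^2(N-4)(N-1)}{8}\int_{\mathbb{H}^N}\frac{r\coth r-1}{r^4}u^2\,dv_{\mathbb{H}^N}\\&+\frac{N(N-1)}{2}\int_{\mathbb{H}^N}\frac{r\coth r-1}{r^2}|\nabla_{r,\mathbb{H}^N}u|^2\,dv_{\mathbb{H}^N}\\&+\frac{N^2}{4}\int_{\mathbb{H}^N}\frac{1}{r^{N-2}}\left|\nabla_{r,\mathbb{H}^N}\left(r^{\frac{N-4}{2}}u\right)\right|^2dv_{\mathbb{H}^N}\\&+\int_{\mathbb{H}^N}\frac{r^N}{(\sinh r)^{2(N-1)}}\left|\nabla_{r,\mathbb{H}^N}\left(\frac{(\sinh r)^{N-1}u_r}{r^{N/2}}\right)\right|^2dv_{\mathbb{H}^N}.\end{aligned}$$ Moreover, if $N\ge5$, for all $u\in C_c^\infty(\mathbb{H}^N\setminus\{x_0\})$, $$\begin{aligned}\int_{\mathbb{H}^N}|\Delta_{\mathbb{H}^N}u|^2\,dv_{\mathbb{H}^N}\ge{}&\frac{N^2}{4}\left(\frac{N-4}{2}\right)^2\int_{\mathbb{H}^N}\frac{u^2}{r^4}\,dv_{\mathbb{H}^N}+\frac{N^2(N-4)(N-1)}{8}\int_{\mathbb{H}^N}\frac{r\coth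 r-1}{r^4}u^2\,dv_{\mathbb{H}^N}\\&+\frac{N(N-1)}{2}\int_{\mathbb{H}^N}\frac{r\coth r-1}{r^2}|\nabla_{\mathbb{H}^N}u|^2\,dv_{\mathbb{H}^N}\\&+\frac{N^2}{4}\int_{\mathbb{H}^N}\frac{1}{r^{N-2}}\left|\nabla_{\mathbb{H}^N}\left(r^{\frac{N-4}{2}}u\right)\right|^2dv_{\mathbb{H}^N}\\&+\int_{\mathbb{H}^N}\frac{r^N}{(\sinh r)^{2(N-1)}}\left|\nabla_{\mathbb{H}^N}\left(\frac{(\sinh r)^{N-1}u_r}{r^{N/2}}\right)\right|^2dv_{\mathbb{H}^N},\end{aligned}$$ and the constant $\frac{N^2}{4}\left(\frac{N-4}{2}\right)^2$ on the right-hand side of both relations is sharp, i.e. it is the largest constant $C$ such that $\int_{\mathbb{H}^N}|\Delta_{r,\mathbb{H}^N}u|^2dv_{\mathbb{H}^N}\ge C\int_{\mathbb{H}^N}\frac{u^2}{r^4}dv_{\mathbb{H}^N}$, respectively $\int_{\mathbb{H}^N}|\Delta_{\mathbb{H}^N}u|^2dv_{\mathbb{H}^N}\ge C\int_{\mathbb{H}^N}\frac{u^2}{r^4}dv_{\mathbb{H}^N}$, holds for all $u\in C_c^\infty(\mathbb{H}^N\setminus\{x_0\})$.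
   Context: $\mathbb{H}^N$ is the $N$-dimensional hyperbolic space (constant curvature $-1$) with Riemannian volume $dv_{\mathbb{H}^N}$, Laplace-Beltrami operator $\Delta_{\mathbb{H}^N}$ and Riemannian gradient $\nabla_{\mathbb{H}^N}$; $x_0\in\mathbb{H}^N$ is a fixed pole, $r=d(x,x_0)$ is the geodesic distance, and $(r,\Theta)\in(0,\infty)\times\mathbb{S}^{N-1}$ are polar coordinates about $x_0$, in which $dv_{\mathbb{H}^N}=(\sinh r)^{N-1}\,dr\,d\Theta$ and $|\nabla_{\mathbb{H}^N}u|^2=u_r^2+\frac{1}{\sinh^2 r}|\nabla_{\mathbb{S}^{N-1}}u|^2$. Functions are real-valued (not necessarily radial) and $u_r=\frac{\partial u}{\partial r}$. The radial gradient is $\nabla_{r,\mathbb{H}^N}u=(u_r,0)$, so $|\nabla_{r,\mathbb{H}^N}u|^2=u_r^2$; the radial Laplacian is $\Delta_{r,\mathbb{H}^N}u=u_{rr}+(N-1)\coth r\,u_r$. *)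

theory Defs
  imports "HOL-Analysis.Analysis"
begin

text \<open>
  Hyperbolic space of dimension \<open>N = DIM('a)\<close> is the Poincare ball: the open unit ball of
  a Euclidean space \<open>'a\<close> with the metric \<open>g\<^sub>x(v, w) = (2 / (1 - |x|\<^sup>2))\<^sup>2 (v \<bullet> w)\<close>, which has
  constant curvature \<open>-1\<close>.  The pole \<open>x0\<close> is an arbitrary point of the ball.
  Functions on hyperbolic space are functions on \<open>'a\<close> whose values outside the ball
  play no role.
\<close>

definition hyp_space :: "'a::euclidean_space set" where
  "hyp_space = ball 0 1"

definition conf_factor :: "'a::euclidean_space \<Rightarrow> real" where
  "conf_factor x = 2 / (1 - (norm x)\<^sup>2)"

definition hyp_inner :: "'a::euclidean_space \<Rightarrow> 'a \<Rightarrow> 'a \<Rightarrow> real" where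
  "hyp_inner x v w = (conf_factor x)\<^sup>2 * (v \<bullet> w)"

text \<open>The volume density is \<open>sqrt (det g) = conf_factor ^ N\<close>.\<close>

definition hyp_vol :: "'a::euclidean_space measure" where
  "hyp_vol =
     density (restrict_space lborel hyp_space) (\<lambda>x. ennreal (conf_factor x ^ DIM('a)))"

definition hyp_dist :: "'a::euclidean_space \<Rightarrow> 'a \<Rightarrow> real" where
  "hyp_dist x y =
     arcosh (1 + 2 * (norm (x - y))\<^sup>2 / ((1 - (norm x)\<^sup>2) * (1 - (norm y)\<^sup>2)))"

text \<open>
  Gradient \<open>g\<^sup>i\<^sup>j \<partial>\<^sub>j u\<close>, divergence \<open>(det g) powr (-1/2) * \<partial>\<^sub>i ((det g) powr (1/2) * X\<^sup>i)\<close>,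
  and the Laplace-Beltrami operator as the divergence of the gradient.
\<close>

definition pderiv_dir :: "'a::euclidean_space \<Rightarrow> ('a \<Rightarrow> real) \<Rightarrow> 'a \<Rightarrow> real" where
  "pderiv_dir i u x = frechet_derivative u (at x) i"

definition hyp_grad :: "('a::euclidean_space \<Rightarrow> real) \<Rightarrow> 'a \<Rightarrow> 'a" where
  "hyp_grad u x = (1 / (conf_factor x)\<^sup>2) *\<^sub>R (\<Sum>i\<in>Basis. pderiv_dir i u x *\<^sub>R i)"

definition hyp_div :: "('a::euclidean_space \<Rightarrow> 'a) \<Rightarrow> 'a \<Rightarrow> real" where
  "hyp_div X x =
     (1 / conf_factor x ^ DIM('a)) *
     (\<Sum>i\<in>Basis. pderiv_dir i (\<lambda>y. conf_factor y ^ DIM('a) * (X y \<bullet> i)) x)"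

definition hyp_laplace :: "('a::euclidean_space \<Rightarrow> real) \<Rightarrow> 'a \<Rightarrow> real" where
  "hyp_laplace u = hyp_div (hyp_grad u)"

definition grad_sq :: "('a::euclidean_space \<Rightarrow> real) \<Rightarrow> 'a \<Rightarrow> real" where
  "grad_sq u x = hyp_inner x (hyp_grad u x) (hyp_grad u x)"

text \<open>
  Geodesic polar coordinates about \<open>x0\<close>.  Moebius addition \<open>y \<mapsto> moebius_add x0 y\<close> is an
  isometry of the ball taking \<open>0\<close> to \<open>x0\<close>, with inverse \<open>moebius_add (- x0)\<close>, and
  \<open>t \<mapsto> tanh (t/2) *\<^sub>R \<theta>\<close> is the unit speed geodesic from \<open>0\<close> in the direction of the
  unit vector \<open>\<theta>\<close>.  The lemmas below confirm that the point with polar coordinates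
  \<open>(t, \<theta>)\<close> has distance \<open>t\<close> from \<open>x0\<close> and direction \<open>\<theta>\<close>.
\<close>

definition moebius_add :: "'a::euclidean_space \<Rightarrow> 'a \<Rightarrow> 'a" where
  "moebius_add x y =
     (1 / (1 + 2 * (x \<bullet> y) + (norm x)\<^sup>2 * (norm y)\<^sup>2)) *\<^sub>R
     ((1 + 2 * (x \<bullet> y) + (norm y)\<^sup>2) *\<^sub>R x + (1 - (norm x)\<^sup>2) *\<^sub>R y)"

definition polar_point :: "'a::euclidean_space \<Rightarrow> real \<Rightarrow> 'a \<Rightarrow> 'a" where
  "polar_point x0 t \<theta> = moebius_add x0 (tanh (t / 2) *\<^sub>R \<theta>)"

definition polar_dir :: "'a::euclidean_space \<Rightarrow> 'a \<Rightarrow> 'a" where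
  "polar_dir x0 x = sgn (moebius_add (- x0) x)"

lemma moebius_add_denom_pos:
  fixes x y :: "'a::euclidean_space"
  assumes "norm x < 1" "norm y < 1"
  shows "1 + 2 * (x \<bullet> y) + (norm x)\<^sup>2 * (norm y)\<^sup>2 > 0"
proof -
  have 1: "norm x * norm y < 1"
    using assms mult_strict_mono'[of "norm x" 1 "norm y" 1] by simp
  have "- (x \<bullet> y) \<le> norm x * norm y"
    using Cauchy_Schwarz_ineq2[of x y] by linarith
  moreover have "(1 - norm x * norm y)\<^sup>2 > 0"
    using 1 by simp
  ultimately show ?thesis
    by (simp add: power2_eq_square algebra_simps)
qed

lemma norm_moebius_add:
  fixes x y :: "'a::euclidean_space"
  assumes "norm x < 1" "norm y < 1"
  shows "(norm (moebius_add x y))\<^sup>2 =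
    ((norm x)\<^sup>2 + 2 * (x \<bullet> y) + (norm y)\<^sup>2) / (1 + 2 * (x \<bullet> y) + (norm x)\<^sup>2 * (norm y)\<^sup>2)"
proof -
  define p q s D where "p = (norm x)\<^sup>2" and "q = (norm y)\<^sup>2" and "s = x \<bullet> y"
    and "D = 1 + 2 * s + p * q"
  have D: "D > 0"
    using moebius_add_denom_pos[OF assms] by (simp add: D_def p_def q_def s_def)
  have xx: "x \<bullet> x = p" "y \<bullet> y = q" "x \<bullet> y = s" "y \<bullet> x = s"
    by (simp_all add: p_def q_def s_def power2_norm_eq_inner inner_commute)
  have m: "moebius_add x y = (1 / D) *\<^sub>R ((1 + 2 * s + q) *\<^sub>R x + (1 - p) *\<^sub>R y)"
    by (simp add: moebius_add_def D_def p_def q_def s_def)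
  have "(norm (moebius_add x y))\<^sup>2 =
      ((1 + 2 * s + q)\<^sup>2 * p + 2 * (1 + 2 * s + q) * (1 - p) * s + (1 - p)\<^sup>2 * q) / D\<^sup>2"
    unfolding power2_norm_eq_inner m
    by (simp add: inner_add_left inner_add_right xx power2_eq_square algebra_simps add_divide_distrib)
  also have "(1 + 2 * s + q)\<^sup>2 * p + 2 * (1 + 2 * s + q) * (1 - p) * s + (1 - p)\<^sup>2 * q
      = (p + 2 * s + q) * D"
    by (simp add: D_def) algebra
  also have "(p + 2 * s + q) * D / D\<^sup>2 = (p + 2 * s + q) / D"
    using D by (simp add: power2_eq_square)
  finally show ?thesis
    by (simp add: D_def p_def q_def s_def)
qed

lemma moebius_add_cancel_left:
  fixes x y :: "'a::euclidean_space"
  assumes "norm x < 1" "norm y < 1"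
  shows "moebius_add (- x) (moebius_add x y) = y"
proof -
  define p q s D where "p = (norm x)\<^sup>2" and "q = (norm y)\<^sup>2" and "s = x \<bullet> y"
    and "D = 1 + 2 * s + p * q"
  define z where "z = moebius_add x y"
  have D: "D > 0"
    using moebius_add_denom_pos[OF assms] by (simp add: D_def p_def q_def s_def)
  have p: "p < 1"
    using assms(1) by (simp add: p_def abs_square_less_1)
  have xx: "x \<bullet> x = p" "x \<bullet> y = s"
    by (simp_all add: p_def s_def power2_norm_eq_inner)
  have m: "z = (1 / D) *\<^sub>R ((1 + 2 * s + q) *\<^sub>R x + (1 - p) *\<^sub>R y)"
    by (simp add: z_def moebius_add_def D_def p_def q_def s_def)
  have xz: "x \<bullet> z = ((1 + 2 * s + q) * p + (1 - p) * s) / D"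
    unfolding m by (simp add: inner_add_right xx)
  have nz: "(norm z)\<^sup>2 = (p + 2 * s + q) / D"
    using norm_moebius_add[OF assms] by (simp add: z_def p_def q_def s_def D_def)
  have d: "1 + 2 * (- x \<bullet> z) + p * (norm z)\<^sup>2 = (1 - p)\<^sup>2 / D"
    unfolding nz inner_minus_left xz using D by (simp add: divide_simps) (simp add: D_def, algebra)
  have c: "1 + 2 * (- x \<bullet> z) + (norm z)\<^sup>2 = (1 + 2 * s + q) * (1 - p) / D"
    unfolding nz inner_minus_left xz using D by (simp add: divide_simps) (simp add: D_def, algebra)
  have "moebius_add (- x) z = (D / (1 - p)\<^sup>2) *\<^sub>R
      (((1 + 2 * s + q) * (1 - p) / D) *\<^sub>R (- x) + (1 - p) *\<^sub>R z)"
    using d c by (simp add: moebius_add_def p_def)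
  also have "((1 + 2 * s + q) * (1 - p) / D) *\<^sub>R (- x) + (1 - p) *\<^sub>R z = ((1 - p)\<^sup>2 / D) *\<^sub>R y"
    unfolding m by (simp add: scaleR_add_right power2_eq_square mult.commute)
  finally show ?thesis
    using D p by (simp add: z_def)
qed

lemma hyp_dist_moebius_add:
  fixes x y :: "'a::euclidean_space"
  assumes "norm x < 1" "norm y < 1"
  shows "hyp_dist x (moebius_add x y) = arcosh ((1 + (norm y)\<^sup>2) / (1 - (norm y)\<^sup>2))"
proof -
  define p q s D where "p = (norm x)\<^sup>2" and "q = (norm y)\<^sup>2" and "s = x \<bullet> y"
    and "D = 1 + 2 * s + p * q"
  define z where "z = moebius_add x y"
  have D: "D > 0"
    using moebius_add_denom_pos[OF assms] by (simp add: D_def p_def q_def s_def)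
  have pq: "p < 1" "q < 1"
    using assms by (simp_all add: p_def q_def abs_square_less_1)
  have xx: "x \<bullet> x = p" "y \<bullet> y = q" "x \<bullet> y = s" "y \<bullet> x = s"
    by (simp_all add: p_def q_def s_def power2_norm_eq_inner inner_commute)
  have m: "z = (1 / D) *\<^sub>R ((1 + 2 * s + q) *\<^sub>R x + (1 - p) *\<^sub>R y)"
    by (simp add: z_def moebius_add_def D_def p_def q_def s_def)
  have nz: "(norm z)\<^sup>2 = (p + 2 * s + q) / D"
    using norm_moebius_add[OF assms] by (simp add: z_def p_def q_def s_def D_def)
  have n1: "1 - (norm z)\<^sup>2 = (1 - p) * (1 - q) / D"
    unfolding nz using D by (simp add: divide_simps) (simp add: D_def algebra_simps)
  have xz: "x \<bullet> z = ((1 + 2 * s + q) * p + (1 - p) * s) / D"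
    unfolding m by (simp add: inner_add_right xx)
  have "(norm (x - z))\<^sup>2 = p - 2 * (x \<bullet> z) + (norm z)\<^sup>2"
    by (simp add: p_def power2_norm_eq_inner inner_diff_left inner_diff_right inner_commute)
  also have "\<dots> = (1 - p)\<^sup>2 * q / D"
    unfolding nz xz using D by (simp add: divide_simps) (simp add: D_def, algebra)
  finally have n2: "(norm (x - z))\<^sup>2 = (1 - p)\<^sup>2 * q / D" .
  have "1 + 2 * (norm (x - z))\<^sup>2 / ((1 - p) * (1 - (norm z)\<^sup>2)) = (1 + q) / (1 - q)"
    unfolding n1 n2 using D pq by (simp add: divide_simps power2_eq_square)
  then show ?thesis
    by (simp add: hyp_dist_def z_def p_def q_def)
qed

lemma hyp_dist_polar_point:
  fixes x0 \<theta> :: "'a::euclidean_space"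
  assumes "x0 \<in> hyp_space" "norm \<theta> = 1" "t \<ge> 0"
  shows "hyp_dist x0 (polar_point x0 t \<theta>) = t"
proof -
  have x0: "norm x0 < 1"
    using assms(1) by (simp add: hyp_space_def)
  have n: "norm (tanh (t / 2) *\<^sub>R \<theta>) < 1"
    using assms(2) tanh_real_bounds[of "t/2"] by (auto simp: abs_less_iff)
  have nsq: "(norm (tanh (t / 2) *\<^sub>R \<theta>))\<^sup>2 = (tanh (t / 2))\<^sup>2"
    using assms(2) by (simp add: power_mult_distrib)
  have c: "cosh (t/2) \<noteq> 0"
    using cosh_real_pos[of "t/2"] by linarith
  have cs: "(cosh (t/2))\<^sup>2 - (sinh (t/2))\<^sup>2 = 1"
    by (simp add: cosh_square_eq)
  have "(1 + (tanh (t / 2))\<^sup>2) / (1 - (tanh (t / 2))\<^sup>2)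
      = ((cosh (t/2))\<^sup>2 + (sinh (t/2))\<^sup>2) / ((cosh (t/2))\<^sup>2 - (sinh (t/2))\<^sup>2)"
    unfolding tanh_def power_divide using c cs by (simp add: divide_simps)
  also have "\<dots> = cosh t"
    unfolding cs using cosh_add[of "t/2" "t/2"] by (simp add: power2_eq_square)
  finally show ?thesis
    unfolding polar_point_def hyp_dist_moebius_add[OF x0 n] nsq
    using assms(3) by (simp add: arcosh_cosh_real)
qed

lemma polar_dir_polar_point:
  fixes x0 \<theta> :: "'a::euclidean_space"
  assumes "x0 \<in> hyp_space" "norm \<theta> = 1" "t > 0"
  shows "polar_dir x0 (polar_point x0 t \<theta>) = \<theta>"
proof -
  have x0: "norm x0 < 1"
    using assms(1) by (simp add: hyp_space_def)
  have n: "norm (tanh (t / 2) *\<^sub>R \<theta>) < 1"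
    using assms(2) tanh_real_bounds[of "t/2"] by (auto simp: abs_less_iff)
  show ?thesis
    unfolding polar_dir_def polar_point_def moebius_add_cancel_left[OF x0 n]
    using assms(2,3) by (simp add: sgn_scaleR sgn_div_norm)
qed

text \<open>
  The radial derivative \<open>u\<^sub>r\<close>: the derivative of \<open>u\<close> in the first polar coordinate, with
  the angular coordinate held fixed.
\<close>

definition radial_deriv :: "'a::euclidean_space \<Rightarrow> ('a \<Rightarrow> real) \<Rightarrow> 'a \<Rightarrow> real" where
  "radial_deriv x0 u x = deriv (\<lambda>t. u (polar_point x0 t (polar_dir x0 x))) (hyp_dist x0 x)"

definition radial_grad_sq :: "'a::euclidean_space \<Rightarrow> ('a \<Rightarrow> real) \<Rightarrow> 'a \<Rightarrow> real" where
  "radial_grad_sq x0 u x = (radial_deriv x0 u x)\<^sup>2"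

definition coth :: "real \<Rightarrow> real" where
  "coth t = cosh t / sinh t"

definition radial_laplace :: "'a::euclidean_space \<Rightarrow> ('a \<Rightarrow> real) \<Rightarrow> 'a \<Rightarrow> real" where
  "radial_laplace x0 u x =
     radial_deriv x0 (radial_deriv x0 u) x
     + (real DIM('a) - 1) * coth (hyp_dist x0 x) * radial_deriv x0 u x"

primrec C_k :: "nat \<Rightarrow> ('a::euclidean_space \<Rightarrow> real) \<Rightarrow> bool" where
  "C_k 0 u \<longleftrightarrow> continuous_on UNIV u"
| "C_k (Suc k) u \<longleftrightarrow> (\<forall>x. u differentiable at x) \<and> (\<forall>i\<in>Basis. C_k k (pderiv_dir i u))"

text \<open>
  Smooth functions with compact support in the ball minus \<open>x0\<close>, extended by zero to all
  of \<open>'a\<close>.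
\<close>

definition test_functions :: "'a::euclidean_space \<Rightarrow> ('a \<Rightarrow> real) set" where
  "test_functions x0 =
     {u. (\<forall>k. C_k k u) \<and> compact (closure {x. u x \<noteq> 0})
         \<and> closure {x. u x \<noteq> 0} \<subseteq> hyp_space - {x0}}"

definition rellich_ineq ::
    "'a::euclidean_space \<Rightarrow> (('a \<Rightarrow> real) \<Rightarrow> 'a \<Rightarrow> real) \<Rightarrow> real \<Rightarrow> bool" where
  "rellich_ineq x0 L C \<longleftrightarrow>
     (\<forall>u\<in>test_functions x0.
        (\<integral>x. (L u x)\<^sup>2 \<partial>hyp_vol) \<ge> C * (\<integral>x. (u x)\<^sup>2 / hyp_dist x0 x ^ 4 \<partial>hyp_vol))"

definition sharp_rellich_constant ::
    "'a::euclidean_space \<Rightarrow> (('a \<Rightarrow> real) \<Rightarrow> 'a \<Rightarrow> real) \<Rightarrow> real \<Rightarrow> bool" where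
  "sharp_rellich_constant x0 L C \<longleftrightarrow>
     rellich_ineq x0 L C \<and> (\<forall>C'. rellich_ineq x0 L C' \<longrightarrow> C' \<le> C)"

end

theory Submission
  imports Defs
begin

text \<open>
  Polar coordinates are replaced by a frame.  The ball embeds into the unit hyperboloid of
  Minkowski space, and the restrictions of linear functions to the hyperboloid have hyperbolic
  gradients with polynomial components in the ball.  In a Lorentz frame based at the pole these
  gradients yield the radial field \<open>Xr = \<partial>\<^sub>r\<close> and the components \<open>Dt i\<close> of the
  gradient of the unit sphere, together with their commutators, the decompositions
  \<open>|\<nabla>u|\<^sup>2 = u\<^sub>r\<^sup>2 + |\<nabla>\<^sub>S u|\<^sup>2 / sinh\<^sup>2 r\<close> and \<open>\<Delta>u = \<Delta>\<^sub>r u + \<Delta>\<^sub>S u / sinh\<^sup>2 r\<close>, and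
  integration by parts, which reduces to the vanishing of the integral of a partial derivative.

  The integrands of the last two terms of the identity are \<open>(u\<^sub>r + (N-4)/(2r) u)\<^sup>2 / r\<^sup>2\<close> and
  \<open>(\<Delta>\<^sub>r u - N/(2r) u\<^sub>r)\<^sup>2\<close>, so the two sides differ by the divergence of a radial field.  For the
  inequality, the cross term \<open>2 \<integral> \<Delta>\<^sub>r u \<Delta>\<^sub>S u / sinh\<^sup>2 r\<close> is integrated by parts,
  \<open>\<integral> (\<Delta>\<^sub>S u)\<^sup>2 / sinh\<^sup>4 r\<close> is bounded below by the first eigenvalue \<open>N - 1\<close> of the sphere (Bochner), and a
  Hardy inequality for \<open>\<nabla>\<^sub>S u\<close> with the function \<open>g = 1/r - (N-2)/2 coth r\<close> leaves a pointwise
  inequality between \<open>coth r\<close> and \<open>1/r\<close>.  Sharpness follows from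
  \<open>u = r powr (-(N-4)/2) * \<phi>(- ln r / R)\<close> with a fixed bump \<open>\<phi>\<close> and \<open>R \<rightarrow> \<infinity>\<close>.
\<close>

section \<open>Smooth functions\<close>

text \<open>Integration in polar coordinates would call for a surface measure, a change of variables
  and charts on the sphere. The frame fields live on the whole punctured ball, and every integration
  by parts goes back to one Euclidean fact. The pole is not moved to the origin; the frame carries
  its position instead. The inequality cannot be had term by term: the full gradient in the last
  term demands angular energy of the radial derivative. The cross term supplies this energy twice,
  so one copy remains to pay, through Hardy, for the angular energy of \<open>u\<close> in the other
  terms. Dimension 5 is the borderline: there the remaining coefficient, divided by
  \<open>1 / (sinh r)\<^sup>2\<close>, tends to 0 at the pole, so \<open>coth r - 1 / r\<close> must
  be known beyond its leading order. For sharpness, the exponent -(N-4)/2 turns both integrands near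
  the pole into functions of ln r against dr/r. Stretching by R makes each derivative of the profile
  cost a factor 1/R, while the curvature errors are exponentially small in R. The area of the sphere
  enters only as a common factor that is never computed.\<close>

lemma pderiv_dir_eq:
  assumes "(u has_derivative u') (at x)"
  shows "pderiv_dir i u x = u' i"
  unfolding pderiv_dir_def using frechet_derivative_at[OF assms] by simp

lemma frechet_derivative_eq_sum_pderiv_dir:
  fixes u :: "'a::euclidean_space \<Rightarrow> real"
  assumes "u differentiable at x"
  shows "frechet_derivative u (at x) v = (\<Sum>i\<in>Basis. (v \<bullet> i) * pderiv_dir i u x)"
proof -
  have lin: "linear (frechet_derivative u (at x))"
    using linear_frechet_derivative[OF assms] .
  have "frechet_derivative u (at x) v = frechet_derivative u (at x) (\<Sum>i\<in>Basis. (v \<bullet> i) *\<^sub>R i)"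
    by (simp add: euclidean_representation)
  then show ?thesis
    using lin by (simp add: linear_sum linear_scale pderiv_dir_def)
qed

lemma frechet_derivative_add:
  assumes "u differentiable at x" "v differentiable at x"
  shows "frechet_derivative (\<lambda>x. u x + v x) (at x) h =
    frechet_derivative u (at x) h + frechet_derivative v (at x) h"
  using has_derivative_add[OF assms[unfolded frechet_derivative_works]] frechet_derivative_at
  by metis

lemma frechet_derivative_diff:
  assumes "u differentiable at x" "v differentiable at x"
  shows "frechet_derivative (\<lambda>x. u x - v x) (at x) h =
    frechet_derivative u (at x) h - frechet_derivative v (at x) h"
  using has_derivative_diff[OF assms[unfolded frechet_derivative_works]] frechet_derivative_at
  by metis

lemma frechet_derivative_mult:
  fixes u v :: "'a::real_normed_vector \<Rightarrow> real"
  assumes "u differentiable at x" "v differentiable at x"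
  shows "frechet_derivative (\<lambda>x. u x * v x) (at x) h =
    frechet_derivative u (at x) h * v x + u x * frechet_derivative v (at x) h"
proof -
  have "((\<lambda>x. u x * v x) has_derivative
      (\<lambda>h. u x * frechet_derivative v (at x) h + frechet_derivative u (at x) h * v x)) (at x)"
    using assms[unfolded frechet_derivative_works] by (intro has_derivative_mult)
  note fun_cong[OF frechet_derivative_at[OF this], of h]
  then show ?thesis by simp
qed

text \<open>The two functions have the same set of derivatives at \<open>x\<close>, so the choice
  operator returns the same map, whether or not a derivative exists.\<close>

lemma frechet_derivative_cong_open:
  assumes "open S" "x \<in> S" "\<And>y. y \<in> S \<Longrightarrow> u y = v y"
  shows "frechet_derivative u (at x) = frechet_derivative v (at x)"
proof -
  have "(u has_derivative D) (at x) \<longleftrightarrow> (v has_derivative D) (at x)" for D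
    using assms by (metis has_derivative_transform_within_open)
  then show ?thesis
    by (simp add: frechet_derivative_def)
qed

lemma pderiv_dir_cong_open:
  assumes "open S" "x \<in> S" "\<And>y. y \<in> S \<Longrightarrow> u y = v y"
  shows "pderiv_dir i u x = pderiv_dir i v x"
  unfolding pderiv_dir_def using frechet_derivative_cong_open[OF assms] by simp

lemma differentiable_cong_open:
  assumes "open S" "x \<in> S" "\<And>y. y \<in> S \<Longrightarrow> u y = v y" "u differentiable at x"
  shows "v differentiable at x"
  using assms unfolding differentiable_def by (metis has_derivative_transform_within_open)

text \<open>A localized \<open>C_k\<close>: the distance and the weights built from it are smooth
  only off the pole. Derivatives are taken at \<open>x\<close> and not within \<open>S\<close>, so
  the notion is meant for open sets.\<close>

primrec Ck_on :: "nat \<Rightarrow> 'a::euclidean_space set \<Rightarrow> ('a \<Rightarrow> real) \<Rightarrow> bool" where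
  "Ck_on 0 S u \<longleftrightarrow> continuous_on S u"
| "Ck_on (Suc k) S u \<longleftrightarrow>
     (\<forall>x\<in>S. u differentiable at x) \<and> (\<forall>i\<in>Basis. Ck_on k S (pderiv_dir i u))"

lemma C_k_eq_Ck_on: "C_k k u \<longleftrightarrow> Ck_on k UNIV u"
  by (induction k arbitrary: u) auto

lemma Ck_on_cong:
  assumes "open S" "\<And>x. x \<in> S \<Longrightarrow> u x = v x" "Ck_on k S u"
  shows "Ck_on k S v"
  using assms(2,3)
proof (induction k arbitrary: u v)
  case 0
  then show ?case
    by (simp cong: continuous_on_cong)
next
  case (Suc k)
  have "v differentiable at x" if "x \<in> S" for x
    using differentiable_cong_open[OF assms(1) that, of u v] Suc.prems that by auto
  moreover have "Ck_on k S (pderiv_dir i v)" if "i \<in> Basis" for i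
    using Suc.prems(2) that pderiv_dir_cong_open[OF assms(1) _ Suc.prems(1)]
    by (intro Suc.IH[of "pderiv_dir i u" "pderiv_dir i v"]) simp_all
  ultimately show ?case by simp
qed

lemma Ck_on_lower:
  assumes "Ck_on (Suc k) S u"
  shows "Ck_on k S u"
  using assms
proof (induction k arbitrary: u)
  case 0
  then show ?case
    by (auto intro!: continuous_at_imp_continuous_on differentiable_imp_continuous_within)
next
  case (Suc k)
  then show ?case by (metis Ck_on.simps(2))
qed

lemma Ck_on_subset: "Ck_on k S u \<Longrightarrow> T \<subseteq> S \<Longrightarrow> Ck_on k T u"
  by (induction k arbitrary: u) (auto intro: continuous_on_subset)

lemma Ck_on_Un:
  assumes "open S" "open T" "Ck_on k S u" "Ck_on k T u"
  shows "Ck_on k (S \<union> T) u"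
  using assms(3,4) by (induction k arbitrary: u) (auto intro: continuous_on_open_Un assms(1,2))

lemma Ck_on_const: "Ck_on k S (\<lambda>x. c)"
proof (induction k arbitrary: c)
  case (Suc k)
  have "pderiv_dir i (\<lambda>x. c) = (\<lambda>x. 0)" for i :: 'a
    by (simp add: pderiv_dir_def fun_eq_iff)
  with Suc show ?case by simp
qed simp

lemma Ck_on_add:
  assumes S: "open S" and "Ck_on k S u" "Ck_on k S v"
  shows "Ck_on k S (\<lambda>x. u x + v x)"
  using assms(2,3)
proof (induction k arbitrary: u v)
  case 0
  then show ?case by (auto intro: continuous_intros)
next
  case (Suc k)
  have "Ck_on k S (pderiv_dir i (\<lambda>x. u x + v x))" if i: "i \<in> Basis" for i
  proof (rule Ck_on_cong[OF S])
    show "pderiv_dir i u x + pderiv_dir i v x = pderiv_dir i (\<lambda>x. u x + v x) x" if "x \<in> S" for x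
      using Suc.prems that by (auto simp: pderiv_dir_def frechet_derivative_add)
    show "Ck_on k S (\<lambda>x. pderiv_dir i u x + pderiv_dir i v x)"
      using Suc i by simp
  qed
  with Suc.prems show ?case by simp
qed

lemma Ck_on_mult:
  assumes S: "open S" and "Ck_on k S u" "Ck_on k S v"
  shows "Ck_on k S (\<lambda>x. u x * v x)"
  using assms(2,3)
proof (induction k arbitrary: u v)
  case 0
  then show ?case by (auto intro: continuous_intros)
next
  case (Suc k)
  have "Ck_on k S (pderiv_dir i (\<lambda>x. u x * v x))" if i: "i \<in> Basis" for i
  proof (rule Ck_on_cong[OF S])
    show "pderiv_dir i u x * v x + u x * pderiv_dir i v x = pderiv_dir i (\<lambda>x. u x * v x) x"
      if "x \<in> S" for x
      using Suc.prems that by (auto simp: pderiv_dir_def frechet_derivative_mult)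
    have "Ck_on k S u" "Ck_on k S v"
      using Suc.prems Ck_on_lower by blast+
    moreover have "Ck_on k S (pderiv_dir i u)" "Ck_on k S (pderiv_dir i v)"
      using Suc.prems i by simp_all
    ultimately show "Ck_on k S (\<lambda>x. pderiv_dir i u x * v x + u x * pderiv_dir i v x)"
      by (intro Ck_on_add[OF S] Suc.IH)
  qed
  with Suc.prems show ?case by simp
qed

lemma Ck_on_sum:
  assumes "open S" "\<And>i. i \<in> I \<Longrightarrow> Ck_on k S (u i)"
  shows "Ck_on k S (\<lambda>x. \<Sum>i\<in>I. u i x)"
  using assms(2)
  by (induction I rule: infinite_finite_induct) (auto intro: Ck_on_add[OF assms(1)] Ck_on_const)

lemma Ck_on_inner: "open S \<Longrightarrow> Ck_on k S (\<lambda>x. x \<bullet> w)"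
proof (cases k)
  case (Suc m)
  have "pderiv_dir i (\<lambda>x. x \<bullet> w) = (\<lambda>x. i \<bullet> w)" for i
    by (rule ext, rule pderiv_dir_eq) (auto intro!: derivative_eq_intros)
  then show ?thesis
    by (simp add: Suc Ck_on_const)
qed (auto intro: continuous_intros)

text \<open>The outer function has one real variable. Quotients, powers, \<open>arcosh\<close> and
  all radial weights enter through such compositions, and the chain rule then gives a single product
  per direction, to which \<open>Ck_on_mult\<close> applies.\<close>

lemma Ck_on_compose:
  fixes F :: "real \<Rightarrow> real"
  assumes S: "open S" and gS: "\<And>x. x \<in> S \<Longrightarrow> g x \<in> T" and "Ck_on k T F" "Ck_on k S g"
  shows "Ck_on k S (\<lambda>x. F (g x))"
  using assms(3,4)
proof (induction k arbitrary: F)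
  case 0
  then show ?case
    by (auto intro: continuous_on_compose2 gS)
next
  case (Suc k)
  have d: "((\<lambda>x. F (g x)) has_derivative
      (\<lambda>h. frechet_derivative F (at (g x)) (frechet_derivative g (at x) h))) (at x)" if "x \<in> S" for x
  proof -
    have "(g has_derivative frechet_derivative g (at x)) (at x)"
      using Suc.prems(2) that by (simp flip: frechet_derivative_works)
    moreover have "(F has_derivative frechet_derivative F (at (g x))) (at (g x))"
      using Suc.prems(1) gS[OF that] by (simp flip: frechet_derivative_works)
    ultimately show ?thesis by (rule has_derivative_compose)
  qed
  have "Ck_on k S (pderiv_dir i (\<lambda>x. F (g x)))" if i: "i \<in> Basis" for i
  proof (rule Ck_on_cong[OF S])
    show "pderiv_dir 1 F (g x) * pderiv_dir i g x = pderiv_dir i (\<lambda>x. F (g x)) x" if "x \<in> S" for x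
    proof -
      have "linear (frechet_derivative F (at (g x)))"
        using Suc.prems gS that by (intro linear_frechet_derivative) auto
      from linear_scale[OF this, of "frechet_derivative g (at x) i" 1] show ?thesis
        by (simp add: pderiv_dir_eq[OF d[OF that]]) (simp add: pderiv_dir_def)
    qed
    have "Ck_on k S g" using Suc.prems(2) Ck_on_lower by blast
    moreover have "Ck_on k T (pderiv_dir 1 F)" "Ck_on k S (pderiv_dir i g)"
      using Suc.prems i by simp_all
    ultimately show "Ck_on k S (\<lambda>x. pderiv_dir 1 F (g x) * pderiv_dir i g x)"
      using Ck_on_mult[OF S Suc.IH] by blast
  qed
  moreover have "\<forall>x\<in>S. (\<lambda>x. F (g x)) differentiable at x"
    using d differentiableI by blast
  ultimately show ?case unfolding Ck_on.simps by blast
qed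

definition smooth :: "'a::euclidean_space set \<Rightarrow> ('a \<Rightarrow> real) \<Rightarrow> bool" where
  "smooth S u \<longleftrightarrow> (\<forall>k. Ck_on k S u)"

lemma smooth_cong: "open S \<Longrightarrow> smooth S u \<Longrightarrow> (\<And>x. x \<in> S \<Longrightarrow> u x = v x) \<Longrightarrow> smooth S v"
  unfolding smooth_def using Ck_on_cong by blast

lemma smooth_subset: "smooth S u \<Longrightarrow> T \<subseteq> S \<Longrightarrow> smooth T u"
  unfolding smooth_def using Ck_on_subset by blast

lemma smooth_const [simp]: "smooth S (\<lambda>x. c)"
  by (simp add: smooth_def Ck_on_const)

lemma smooth_add: "open S \<Longrightarrow> smooth S u \<Longrightarrow> smooth S v \<Longrightarrow> smooth S (\<lambda>x. u x + v x)"
  by (simp add: smooth_def Ck_on_add)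

lemma smooth_mult: "open S \<Longrightarrow> smooth S u \<Longrightarrow> smooth S v \<Longrightarrow> smooth S (\<lambda>x. u x * v x)"
  by (simp add: smooth_def Ck_on_mult)

lemma smooth_minus:
  assumes "open S" "smooth S u" shows "smooth S (\<lambda>x. - u x)"
  using smooth_mult[OF assms(1) smooth_const[of S "-1"] assms(2)] by simp

lemma smooth_diff:
  assumes "open S" "smooth S u" "smooth S v" shows "smooth S (\<lambda>x. u x - v x)"
  using smooth_add[OF assms(1,2) smooth_minus[OF assms(1,3)]] by simp

lemma smooth_power: "open S \<Longrightarrow> smooth S u \<Longrightarrow> smooth S (\<lambda>x. u x ^ n)"
  by (induction n) (auto intro: smooth_mult)

lemma smooth_sum:
  "open S \<Longrightarrow> (\<And>i. i \<in> I \<Longrightarrow> smooth S (u i)) \<Longrightarrow> smooth S (\<lambda>x. \<Sum>i\<in>I. u i x)"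
  by (simp add: smooth_def Ck_on_sum)

lemma smooth_inner: "open S \<Longrightarrow> smooth S (\<lambda>x. x \<bullet> w)"
  by (simp add: smooth_def Ck_on_inner)

lemma smooth_compose:
  fixes F :: "real \<Rightarrow> real"
  shows "open S \<Longrightarrow> smooth T F \<Longrightarrow> smooth S g \<Longrightarrow> (\<And>x. x \<in> S \<Longrightarrow> g x \<in> T) \<Longrightarrow>
    smooth S (\<lambda>x. F (g x))"
  unfolding smooth_def using Ck_on_compose by blast

lemma smooth_differentiable: "smooth S u \<Longrightarrow> x \<in> S \<Longrightarrow> u differentiable at x"
  unfolding smooth_def using Ck_on.simps(2) by blast

lemma smooth_has_derivative:
  "smooth S u \<Longrightarrow> x \<in> S \<Longrightarrow> (u has_derivative frechet_derivative u (at x)) (at x)"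
  using smooth_differentiable frechet_derivative_works by blast

lemma smooth_continuous_on: "smooth S u \<Longrightarrow> continuous_on S u"
  unfolding smooth_def using Ck_on.simps(1) by blast

lemma smooth_pderiv_dir: "smooth S u \<Longrightarrow> i \<in> Basis \<Longrightarrow> smooth S (pderiv_dir i u)"
  unfolding smooth_def using Ck_on.simps(2) by blast

text \<open>The open sets \<open>S\<close> and \<open>- K\<close> cover the space, and the function
  vanishes on the second.\<close>

lemma smooth_UnivI:
  assumes "open S" "closed K" "K \<subseteq> S" "smooth S u" "\<And>x. x \<notin> K \<Longrightarrow> u x = 0"
  shows "smooth UNIV u"
proof -
  have K: "open (- K)" using assms(2) by auto
  have "smooth (- K) u"
    by (rule smooth_cong[OF K smooth_const[of _ 0]]) (auto simp: assms(5))
  moreover have "S \<union> - K = UNIV" using assms(3) by auto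
  ultimately show ?thesis
    using Ck_on_Un[OF assms(1) K] assms(4) unfolding smooth_def by metis
qed

section \<open>Smoothness of elementary functions of one real variable\<close>

lemma Ck_on_realI:
  fixes F :: "nat \<Rightarrow> real \<Rightarrow> real"
  assumes S: "open S" and "\<And>n x. x \<in> S \<Longrightarrow> (F n has_real_derivative F (Suc n) x) (at x)"
  shows "Ck_on k S (F n)"
proof (induction k arbitrary: n)
  case 0
  then show ?case
    using assms(2) by (auto intro!: continuous_at_imp_continuous_on intro: DERIV_isCont)
next
  case (Suc k)
  have d: "(F n has_derivative (\<lambda>h. F (Suc n) x * h)) (at x)" if "x \<in> S" for x
    using assms(2)[OF that, of n] by (simp add: has_field_derivative_def)
  have "Ck_on k S (pderiv_dir 1 (F n))"
    by (rule Ck_on_cong[OF S _ Suc[of "Suc n"]]) (simp add: pderiv_dir_eq[OF d])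
  then show ?case using d by (auto simp: differentiable_def)
qed

lemma smooth_realI:
  fixes F :: "nat \<Rightarrow> real \<Rightarrow> real"
  assumes "open S" "\<And>n x. x \<in> S \<Longrightarrow> (F n has_real_derivative F (Suc n) x) (at x)"
  shows "smooth S (F n)"
  unfolding smooth_def using Ck_on_realI[of S F, OF assms] by blast

text \<open>Serves functions such as \<open>ln\<close> and \<open>arcosh\<close>, whose first
  derivative is a power of something known to be smooth; no formula for the higher derivatives is
  needed.\<close>

lemma smooth_real_DERIV:
  fixes F :: "real \<Rightarrow> real"
  assumes S: "open S" and "\<And>x. x \<in> S \<Longrightarrow> (F has_real_derivative G x) (at x)" "smooth S G"
  shows "smooth S F"
  unfolding smooth_def
proof
  fix k
  have d: "(F has_derivative (\<lambda>h. G x * h)) (at x)" if "x \<in> S" for x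
    using assms(2)[OF that] by (simp add: has_field_derivative_def)
  have "Ck_on j S (pderiv_dir 1 F)" for j
    by (rule Ck_on_cong[OF S _ assms(3)[unfolded smooth_def, rule_format]])
       (simp add: pderiv_dir_eq[OF d])
  then have "Ck_on (Suc k) S F"
    using d by (auto simp: differentiable_def)
  then show "Ck_on k S F" by (rule Ck_on_lower)
qed

lemma smooth_powr_real: "smooth {0<..} (\<lambda>x::real. x powr a)"
proof -
  define F where "F n x = (\<Prod>j<n. a - real j) * x powr (a - real n)" for n :: nat and x :: real
  have "smooth {0<..} (F 0)"
  proof (rule smooth_realI)
    show "(F n has_real_derivative F (Suc n) x) (at x)" if "x \<in> {0<..}" for n x
      unfolding F_def using that
      by (auto intro!: derivative_eq_intros simp: algebra_simps)
  qed simp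
  moreover have "F 0 = (\<lambda>x. x powr a)" by (simp add: F_def fun_eq_iff)
  ultimately show ?thesis by simp
qed

lemma smooth_ln_real: "smooth {0<..} (ln :: real \<Rightarrow> real)"
proof (rule smooth_real_DERIV)
  show "smooth {0<..} (\<lambda>x::real. x powr (-1))" by (rule smooth_powr_real)
  show "(ln has_real_derivative x powr (-1)) (at x)" if "x \<in> {0<..}" for x :: real
    using that by (auto intro!: derivative_eq_intros simp: powr_minus inverse_eq_divide)
qed simp

lemma smooth_powr:
  assumes "open S" "smooth S u" "\<And>x. x \<in> S \<Longrightarrow> u x > 0"
  shows "smooth S (\<lambda>x. u x powr a)"
  using smooth_compose[OF assms(1) smooth_powr_real assms(2)] assms(3) by auto

text \<open>Division is reduced to \<open>powr\<close> with exponent -1, hence a positive rather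
  than a nonzero denominator.\<close>

lemma smooth_divide:
  assumes "open S" "smooth S u" "smooth S v" "\<And>x. x \<in> S \<Longrightarrow> v x > 0"
  shows "smooth S (\<lambda>x. u x / v x)"
proof (rule smooth_cong[OF assms(1)])
  show "smooth S (\<lambda>x. u x * v x powr (-1))"
    by (intro smooth_mult smooth_powr assms)
  show "u x * v x powr (-1) = u x / v x" if "x \<in> S" for x
    using assms(4)[OF that] by (simp add: powr_minus divide_inverse)
qed

lemma smooth_sinh_real: "smooth UNIV (sinh :: real \<Rightarrow> real)"
proof -
  define F where "F n = (if even n then sinh else cosh :: real \<Rightarrow> real)" for n :: nat
  have "smooth UNIV (F 0)"
    by (rule smooth_realI) (auto simp: F_def intro!: derivative_eq_intros)
  then show ?thesis by (simp add: F_def)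
qed

lemma smooth_arcosh_real: "smooth {1<..} (arcosh :: real \<Rightarrow> real)"
proof (rule smooth_real_DERIV)
  have "smooth {1<..} (\<lambda>x::real. x * x - 1)"
    using smooth_inner[of "{1::real<..}" 1] by (intro smooth_diff smooth_mult) auto
  then show "smooth {1<..} (\<lambda>x::real. (x * x - 1) powr (-1/2))"
    by (rule smooth_powr[rotated]) (auto simp: power2_eq_square[symmetric])
  show "(arcosh has_real_derivative (x * x - 1) powr (-1/2)) (at x)" if "x \<in> {1<..}" for x :: real
  proof -
    have pos: "x * x - 1 > 0" using that by (simp add: power2_eq_square[symmetric])
    have "(x * x - 1) powr (-1/2) = inverse ((x * x - 1) powr (1/2))"
      by (simp add: powr_minus)
    also have "\<dots> = 1 / sqrt (x\<^sup>2 - 1)"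
      using pos by (simp only: powr_half_sqrt less_imp_le) (simp add: inverse_eq_divide power2_eq_square)
    finally show ?thesis
      using arcosh_real_has_field_derivative[of x UNIV] that by simp
  qed
qed simp

text \<open>The second difference of \<open>u\<close> is expressed through each of the two mixed derivatives
  by applying the mean value theorem twice.\<close>

lemma second_difference_mvt:
  fixes u :: "'a::euclidean_space \<Rightarrow> real"
  assumes u: "smooth S u" and i: "i \<in> Basis" and h: "h > 0"
    and sub: "\<And>a b. 0 \<le> a \<Longrightarrow> a \<le> h \<Longrightarrow> 0 \<le> b \<Longrightarrow> b \<le> h \<Longrightarrow> x + a *\<^sub>R i + b *\<^sub>R j \<in> S"
  obtains a b where "0 < a" "a < h" "0 < b" "b < h"
    "u (x + h *\<^sub>R i + h *\<^sub>R j) - u (x + h *\<^sub>R i) - u (x + h *\<^sub>R j) + u x =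
      h\<^sup>2 * frechet_derivative (pderiv_dir i u) (at (x + a *\<^sub>R i + b *\<^sub>R j)) j"
proof -
  have d: "((\<lambda>t. v (p + t *\<^sub>R k)) has_real_derivative frechet_derivative v (at (p + t *\<^sub>R k)) k) (at t)"
    if "smooth S v" "p + t *\<^sub>R k \<in> S" for v :: "'a \<Rightarrow> real" and p k t
  proof -
    have "((\<lambda>t. v (p + t *\<^sub>R k)) has_derivative (\<lambda>s. frechet_derivative v (at (p + t *\<^sub>R k)) (s *\<^sub>R k))) (at t)"
      by (rule has_derivative_compose[where f = "\<lambda>t. p + t *\<^sub>R k" and g = v,
            OF _ smooth_has_derivative[OF that]]) (auto intro!: derivative_eq_intros)
    moreover have "linear (frechet_derivative v (at (p + t *\<^sub>R k)))"
      using smooth_differentiable[OF that] by (rule linear_frechet_derivative)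
    ultimately show ?thesis
      by (simp add: has_field_derivative_def linear_scale mult.commute[of _ "frechet_derivative v _ k"])
  qed
  define g where "g t = u (x + h *\<^sub>R j + t *\<^sub>R i) - u (x + t *\<^sub>R i)" for t
  have "\<exists>a>0. a < h \<and> g h - g 0 = (h - 0) *
      (pderiv_dir i u (x + h *\<^sub>R j + a *\<^sub>R i) - pderiv_dir i u (x + a *\<^sub>R i))"
    unfolding g_def pderiv_dir_def using h sub[of _ h] sub[of _ 0]
    by (intro MVT2 DERIV_diff d[OF u]) (auto simp: add_ac)
  then obtain a where a: "0 < a" "a < h" and ga: "g h - g 0 = h *
      (pderiv_dir i u (x + h *\<^sub>R j + a *\<^sub>R i) - pderiv_dir i u (x + a *\<^sub>R i))" by auto
  have "\<exists>b>0. b < h \<and> pderiv_dir i u (x + a *\<^sub>R i + h *\<^sub>R j) - pderiv_dir i u (x + a *\<^sub>R i + 0 *\<^sub>R j)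
      = (h - 0) * frechet_derivative (pderiv_dir i u) (at (x + a *\<^sub>R i + b *\<^sub>R j)) j"
    using h a sub[of a] by (intro MVT2 d smooth_pderiv_dir[OF u i]) auto
  then obtain b where b: "0 < b" "b < h" and gb:
      "pderiv_dir i u (x + a *\<^sub>R i + h *\<^sub>R j) - pderiv_dir i u (x + a *\<^sub>R i)
      = h * frechet_derivative (pderiv_dir i u) (at (x + a *\<^sub>R i + b *\<^sub>R j)) j" by auto
  have "g h - g 0 = h\<^sup>2 * frechet_derivative (pderiv_dir i u) (at (x + a *\<^sub>R i + b *\<^sub>R j)) j"
    using ga gb by (simp add: power2_eq_square add_ac)
  then show ?thesis
    using that[OF a b] by (simp add: g_def add_ac)
qed

text \<open>Each mixed derivative, at some point of a small square, equals the second difference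
  divided by \<open>h\<^sup>2\<close>. The two points differ, so the equality at \<open>x\<close> is
  reached by continuity as the square shrinks.\<close>

lemma pderiv_dir_commute:
  fixes u :: "'a::euclidean_space \<Rightarrow> real"
  assumes S: "open S" and x: "x \<in> S" and u: "smooth S u" and i: "i \<in> Basis" and j: "j \<in> Basis"
  shows "pderiv_dir j (pderiv_dir i u) x = pderiv_dir i (pderiv_dir j u) x"
proof -
  let ?P = "pderiv_dir j (pderiv_dir i u)" and ?Q = "pderiv_dir i (pderiv_dir j u)"
  have cont: "isCont ?P x" "isCont ?Q x"
    using smooth_continuous_on[OF smooth_pderiv_dir[OF smooth_pderiv_dir[OF u]]] S x i j
    by (auto simp: continuous_on_eq_continuous_at)
  have "\<bar>?P x - ?Q x\<bar> \<le> e" if e: "e > 0" for e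
  proof -
    obtain d1 where d1: "d1 > 0" "\<And>y. dist y x < d1 \<Longrightarrow> \<bar>?P y - ?P x\<bar> < e/2"
      using cont(1) e unfolding continuous_at_eps_delta dist_real_def by (metis half_gt_zero)
    obtain d2 where d2: "d2 > 0" "\<And>y. dist y x < d2 \<Longrightarrow> \<bar>?Q y - ?Q x\<bar> < e/2"
      using cont(2) e unfolding continuous_at_eps_delta dist_real_def by (metis half_gt_zero)
    obtain d3 where d3: "d3 > 0" "ball x d3 \<subseteq> S"
      using S x open_contains_ball by blast
    \<comment> \<open>Points of the square of side \<open>h\<close> lie within \<open>2 * h\<close>
      of \<open>x\<close>; the factor 3 makes the three distance conditions strict.\<close>
    define h where "h = min d1 (min d2 d3) / 3"
    have h: "h > 0" "3 * h \<le> d1" "3 * h \<le> d2" "3 * h \<le> d3"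
      using d1 d2 d3 by (auto simp: h_def)
    have near: "dist (x + a *\<^sub>R k + b *\<^sub>R l) x < 3 * h"
      if "0 \<le> a" "a \<le> h" "0 \<le> b" "b \<le> h" "k \<in> Basis" "l \<in> Basis" for a b and k l :: 'a
    proof -
      have "norm (a *\<^sub>R k + b *\<^sub>R l) \<le> a + b"
        using norm_triangle_ineq[of "a *\<^sub>R k" "b *\<^sub>R l"] that by simp
      moreover have "dist (x + a *\<^sub>R k + b *\<^sub>R l) x = norm (a *\<^sub>R k + b *\<^sub>R l)"
        by (simp add: dist_norm add.assoc)
      ultimately show ?thesis using that h by linarith
    qed
    have inS: "x + a *\<^sub>R k + b *\<^sub>R l \<in> S"
      if "0 \<le> a" "a \<le> h" "0 \<le> b" "b \<le> h" "k \<in> Basis" "l \<in> Basis" for a b k l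
      using near[OF that] d3 h by (auto simp: dist_commute)
    obtain a b where ab: "0 < a" "a < h" "0 < b" "b < h"
      "u (x + h *\<^sub>R i + h *\<^sub>R j) - u (x + h *\<^sub>R i) - u (x + h *\<^sub>R j) + u x =
        h\<^sup>2 * ?P (x + a *\<^sub>R i + b *\<^sub>R j)"
      using second_difference_mvt[OF u i h(1), of x j] inS i j
      by (metis pderiv_dir_def)
    obtain a' b' where ab': "0 < a'" "a' < h" "0 < b'" "b' < h"
      "u (x + h *\<^sub>R j + h *\<^sub>R i) - u (x + h *\<^sub>R j) - u (x + h *\<^sub>R i) + u x =
        h\<^sup>2 * ?Q (x + a' *\<^sub>R j + b' *\<^sub>R i)"
      using second_difference_mvt[OF u j h(1), of x i] inS i j
      by (metis pderiv_dir_def)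
    have "h\<^sup>2 * ?P (x + a *\<^sub>R i + b *\<^sub>R j) = h\<^sup>2 * ?Q (x + a' *\<^sub>R j + b' *\<^sub>R i)"
      using ab(5) ab'(5) by (simp only: add.assoc add.commute[of "h *\<^sub>R j" "h *\<^sub>R i"])
    then have "?P (x + a *\<^sub>R i + b *\<^sub>R j) = ?Q (x + a' *\<^sub>R j + b' *\<^sub>R i)"
      using h by simp
    moreover have "\<bar>?P (x + a *\<^sub>R i + b *\<^sub>R j) - ?P x\<bar> < e/2"
      using near[of a b i j] ab h i j by (intro d1) auto
    moreover have "\<bar>?Q (x + a' *\<^sub>R j + b' *\<^sub>R i) - ?Q x\<bar> < e/2"
      using near[of a' b' j i] ab' h i j by (intro d2) auto
    ultimately show ?thesis by linarith
  qed
  then have "\<bar>?P x - ?Q x\<bar> \<le> 0" by (rule field_le_epsilon[of _ 0, simplified])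
  then show ?thesis by simp
qed

section \<open>Vector fields as first order operators and their brackets\<close>

definition vf :: "('a::euclidean_space \<Rightarrow> 'a) \<Rightarrow> ('a \<Rightarrow> real) \<Rightarrow> 'a \<Rightarrow> real" where
  "vf V u x = frechet_derivative u (at x) (V x)"

lemma vf_eq_sum:
  "u differentiable at x \<Longrightarrow> vf V u x = (\<Sum>i\<in>Basis. (V x \<bullet> i) * pderiv_dir i u x)"
  by (simp add: vf_def frechet_derivative_eq_sum_pderiv_dir)

lemma smooth_vf:
  assumes "open S" "smooth S u" "\<And>i. i \<in> Basis \<Longrightarrow> smooth S (\<lambda>x. V x \<bullet> i)"
  shows "smooth S (vf V u)"
proof (rule smooth_cong[OF assms(1)])
  show "smooth S (\<lambda>x. \<Sum>i\<in>Basis. (V x \<bullet> i) * pderiv_dir i u x)"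
    by (intro smooth_sum smooth_mult assms smooth_pderiv_dir)
qed (simp add: vf_eq_sum smooth_differentiable[OF assms(2)])

lemma vf_eqI: "(u has_derivative u') (at x) \<Longrightarrow> vf V u x = u' (V x)"
  unfolding vf_def using frechet_derivative_at by force

text \<open>The second order parts of the two compositions agree by symmetry of mixed derivatives;
  what survives is \<open>u\<close> differentiated along the Lie bracket of the coefficient
  fields.\<close>

lemma vf_bracket:
  fixes u :: "'a::euclidean_space \<Rightarrow> real"
  assumes S: "open S" and x: "x \<in> S" and u: "smooth S u"
    and V: "(V has_derivative V') (at x)" and W: "(W has_derivative W') (at x)"
  shows "vf V (vf W u) x - vf W (vf V u) x = frechet_derivative u (at x) (W' (V x) - V' (W x))"
proof -
  have du: "u differentiable at y" if "y \<in> S" for y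
    using smooth_differentiable[OF u that] .
  have main: "vf V (vf W u) x = frechet_derivative u (at x) (W' (V x))
      + (\<Sum>i\<in>Basis. \<Sum>j\<in>Basis. (W x \<bullet> i) * (V x \<bullet> j) * pderiv_dir j (pderiv_dir i u) x)"
    if W: "(W has_derivative W') (at x)" for V W :: "'a \<Rightarrow> 'a" and W'
  proof -
    have p: "(pderiv_dir i u has_derivative frechet_derivative (pderiv_dir i u) (at x)) (at x)"
      if "i \<in> Basis" for i
      using smooth_has_derivative[OF smooth_pderiv_dir[OF u that] x] .
    have "((\<lambda>y. \<Sum>i\<in>Basis. (W y \<bullet> i) * pderiv_dir i u y) has_derivative
        (\<lambda>h. \<Sum>i\<in>Basis. (W x \<bullet> i) * frechet_derivative (pderiv_dir i u) (at x) h
            + (W' h \<bullet> i) * pderiv_dir i u x)) (at x)"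
      by (auto intro!: derivative_eq_intros W p)
    then have "(vf W u has_derivative
        (\<lambda>h. \<Sum>i\<in>Basis. (W x \<bullet> i) * frechet_derivative (pderiv_dir i u) (at x) h
            + (W' h \<bullet> i) * pderiv_dir i u x)) (at x)"
      by (rule has_derivative_transform_within_open[OF _ S x]) (simp add: vf_eq_sum du)
    from vf_eqI[OF this, of V] show ?thesis
      by (simp add: sum.distrib frechet_derivative_eq_sum_pderiv_dir[OF du[OF x]]
          frechet_derivative_eq_sum_pderiv_dir[OF smooth_differentiable[OF smooth_pderiv_dir[OF u] x]]
          sum_distrib_left mult.assoc)
  qed
  have "(\<Sum>i\<in>Basis. \<Sum>j\<in>Basis. (W x \<bullet> i) * (V x \<bullet> j) * pderiv_dir j (pderiv_dir i u) x)
      = (\<Sum>i\<in>Basis. \<Sum>j\<in>Basis. (V x \<bullet> i) * (W x \<bullet> j) * pderiv_dir j (pderiv_dir i u) x)"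
    by (subst sum.swap) (auto intro!: sum.cong simp: pderiv_dir_commute[OF S x u])
  then show ?thesis
    unfolding main[OF W, of V] main[OF V, of W]
    by (simp add: linear_diff[OF linear_frechet_derivative[OF du[OF x]]])
qed

lemma vf_cong: "open S \<Longrightarrow> x \<in> S \<Longrightarrow> (\<And>y. y \<in> S \<Longrightarrow> u y = v y) \<Longrightarrow> vf V u x = vf V v x"
  unfolding vf_def using frechet_derivative_cong_open by metis

lemma vf_const [simp]: "vf V (\<lambda>x. c) x = 0"
  by (simp add: vf_def)

lemma vf_add:
  "u differentiable at x \<Longrightarrow> v differentiable at x \<Longrightarrow> vf V (\<lambda>y. u y + v y) x = vf V u x + vf V v x"
  by (simp add: vf_def frechet_derivative_add)

lemma vf_diff:
  "u differentiable at x \<Longrightarrow> v differentiable at x \<Longrightarrow> vf V (\<lambda>y. u y - v y) x = vf V u x - vf V v x"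
  by (simp add: vf_def frechet_derivative_diff)

lemma vf_mult:
  "u differentiable at x \<Longrightarrow> v differentiable at x \<Longrightarrow>
    vf V (\<lambda>y. u y * v y) x = vf V u x * v x + u x * vf V v x"
  by (simp add: vf_def frechet_derivative_mult)

lemma vf_sum:
  assumes "\<And>i. i \<in> I \<Longrightarrow> u i differentiable at x"
  shows "vf V (\<lambda>y. \<Sum>i\<in>I. u i y) x = (\<Sum>i\<in>I. vf V (u i) x)"
proof -
  have "((\<lambda>y. \<Sum>i\<in>I. u i y) has_derivative (\<lambda>h. \<Sum>i\<in>I. frechet_derivative (u i) (at x) h)) (at x)"
    using assms by (intro has_derivative_sum) (simp add: frechet_derivative_works)
  from vf_eqI[OF this] show ?thesis by (simp add: vf_def)
qed

lemma vf_compose: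
  assumes "u differentiable at x" "(F has_real_derivative F') (at (u x))"
  shows "vf V (\<lambda>y. F (u y)) x = F' * vf V u x"
proof -
  have "((\<lambda>y. F (u y)) has_derivative (\<lambda>h. F' * frechet_derivative u (at x) h)) (at x)"
    using assms by (intro has_derivative_compose[of u _ x UNIV F])
       (auto simp: frechet_derivative_works has_field_derivative_def)
  from vf_eqI[OF this] show ?thesis by (simp add: vf_def)
qed

section \<open>Linear functions on Minkowski space and the divergence theorem\<close>

lemma integrable_lborel_compact_support:
  fixes F :: "'a::euclidean_space \<Rightarrow> real"
  assumes "continuous_on UNIV F" "compact K" "\<And>x. x \<notin> K \<Longrightarrow> F x = 0"
  shows "integrable lborel F"
proof -
  have "integrable lborel (\<lambda>x. indicator K x *\<^sub>R F x)"
    using assms by (intro borel_integrable_compact) (auto intro: continuous_on_subset)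
  also have "(\<lambda>x. indicator K x *\<^sub>R F x) = F"
    using assms(3) by (auto simp: indicator_def fun_eq_iff)
  finally show ?thesis .
qed

lemma pderiv_dir_eq_0_outside:
  assumes "closed K" "\<And>x. x \<notin> K \<Longrightarrow> F x = 0" "x \<notin> K"
  shows "pderiv_dir i F x = 0"
  using pderiv_dir_cong_open[of "- K" x F "\<lambda>_. 0" i] assms
  by (auto simp: pderiv_dir_def)

text \<open>The integral of the difference quotients vanishes by translation invariance.\<close>

lemma integral_pderiv_dir_eq_0:
  fixes F :: "'a::euclidean_space \<Rightarrow> real"
  assumes F: "smooth UNIV F" and K: "compact K" and out: "\<And>x. x \<notin> K \<Longrightarrow> F x = 0"
    and i: "i \<in> Basis"
  shows "(\<integral>x. pderiv_dir i F x \<partial>lborel) = 0"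
proof -
  define e where "e n = 1 / real (Suc n)" for n
  have e: "0 < e n" "e n \<le> 1" for n by (auto simp: e_def)
  define g where "g n x = (F (e n *\<^sub>R i + x) - F x) / e n" for n x
  have contF: "continuous_on UNIV F" and contP: "continuous_on UNIV (pderiv_dir i F)"
    using smooth_continuous_on F smooth_pderiv_dir i by blast+
  have intF: "integrable lborel F"
    by (rule integrable_lborel_compact_support[OF contF K out])
  have meas: "F \<in> borel_measurable borel" "pderiv_dir i F \<in> borel_measurable borel"
    using contF contP by (auto intro: borel_measurable_continuous_onI)
  have shift: "integrable lborel (\<lambda>x. F (c + x))" "(\<integral>x. F (c + x) \<partial>lborel) = (\<integral>x. F x \<partial>lborel)" for c
  proof -
    have "integrable (distr lborel borel ((+) c)) F" using intF by (simp add: lborel_distr_plus)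
    then show "integrable lborel (\<lambda>x. F (c + x))"
      by (subst (asm) integrable_distr_eq) (use meas in auto)
    have "(\<integral>x. F x \<partial>lborel) = (\<integral>x. F x \<partial>distr lborel borel ((+) c))" by (simp add: lborel_distr_plus)
    also have "\<dots> = (\<integral>x. F (c + x) \<partial>lborel)"
      by (subst integral_distr) (use meas in auto)
    finally show "(\<integral>x. F (c + x) \<partial>lborel) = (\<integral>x. F x \<partial>lborel)" ..
  qed
  have int0: "(\<integral>x. g n x \<partial>lborel) = 0" for n
    unfolding g_def using shift intF by simp
  have dF: "((\<lambda>t. F (t *\<^sub>R i + x)) has_real_derivative pderiv_dir i F (t *\<^sub>R i + x)) (at t)" for x t
  proof -
    have "((\<lambda>t. F (t *\<^sub>R i + x)) has_derivative
        (\<lambda>s. frechet_derivative F (at (t *\<^sub>R i + x)) (s *\<^sub>R i))) (at t)"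
      by (rule has_derivative_compose[where f = "\<lambda>t. t *\<^sub>R i + x" and g = F,
            OF _ smooth_has_derivative[OF F]]) (auto intro!: derivative_eq_intros)
    moreover have "linear (frechet_derivative F (at (t *\<^sub>R i + x)))"
      using smooth_differentiable[OF F] by (intro linear_frechet_derivative) auto
    ultimately show ?thesis
      by (simp add: has_field_derivative_def linear_scale pderiv_dir_def
          mult.commute[of _ "frechet_derivative F _ i"])
  qed
  obtain R where R: "\<And>x. x \<in> K \<Longrightarrow> norm x \<le> R"
    using compact_imp_bounded[OF K] by (auto simp: bounded_iff)
  obtain M where M0: "\<And>x. x \<in> K \<Longrightarrow> \<bar>pderiv_dir i F x\<bar> \<le> M"
    using compact_imp_bounded[OF compact_continuous_image[OF continuous_on_subset[OF contP] K]]
    by (auto simp: bounded_iff)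
  have M: "\<bar>pderiv_dir i F x\<bar> \<le> \<bar>M\<bar>" for x
    using M0[of x] pderiv_dir_eq_0_outside[where F = F, OF compact_imp_closed[OF K] out, of x i]
    by (cases "x \<in> K") auto
  \<comment> \<open>By the mean value theorem the quotient is a value of the derivative, and shifts
    of length at most 1 enlarge the support by at most 1. This gives a dominating function
    independent of \<open>n\<close>.\<close>
  have bound: "norm (g n x) \<le> indicator (cball 0 (R + 1)) x *\<^sub>R \<bar>M\<bar>" for n x
  proof (cases "x \<in> cball 0 (R + 1)")
    case True
    obtain t where "F (e n *\<^sub>R i + x) - F (0 *\<^sub>R i + x) = (e n - 0) * pderiv_dir i F (t *\<^sub>R i + x)"
      using MVT2[of 0 "e n" "\<lambda>t. F (t *\<^sub>R i + x)" "\<lambda>t. pderiv_dir i F (t *\<^sub>R i + x)"] e dF by blast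
    then have "g n x = pderiv_dir i F (t *\<^sub>R i + x)"
      using e[of n] by (simp add: g_def)
    then show ?thesis using M True by simp
  next
    case False
    have "norm x \<le> norm (e n *\<^sub>R i + x) + norm (e n *\<^sub>R i)"
      using norm_triangle_ineq4[of "e n *\<^sub>R i + x" "e n *\<^sub>R i"] by simp
    then have "norm x \<le> norm (e n *\<^sub>R i + x) + 1"
      using i e[of n] by simp
    then have "e n *\<^sub>R i + x \<notin> K" "x \<notin> K" using R[of "e n *\<^sub>R i + x"] R[of x] False by auto
    then show ?thesis by (simp add: g_def out)
  qed
  have e0: "e \<longlonglongrightarrow> 0"
    unfolding e_def using LIMSEQ_inverse_real_of_nat by (simp add: inverse_eq_divide)
  have lim: "(\<lambda>n. g n x) \<longlonglongrightarrow> pderiv_dir i F x" for x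
  proof -
    have "((\<lambda>h. (F ((0 + h) *\<^sub>R i + x) - F (0 *\<^sub>R i + x)) / h) \<longlongrightarrow> pderiv_dir i F (0 *\<^sub>R i + x)) (at 0)"
      using dF[of x 0] unfolding DERIV_def .
    moreover have "filterlim e (at 0) sequentially"
      using e0 e(1) by (auto simp: filterlim_at intro!: always_eventually less_imp_neq[symmetric])
    ultimately show ?thesis
      by (auto simp: g_def dest: filterlim_compose)
  qed
  have "(\<lambda>n. \<integral>x. g n x \<partial>lborel) \<longlonglongrightarrow> (\<integral>x. pderiv_dir i F x \<partial>lborel)"
  proof (rule integral_dominated_convergence[where w = "\<lambda>x. indicator (cball 0 (R + 1)) x *\<^sub>R \<bar>M\<bar>"])
    show "integrable lborel (\<lambda>x::'a. indicator (cball 0 (R + 1)) x *\<^sub>R \<bar>M\<bar>)"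
      by (rule borel_integrable_compact) auto
    show "g n \<in> borel_measurable lborel" for n
      unfolding g_def using meas by measurable
  qed (use meas lim bound in auto)
  then have "(\<lambda>n::nat. 0) \<longlonglongrightarrow> (\<integral>x. pderiv_dir i F x \<partial>lborel)"
    unfolding int0 .
  then show ?thesis by (simp add: LIMSEQ_const_iff)
qed

text \<open>The Lorentz pairing of the vectors (\<alpha>, w) and (\<beta>, v), with the time
  component written first.\<close>

definition mink_form :: "real \<Rightarrow> 'a::euclidean_space \<Rightarrow> real \<Rightarrow> 'a \<Rightarrow> real" where
  "mink_form \<alpha> w \<beta> v = w \<bullet> v - \<alpha> * \<beta>"

text \<open>The ball embeds into the unit hyperboloid of Minkowski space as
  \<open>x \<mapsto> (1 + |x|\<^sup>2, 2 x) / (1 - |x|\<^sup>2)\<close>.  Linear functions on Minkowski space restrict to the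
  functions \<open>mink_fun \<alpha> w\<close>, and \<open>mink_vec \<alpha> w\<close> is the hyperbolic gradient of \<open>mink_fun \<alpha> w\<close>.\<close>

definition mink_fun :: "real \<Rightarrow> 'a::euclidean_space \<Rightarrow> 'a \<Rightarrow> real" where
  "mink_fun \<alpha> w x = (\<alpha> * (1 + x \<bullet> x) + 2 * (w \<bullet> x)) / (1 - x \<bullet> x)"

definition mink_vec :: "real \<Rightarrow> 'a::euclidean_space \<Rightarrow> 'a \<Rightarrow> 'a" where
  "mink_vec \<alpha> w x = (1/2) *\<^sub>R ((1 - x \<bullet> x) *\<^sub>R w + (2 * (\<alpha> + w \<bullet> x)) *\<^sub>R x)"

section \<open>Derivatives, brackets and divergences of the Minkowski gradients\<close>

lemma inner_self_less_1:
  fixes x :: "'a::euclidean_space"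
  shows "norm x < 1 \<Longrightarrow> x \<bullet> x < 1"
  by (simp add: power2_norm_eq_inner[symmetric] abs_square_less_1)

lemma conf_factor_alt: "conf_factor x = 2 / (1 - x \<bullet> x)"
  by (simp add: conf_factor_def power2_norm_eq_inner)

lemma conf_factor_pos: "norm x < 1 \<Longrightarrow> conf_factor x > 0"
  using inner_self_less_1[of x] by (simp add: conf_factor_alt)

lemma conf_factor_has_derivative:
  assumes "norm x < 1"
  shows "(conf_factor has_derivative (\<lambda>h. (conf_factor x)\<^sup>2 * (x \<bullet> h))) (at x)"
proof -
  have n: "1 - x \<bullet> x \<noteq> 0" using inner_self_less_1[OF assms] by simp
  have "((\<lambda>x. 2 / (1 - x \<bullet> x)) has_derivative (\<lambda>h. (conf_factor x)\<^sup>2 * (x \<bullet> h))) (at x)"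
    by (rule derivative_eq_intros refl n)+
       (use n in \<open>auto simp: fun_eq_iff conf_factor_alt divide_simps power2_eq_square inner_commute\<close>)
  then show ?thesis by (simp add: conf_factor_alt[abs_def])
qed

lemma mink_fun_has_derivative:
  assumes "norm x < 1"
  shows "(mink_fun \<alpha> w has_derivative (\<lambda>h. (conf_factor x)\<^sup>2 * (mink_vec \<alpha> w x \<bullet> h))) (at x)"
proof -
  have n: "1 - x \<bullet> x \<noteq> 0" using inner_self_less_1[OF assms] by simp
  have "((\<lambda>x. (\<alpha> * (1 + x \<bullet> x) + 2 * (w \<bullet> x)) / (1 - x \<bullet> x)) has_derivative
      (\<lambda>h. ((\<alpha> * (2 * (x \<bullet> h)) + 2 * (w \<bullet> h)) * (1 - x \<bullet> x)
         - (\<alpha> * (1 + x \<bullet> x) + 2 * (w \<bullet> x)) * (- (2 * (x \<bullet> h)))) / ((1 - x \<bullet> x) * (1 - x \<bullet> x)))) (at x)"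
    by (rule derivative_eq_intros refl n)+ (simp add: fun_eq_iff inner_commute)
  also have "(\<lambda>h. ((\<alpha> * (2 * (x \<bullet> h)) + 2 * (w \<bullet> h)) * (1 - x \<bullet> x)
         - (\<alpha> * (1 + x \<bullet> x) + 2 * (w \<bullet> x)) * (- (2 * (x \<bullet> h)))) / ((1 - x \<bullet> x) * (1 - x \<bullet> x)))
      = (\<lambda>h. (conf_factor x)\<^sup>2 * (mink_vec \<alpha> w x \<bullet> h))"
    using n by (simp add: fun_eq_iff conf_factor_alt mink_vec_def power2_eq_square inner_add_left
        divide_simps) (simp add: algebra_simps)
  finally show ?thesis by (simp add: mink_fun_def[abs_def])
qed

lemma mink_vec_has_derivative:
  "(mink_vec \<alpha> w has_derivative
     (\<lambda>h. (w \<bullet> h) *\<^sub>R x + (\<alpha> + w \<bullet> x) *\<^sub>R h - (x \<bullet> h) *\<^sub>R w)) (at x)"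
  unfolding mink_vec_def
  by (rule derivative_eq_intros refl)+
     (auto simp: fun_eq_iff inner_commute scaleR_add_right scaleR_diff_right algebra_simps
       simp flip: scaleR_add_left)

text \<open>On the hyperboloid the gradient of a linear function is the tangential projection of a
  constant vector. The position vector has square -1, so projecting adds the product of the two
  functions to the pairing of the constant vectors.\<close>

lemma vf_mink_vec_mink_fun:
  assumes "norm x < 1"
  shows "vf (mink_vec \<alpha> w) (mink_fun \<beta> v) x
    = mink_form \<alpha> w \<beta> v + mink_fun \<alpha> w x * mink_fun \<beta> v x"
proof -
  have n: "1 - x \<bullet> x \<noteq> 0" using inner_self_less_1[OF assms] by simp
  show ?thesis
    unfolding vf_eqI[OF mink_fun_has_derivative[OF assms]] conf_factor_alt mink_form_def mink_fun_def
    using n by (simp add: mink_vec_def inner_add_left inner_add_right inner_commute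
        divide_simps power2_eq_square) (simp add: algebra_simps)
qed

text \<open>The Hessian of a linear function restricted to the hyperboloid is the function times the
  metric. Differentiating one gradient along another therefore just multiplies by the function, and
  the bracket is the difference of two such terms.\<close>

lemma vf_mink_vec_bracket:
  assumes S: "open S" "S \<subseteq> ball 0 1" and x: "x \<in> S" and u: "smooth S u"
  shows "vf (mink_vec \<alpha> w) (vf (mink_vec \<beta> v) u) x - vf (mink_vec \<beta> v) (vf (mink_vec \<alpha> w) u) x
    = mink_fun \<beta> v x * vf (mink_vec \<alpha> w) u x - mink_fun \<alpha> w x * vf (mink_vec \<beta> v) u x"
proof -
  have x1: "norm x < 1" using S x by auto
  then have n: "1 - x \<bullet> x \<noteq> 0" using inner_self_less_1[of x] by simp
  let ?V = "mink_vec \<alpha> w x" and ?W = "mink_vec \<beta> v x"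
  let ?L = "(v \<bullet> ?V) *\<^sub>R x + (\<beta> + v \<bullet> x) *\<^sub>R ?V - (x \<bullet> ?V) *\<^sub>R v
    - ((w \<bullet> ?W) *\<^sub>R x + (\<alpha> + w \<bullet> x) *\<^sub>R ?W - (x \<bullet> ?W) *\<^sub>R w)"
  let ?R = "mink_fun \<beta> v x *\<^sub>R ?V - mink_fun \<alpha> w x *\<^sub>R ?W"
  have "?L \<bullet> i = ?R \<bullet> i" for i
  proof -
    \<comment> \<open>With the scalar products named, the vector identity becomes, component by
      component, a rational identity in independent variables.\<close>
    define q a b c wi vi xi where "q = x \<bullet> x" and "a = w \<bullet> x" and "b = v \<bullet> x" and "c = w \<bullet> v"
      and "wi = w \<bullet> i" and "vi = v \<bullet> i" and "xi = x \<bullet> i"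
    have e: "x \<bullet> x = q" "w \<bullet> x = a" "x \<bullet> w = a" "v \<bullet> x = b" "x \<bullet> v = b" "w \<bullet> v = c" "v \<bullet> w = c"
      "w \<bullet> i = wi" "v \<bullet> i = vi" "x \<bullet> i = xi"
      by (simp_all add: q_def a_def b_def c_def wi_def vi_def xi_def inner_commute)
    show ?thesis
      using n unfolding mink_fun_def mink_vec_def
      by (simp add: e inner_add_left inner_add_right inner_diff_left divide_simps) (simp add: algebra_simps)
  qed
  then have "?L = ?R" by (rule euclidean_eqI)
  moreover have "linear (frechet_derivative u (at x))"
    using smooth_differentiable[OF u x] by (rule linear_frechet_derivative)
  ultimately show ?thesis
    unfolding vf_bracket[OF S(1) x u mink_vec_has_derivative mink_vec_has_derivative]
    by (simp add: vf_def linear_diff linear_scale)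
qed

lemma inner_has_derivative_mink_vec:
  "((\<lambda>x. mink_vec \<alpha> w x \<bullet> i) has_derivative
     (\<lambda>h. ((w \<bullet> h) *\<^sub>R x + (\<alpha> + w \<bullet> x) *\<^sub>R h - (x \<bullet> h) *\<^sub>R w) \<bullet> i)) (at x)"
  by (rule has_derivative_inner_left[OF mink_vec_has_derivative])

lemma euclidean_divergence_mink_vec:
  fixes x :: "'a::euclidean_space"
  shows "(\<Sum>i\<in>Basis. pderiv_dir i (\<lambda>x. mink_vec \<alpha> w x \<bullet> i) x) = real DIM('a) * (\<alpha> + w \<bullet> x)"
proof -
  have "(\<Sum>i\<in>Basis. pderiv_dir i (\<lambda>x. mink_vec \<alpha> w x \<bullet> i) x)
      = (\<Sum>i\<in>Basis. (w \<bullet> i) * (x \<bullet> i) + (\<alpha> + w \<bullet> x) - (x \<bullet> i) * (w \<bullet> i))"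
    by (intro sum.cong refl)
       (simp add: pderiv_dir_eq[OF inner_has_derivative_mink_vec] inner_diff_left inner_add_left)
  then show ?thesis by (simp add: mult.commute)
qed

text \<open>The factor \<open>DIM('a) * mink_fun \<alpha> w\<close> is the Laplacian of the linear
  function, the trace of its Hessian. The volume density stays inside the derivatives so that the
  left side is a sum of Euclidean partial derivatives, whose integrals vanish.\<close>

lemma conf_factor_divergence:
  fixes x :: "'a::euclidean_space"
  assumes "norm x < 1" and f: "f differentiable at x"
  shows "(\<Sum>i\<in>Basis. pderiv_dir i (\<lambda>y. conf_factor y ^ DIM('a) * (f y * (mink_vec \<alpha> w y \<bullet> i))) x)
    = conf_factor x ^ DIM('a) * (vf (mink_vec \<alpha> w) f x + real DIM('a) * mink_fun \<alpha> w x * f x)"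
proof -
  let ?N = "DIM('a)" and ?c = "conf_factor x" and ?V = "mink_vec \<alpha> w"
  let ?D = "\<lambda>h. (w \<bullet> h) *\<^sub>R x + (\<alpha> + w \<bullet> x) *\<^sub>R h - (x \<bullet> h) *\<^sub>R w"
  have n: "1 - x \<bullet> x \<noteq> 0" using inner_self_less_1[OF assms(1)] by simp
  note c = has_derivative_power[OF conf_factor_has_derivative[OF assms(1)], of ?N]
  have f': "(f has_derivative frechet_derivative f (at x)) (at x)"
    using f by (simp flip: frechet_derivative_works)
  have pow: "real ?N * (?c\<^sup>2 * k) * ?c ^ (?N - 1) = real ?N * ?c * ?c ^ ?N * k" for k
    by (simp add: power_eq_if[of _ ?N] power2_eq_square)
  have fi: "pderiv_dir i f x = frechet_derivative f (at x) i" for i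
    by (simp add: pderiv_dir_def)
  have "pderiv_dir i (\<lambda>y. conf_factor y ^ ?N * (f y * (?V y \<bullet> i))) x =
     ?c ^ ?N * ((?V x \<bullet> i) * pderiv_dir i f x + f x * pderiv_dir i (\<lambda>y. ?V y \<bullet> i) x
       + real ?N * ?c * f x * ((x \<bullet> i) * (?V x \<bullet> i)))" for i
    unfolding pderiv_dir_eq[OF has_derivative_mult[OF c has_derivative_mult[OF f' inner_has_derivative_mink_vec]]]
      pderiv_dir_eq[OF inner_has_derivative_mink_vec] fi pow
    by (simp add: algebra_simps)
  then have "(\<Sum>i\<in>Basis. pderiv_dir i (\<lambda>y. conf_factor y ^ ?N * (f y * (?V y \<bullet> i))) x)
    = ?c ^ ?N * (vf ?V f x + f x * (real ?N * (\<alpha> + w \<bullet> x)) + real ?N * ?c * f x * (x \<bullet> ?V x))"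
    by (simp add: sum_distrib_left[symmetric] sum.distrib vf_eq_sum[OF f]
        euclidean_divergence_mink_vec euclidean_inner[of x "?V x"])
  moreover have "f x * (real ?N * (\<alpha> + w \<bullet> x)) + real ?N * ?c * f x * (x \<bullet> ?V x)
      = real ?N * mink_fun \<alpha> w x * f x"
    using n by (simp add: conf_factor_alt mink_fun_def mink_vec_def inner_add_right inner_commute
        divide_simps) (simp add: algebra_simps)
  ultimately show ?thesis by (simp add: add.assoc)
qed

lemma hyp_div_mink_vec:
  fixes x :: "'a::euclidean_space"
  assumes "norm x < 1" "f differentiable at x"
  shows "hyp_div (\<lambda>y. f y *\<^sub>R mink_vec \<alpha> w y) x =
    vf (mink_vec \<alpha> w) f x + real DIM('a) * mink_fun \<alpha> w x * f x"
  using conf_factor_divergence[OF assms, of \<alpha> w] conf_factor_pos[OF assms(1)]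
  by (simp add: hyp_div_def)

lemma smooth_inner_self:
  assumes "open S"
  shows "smooth S (\<lambda>x. x \<bullet> x)"
proof (rule smooth_cong[OF assms])
  show "smooth S (\<lambda>x::'a::euclidean_space. \<Sum>i\<in>Basis. (x \<bullet> i) * (x \<bullet> i))"
    using assms by (intro smooth_sum smooth_mult smooth_inner)
  show "(\<Sum>i\<in>Basis. (x \<bullet> i) * (x \<bullet> i)) = x \<bullet> x" for x :: 'a
    by (rule euclidean_inner[symmetric])
qed

lemma smooth_mink_fun:
  assumes "open S" "S \<subseteq> ball 0 1"
  shows "smooth S (mink_fun \<alpha> w)"
proof -
  have q: "smooth S (\<lambda>x. x \<bullet> x)" using assms(1) by (rule smooth_inner_self)
  have w: "smooth S (\<lambda>x. w \<bullet> x)"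
    using smooth_inner[OF assms(1), of w] by (simp add: inner_commute)
  show ?thesis
    unfolding mink_fun_def[abs_def] using assms
    by (intro smooth_divide smooth_add smooth_mult smooth_diff smooth_const q w)
       (auto intro!: inner_self_less_1)
qed

lemma smooth_mink_vec_inner:
  assumes "open S"
  shows "smooth S (\<lambda>x. mink_vec \<alpha> w x \<bullet> i)"
proof -
  have q: "smooth S (\<lambda>x. x \<bullet> x)" using assms by (rule smooth_inner_self)
  have w: "smooth S (\<lambda>x. w \<bullet> x)"
    using smooth_inner[OF assms, of w] by (simp add: inner_commute)
  have "smooth S (\<lambda>x. 1/2 * ((1 - x \<bullet> x) * (w \<bullet> i) + 2 * (\<alpha> + w \<bullet> x) * (x \<bullet> i)))"
    using assms by (intro smooth_add smooth_mult smooth_diff smooth_const q w smooth_inner)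
  then show ?thesis by (simp add: mink_vec_def inner_add_left)
qed

lemma smooth_conf_factor:
  assumes "open S" "S \<subseteq> ball 0 1"
  shows "smooth S conf_factor"
proof -
  have q: "smooth S (\<lambda>x. x \<bullet> x)" using assms(1) by (rule smooth_inner_self)
  show ?thesis
    unfolding conf_factor_alt[abs_def] using assms
    by (intro smooth_divide smooth_diff smooth_const q) (auto intro!: inner_self_less_1)
qed

lemma smooth_vf_mink_vec: "open S \<Longrightarrow> smooth S u \<Longrightarrow> smooth S (vf (mink_vec \<alpha> w) u)"
  by (intro smooth_vf smooth_mink_vec_inner)

section \<open>Compactly supported functions off the pole and the hyperbolic integral\<close>

definition punctured :: "'a::euclidean_space \<Rightarrow> 'a set" where
  "punctured x0 = ball 0 1 - {x0}"

lemma open_punctured: "open (punctured x0)"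
  by (auto simp: punctured_def)

lemma punctured_norm: "x \<in> punctured x0 \<Longrightarrow> norm x < 1"
  by (auto simp: punctured_def)

text \<open>Nothing is asked of \<open>f\<close> at the pole or outside the ball, where the
  operators below take arbitrary values. \<open>ext_zero\<close> supplies the globally smooth
  representative whenever one is needed.\<close>

definition cpt_smooth :: "'a::euclidean_space \<Rightarrow> ('a \<Rightarrow> real) \<Rightarrow> bool" where
  "cpt_smooth x0 f \<longleftrightarrow> smooth (punctured x0) f \<and>
     (\<exists>K. compact K \<and> K \<subseteq> punctured x0 \<and> (\<forall>x\<in>punctured x0 - K. f x = 0))"

definition ext_zero :: "'a::euclidean_space \<Rightarrow> ('a \<Rightarrow> real) \<Rightarrow> 'a \<Rightarrow> real" where
  "ext_zero x0 f x = (if x \<in> punctured x0 then f x else 0)"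

lemma smooth_ext_zero:
  assumes "smooth (punctured x0) f" "compact K" "K \<subseteq> punctured x0" "\<And>x. x \<in> punctured x0 - K \<Longrightarrow> f x = 0"
  shows "smooth UNIV (ext_zero x0 f)"
proof (rule smooth_UnivI[OF open_punctured compact_imp_closed[OF assms(2)] assms(3)])
  show "smooth (punctured x0) (ext_zero x0 f)"
    by (rule smooth_cong[OF open_punctured assms(1)]) (simp add: ext_zero_def)
qed (use assms in \<open>auto simp: ext_zero_def\<close>)

lemma hyp_vol_integral_cpt_smooth:
  fixes f :: "'a::euclidean_space \<Rightarrow> real"
  assumes "cpt_smooth x0 f"
  shows "integrable hyp_vol f"
    and "(\<integral>x. f x \<partial>hyp_vol) = (\<integral>x. ext_zero x0 (\<lambda>x. conf_factor x ^ DIM('a) * f x) x \<partial>lborel)"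
proof -
  let ?N = "DIM('a)" and ?B = "ball 0 1 :: 'a set"
  obtain K where K: "compact K" "K \<subseteq> punctured x0" "\<And>x. x \<in> punctured x0 - K \<Longrightarrow> f x = 0"
    and f: "smooth (punctured x0) f"
    using assms unfolding cpt_smooth_def by blast
  let ?g = "\<lambda>x. conf_factor x ^ ?N * f x"
  have g: "smooth UNIV (ext_zero x0 ?g)"
    by (rule smooth_ext_zero[OF _ K(1,2)])
       (auto intro!: smooth_mult smooth_power smooth_conf_factor f open_punctured simp: K(3)
          dest: punctured_norm)
  have gi: "integrable lborel (ext_zero x0 ?g)"
    by (rule integrable_lborel_compact_support[OF smooth_continuous_on[OF g] K(1)])
       (use K in \<open>auto simp: ext_zero_def\<close>)
  have mc: "(\<lambda>x::'a. conf_factor x ^ ?N) \<in> borel_measurable borel"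
    unfolding conf_factor_def by measurable
  have mf: "ext_zero x0 f \<in> borel_measurable borel"
    by (rule borel_measurable_continuous_onI[OF smooth_continuous_on[OF smooth_ext_zero[OF f K]]])
  \<comment> \<open>Outside the ball \<open>f\<close> is arbitrary and may fail to be Borel.
    \<open>f1\<close> agrees with \<open>f\<close> on the whole ball, including its arbitrary value
    at the pole, and is Borel because it differs from a continuous function in at most one
    point.\<close>
  define f1 where "f1 x = (if x = x0 then f x0 else ext_zero x0 f x)" for x
  have m1: "f1 \<in> borel_measurable borel"
    unfolding f1_def using mf by measurable
  have ff1: "f x = f1 x" if "x \<in> ?B" for x
    using that by (simp add: f1_def ext_zero_def punctured_def)
  have ae: "AE x in lborel. indicator ?B x *\<^sub>R (conf_factor x ^ ?N * f1 x) = ext_zero x0 ?g x"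
    using AE_lborel_singleton[of x0]
    by eventually_elim (auto simp: indicator_def f1_def ext_zero_def punctured_def)
  have mg: "ext_zero x0 ?g \<in> borel_measurable borel"
    by (rule borel_measurable_continuous_onI[OF smooth_continuous_on[OF g]])
  have mi: "(\<lambda>x. indicator ?B x *\<^sub>R (conf_factor x ^ ?N * f1 x)) \<in> borel_measurable borel"
    using mc m1 by (intro borel_measurable_scaleR borel_measurable_times borel_measurable_indicator) auto
  have cpos: "0 \<le> conf_factor x ^ ?N" if "x \<in> space (restrict_space lborel hyp_space)" for x :: 'a
    using that conf_factor_pos[of x] by (auto simp: hyp_space_def space_restrict_space)
  have mR: "h \<in> borel_measurable (restrict_space lborel hyp_space)" if "h \<in> borel_measurable borel"
    for h :: "'a \<Rightarrow> real"
    using that by (intro measurable_restrict_space1) simp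
  have aeR: "AE x in restrict_space lborel hyp_space. 0 \<le> conf_factor (x::'a) ^ ?N"
    using cpos by (rule AE_I2)
  have sp: "space (hyp_vol :: 'a measure) = ?B"
    by (simp add: hyp_vol_def hyp_space_def space_restrict_space)
  have eqi: "integrable hyp_vol f \<longleftrightarrow> integrable hyp_vol f1"
    by (rule Bochner_Integration.integrable_cong) (auto simp: sp ff1)
  have "integrable hyp_vol f1 \<longleftrightarrow>
      integrable (restrict_space lborel hyp_space) (\<lambda>x. conf_factor x ^ ?N * f1 x)"
    unfolding hyp_vol_def using integrable_density[OF mR[OF m1] mR[OF mc] aeR] by simp
  also have "\<dots> \<longleftrightarrow> integrable lborel (\<lambda>x. indicator ?B x *\<^sub>R (conf_factor x ^ ?N * f1 x))"
    by (subst integrable_restrict_space) (auto simp: hyp_space_def)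
  also have "\<dots> \<longleftrightarrow> integrable lborel (ext_zero x0 ?g)"
    by (rule integrable_cong_AE) (use ae mi mg in auto)
  finally show "integrable hyp_vol f" using gi eqi by simp
  have "(\<integral>x. f x \<partial>hyp_vol) = (\<integral>x. f1 x \<partial>hyp_vol)"
    by (rule Bochner_Integration.integral_cong) (auto simp: sp ff1)
  also have "\<dots> = (\<integral>x. conf_factor x ^ ?N * f1 x \<partial>restrict_space lborel hyp_space)"
    unfolding hyp_vol_def using integral_density[OF mR[OF m1] mR[OF mc] aeR] by simp
  also have "\<dots> = (\<integral>x. indicator ?B x *\<^sub>R (conf_factor x ^ ?N * f1 x) \<partial>lborel)"
    by (subst integral_restrict_space) (auto simp: hyp_space_def)
  also have "\<dots> = (\<integral>x. ext_zero x0 ?g x \<partial>lborel)"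
    by (rule integral_cong_AE) (use ae mi mg in auto)
  finally show "(\<integral>x. f x \<partial>hyp_vol) = (\<integral>x. ext_zero x0 ?g x \<partial>lborel)" .
qed

lemma cpt_smooth_congD: "cpt_smooth x0 f \<Longrightarrow> (\<And>x. x \<in> punctured x0 \<Longrightarrow> f x = g x) \<Longrightarrow> cpt_smooth x0 g"
  unfolding cpt_smooth_def using smooth_cong[OF open_punctured] by (metis DiffD1)

text \<open>The pole is a null set and the measure does not see the outside of the ball; the second
  function inherits its regularity from the first.\<close>

lemma hyp_vol_integral_cong:
  assumes "cpt_smooth x0 f" "\<And>x. x \<in> punctured x0 \<Longrightarrow> f x = g x"
  shows "(\<integral>x. f x \<partial>hyp_vol) = (\<integral>x. g x \<partial>hyp_vol)"
proof -
  have "ext_zero x0 (\<lambda>x. conf_factor x ^ DIM('a) * f x) = ext_zero x0 (\<lambda>x. conf_factor x ^ DIM('a) * g x)"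
    by (auto simp: ext_zero_def assms(2))
  then show ?thesis
    using hyp_vol_integral_cpt_smooth(2)[OF assms(1)] hyp_vol_integral_cpt_smooth(2)[OF cpt_smooth_congD[OF assms]]
    by simp
qed

lemma hyp_vol_integral_nonneg:
  fixes f :: "'a::euclidean_space \<Rightarrow> real"
  assumes "cpt_smooth x0 f" "\<And>x. x \<in> punctured x0 \<Longrightarrow> f x \<ge> 0"
  shows "(\<integral>x. f x \<partial>hyp_vol) \<ge> 0"
  unfolding hyp_vol_integral_cpt_smooth(2)[OF assms(1)]
  by (intro integral_nonneg_AE AE_I2)
     (auto simp: ext_zero_def intro!: mult_nonneg_nonneg zero_le_power less_imp_le[OF conf_factor_pos]
        assms(2) dest: punctured_norm)

lemma hyp_vol_integral_mono:
  assumes "cpt_smooth x0 f" "cpt_smooth x0 g" "\<And>x. x \<in> punctured x0 \<Longrightarrow> f x \<le> g x"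
    "cpt_smooth x0 (\<lambda>x. g x - f x)"
  shows "(\<integral>x. f x \<partial>hyp_vol) \<le> (\<integral>x. g x \<partial>hyp_vol)"
  using hyp_vol_integral_nonneg[OF assms(4)] assms(3) hyp_vol_integral_cpt_smooth(1)[OF assms(1)]
    hyp_vol_integral_cpt_smooth(1)[OF assms(2)] by simp

lemma cpt_smooth_mult_left:
  assumes "cpt_smooth x0 f" "smooth (punctured x0) g"
  shows "cpt_smooth x0 (\<lambda>x. g x * f x)"
  using assms unfolding cpt_smooth_def by (auto intro!: smooth_mult open_punctured)

lemma cpt_smooth_add:
  assumes "cpt_smooth x0 f" "cpt_smooth x0 g"
  shows "cpt_smooth x0 (\<lambda>x. f x + g x)"
proof -
  obtain K L where "compact K" "K \<subseteq> punctured x0" "\<forall>x\<in>punctured x0 - K. f x = 0"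
    "compact L" "L \<subseteq> punctured x0" "\<forall>x\<in>punctured x0 - L. g x = 0"
    using assms unfolding cpt_smooth_def by blast
  then show ?thesis
    using assms unfolding cpt_smooth_def
    by (auto intro!: smooth_add open_punctured exI[of _ "K \<union> L"])
qed

lemma cpt_smooth_zero: "cpt_smooth x0 (\<lambda>x. 0)"
  unfolding cpt_smooth_def by (auto intro!: exI[of _ "{}"])

lemma cpt_smooth_sum:
  assumes "\<And>i. i \<in> I \<Longrightarrow> cpt_smooth x0 (f i)"
  shows "cpt_smooth x0 (\<lambda>x. \<Sum>i\<in>I. f i x)"
  using assms by (induction I rule: infinite_finite_induct) (auto intro: cpt_smooth_add cpt_smooth_zero)

lemma cpt_smooth_vf:
  assumes "cpt_smooth x0 f" "\<And>i. i \<in> Basis \<Longrightarrow> smooth (punctured x0) (\<lambda>x. V x \<bullet> i)"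
  shows "cpt_smooth x0 (vf V f)"
proof -
  obtain K where K: "compact K" "K \<subseteq> punctured x0" "\<forall>x\<in>punctured x0 - K. f x = 0"
    and f: "smooth (punctured x0) f"
    using assms(1) unfolding cpt_smooth_def by blast
  have "vf V f x = 0" if "x \<in> punctured x0 - K" for x
    using vf_cong[of "punctured x0 - K" x f "\<lambda>_. 0" V] that K open_punctured[of x0]
    by (auto simp: compact_imp_closed open_Diff)
  then show ?thesis
    unfolding cpt_smooth_def using K smooth_vf[OF open_punctured f assms(2)] by blast
qed

lemma integral_divergence_mink_vec:
  fixes f :: "'a::euclidean_space \<Rightarrow> real"
  assumes "cpt_smooth x0 f"
  shows "(\<integral>x. vf (mink_vec \<alpha> w) f x + real DIM('a) * mink_fun \<alpha> w x * f x \<partial>hyp_vol) = 0"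
proof -
  let ?N = "DIM('a)" and ?V = "mink_vec \<alpha> w"
  let ?h = "\<lambda>x. vf ?V f x + real ?N * mink_fun \<alpha> w x * f x"
  have sub: "punctured x0 \<subseteq> ball 0 1" by (auto simp: punctured_def)
  obtain K where K: "compact K" "K \<subseteq> punctured x0" "\<And>x. x \<in> punctured x0 - K \<Longrightarrow> f x = 0"
    and f: "smooth (punctured x0) f"
    using assms unfolding cpt_smooth_def by blast
  have h: "cpt_smooth x0 ?h"
    by (intro cpt_smooth_add cpt_smooth_vf cpt_smooth_mult_left assms smooth_mink_vec_inner
        smooth_mult smooth_const smooth_mink_fun open_punctured sub)
  define G where "G i = ext_zero x0 (\<lambda>y. conf_factor y ^ ?N * (f y * (?V y \<bullet> i)))" for i
  have G: "smooth UNIV (G i)" for i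
    unfolding G_def
    by (rule smooth_ext_zero[OF _ K(1,2)])
       (auto intro!: smooth_mult smooth_power smooth_conf_factor smooth_mink_vec_inner f
          open_punctured sub simp: K(3))
  have Gout: "G i x = 0" if "x \<notin> K" for i x
    using that K by (auto simp: G_def ext_zero_def)
  have "ext_zero x0 (\<lambda>x. conf_factor x ^ ?N * ?h x) x = (\<Sum>i\<in>Basis. pderiv_dir i (G i) x)" for x
  proof (cases "x \<in> punctured x0")
    case True
    have "pderiv_dir i (G i) x = pderiv_dir i (\<lambda>y. conf_factor y ^ ?N * (f y * (?V y \<bullet> i))) x" for i
      by (rule pderiv_dir_cong_open[OF open_punctured True]) (simp add: G_def ext_zero_def)
    then show ?thesis
      using True conf_factor_divergence[OF punctured_norm[OF True] smooth_differentiable[OF f True], of \<alpha> w]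
      by (simp add: ext_zero_def)
  next
    case False
    then have "x \<notin> K" using K by auto
    then show ?thesis
      using False pderiv_dir_eq_0_outside[OF compact_imp_closed[OF K(1)] Gout]
      by (simp add: ext_zero_def)
  qed
  then have "(\<integral>x. ?h x \<partial>hyp_vol) = (\<integral>x. (\<Sum>i\<in>Basis. pderiv_dir i (G i) x) \<partial>lborel)"
    unfolding hyp_vol_integral_cpt_smooth(2)[OF h] by presburger
  also have "\<dots> = (\<Sum>i\<in>Basis. \<integral>x. pderiv_dir i (G i) x \<partial>lborel)"
  proof (rule Bochner_Integration.integral_sum)
    fix i :: 'a assume "i \<in> Basis"
    then show "integrable lborel (\<lambda>x. pderiv_dir i (G i) x)"
      using pderiv_dir_eq_0_outside[OF compact_imp_closed[OF K(1)] Gout]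
      by (intro integrable_lborel_compact_support[OF _ K(1)] smooth_continuous_on smooth_pderiv_dir G) auto
  qed
  also have "\<dots> = 0"
    by (simp add: integral_pderiv_dir_eq_0[OF G K(1) Gout])
  finally show ?thesis .
qed

section \<open>The polar frame\<close>

lemma hyp_div_cong_open:
  assumes "open S" "x \<in> S" "\<And>y. y \<in> S \<Longrightarrow> X y = Y y"
  shows "hyp_div X x = hyp_div Y x"
  unfolding hyp_div_def
  by (intro arg_cong2[where f = "(*)"] refl sum.cong pderiv_dir_cong_open[OF assms(1,2)])
     (simp add: assms(3))

lemma hyp_div_mink_vec_sum:
  fixes x :: "'a::euclidean_space"
  assumes x: "norm x < 1" and d: "\<And>i. i \<in> I \<Longrightarrow> f i differentiable at x"
  shows "hyp_div (\<lambda>y. \<Sum>i\<in>I. f i y *\<^sub>R mink_vec (\<alpha> i) (w i) y) x =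
    (\<Sum>i\<in>I. vf (mink_vec (\<alpha> i) (w i)) (f i) x + real DIM('a) * mink_fun (\<alpha> i) (w i) x * f i x)"
proof -
  let ?N = "DIM('a)"
  have c: "(\<lambda>y. conf_factor y ^ ?N) differentiable at x"
    using has_derivative_power[OF conf_factor_has_derivative[OF x]] differentiableI by blast
  have "pderiv_dir j (\<lambda>y. conf_factor y ^ ?N * ((\<Sum>i\<in>I. f i y *\<^sub>R mink_vec (\<alpha> i) (w i) y) \<bullet> j)) x
     = (\<Sum>i\<in>I. pderiv_dir j (\<lambda>y. conf_factor y ^ ?N * (f i y * (mink_vec (\<alpha> i) (w i) y \<bullet> j))) x)" for j
  proof -
    have dd: "(\<lambda>y. conf_factor y ^ ?N * (f i y * (mink_vec (\<alpha> i) (w i) y \<bullet> j))) differentiable at x"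
      if "i \<in> I" for i
      using c d[OF that] inner_has_derivative_mink_vec[THEN differentiableI]
      by (intro differentiable_mult) auto
    show ?thesis
      using vf_sum[OF dd, where V = "\<lambda>_. j"]
      by (simp add: vf_def pderiv_dir_def inner_sum_left sum_distrib_left)
  qed
  then have "hyp_div (\<lambda>y. \<Sum>i\<in>I. f i y *\<^sub>R mink_vec (\<alpha> i) (w i) y) x =
      (1 / conf_factor x ^ ?N) * (\<Sum>j\<in>Basis. \<Sum>i\<in>I.
        pderiv_dir j (\<lambda>y. conf_factor y ^ ?N * (f i y * (mink_vec (\<alpha> i) (w i) y \<bullet> j))) x)"
    by (simp add: hyp_div_def)
  also have "\<dots> = (\<Sum>i\<in>I. hyp_div (\<lambda>y. f i y *\<^sub>R mink_vec (\<alpha> i) (w i) y) x)"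
    by (subst sum.swap) (simp add: hyp_div_def sum_distrib_left)
  finally show ?thesis
    using hyp_div_mink_vec[OF x d] by simp
qed

lemma vf_minus:
  assumes "u differentiable at x"
  shows "vf V (\<lambda>y. - u y) x = - vf V u x"
  using vf_diff[of "\<lambda>_. 0" x u V] assms by simp

lemma sum_Basis_inner_mult: "(\<Sum>i\<in>Basis. (i \<bullet> a) * (i \<bullet> b)) = a \<bullet> (b::'a::euclidean_space)"
  by (subst euclidean_inner) (simp add: inner_commute)

section \<open>The Lorentz frame at the pole\<close>

locale hyp_pole =
  fixes x0 :: "'a::euclidean_space"
  assumes x0_norm: "norm x0 < 1"
begin

abbreviation "\<Omega> \<equiv> punctured x0"

definition pole_time :: real where
  "pole_time = (1 + x0 \<bullet> x0) / (1 - x0 \<bullet> x0)"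

definition pole_scale :: real where
  "pole_scale = 2 / (1 - x0 \<bullet> x0)"

text \<open>The image of \<open>x0\<close> on the hyperboloid is \<open>(pole_time, pole_scale *\<^sub>R x0)\<close>; the vectors
  \<open>(pole_scale * (x0 \<bullet> v), v + (pole_scale * (x0 \<bullet> v)) *\<^sub>R x0)\<close> with \<open>v \<in> Basis\<close> complete it to a
  Lorentz frame.  With respect to this frame, the coordinates of the image of \<open>x\<close> are
  \<open>ch x = cosh r\<close> and \<open>zc v x = sinh r * \<theta>\<^sub>v\<close>.\<close>

definition ch :: "'a \<Rightarrow> real" where
  "ch = mink_fun pole_time (- pole_scale *\<^sub>R x0)"

definition VP :: "'a \<Rightarrow> 'a" where
  "VP = mink_vec pole_time (- pole_scale *\<^sub>R x0)"

definition zc :: "'a \<Rightarrow> 'a \<Rightarrow> real" where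
  "zc v = mink_fun (- pole_scale * (x0 \<bullet> v)) (v + (pole_scale * (x0 \<bullet> v)) *\<^sub>R x0)"

definition VE :: "'a \<Rightarrow> 'a \<Rightarrow> 'a" where
  "VE v = mink_vec (- pole_scale * (x0 \<bullet> v)) (v + (pole_scale * (x0 \<bullet> v)) *\<^sub>R x0)"

definition rad :: "'a \<Rightarrow> real" where
  "rad = hyp_dist x0"

definition sh :: "'a \<Rightarrow> real" where
  "sh x = sinh (rad x)"

definition th :: "'a \<Rightarrow> 'a \<Rightarrow> real" where
  "th v x = zc v x / sh x"

definition Xr :: "('a \<Rightarrow> real) \<Rightarrow> 'a \<Rightarrow> real" where
  "Xr = vf (\<lambda>x. (1 / sh x) *\<^sub>R VP x)"

text \<open>On the unit sphere this is differentiation along the tangential projection of the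
  constant vector \<open>v\<close>. A sphere has in general no global tangent frame, so the
  \<open>DIM('a)\<close> components, tied by the relation \<open>sum_th_Dt\<close>, replace angular
  coordinates. The factor \<open>sh\<close> removes the dependence on the radius.\<close>

definition Dt :: "'a \<Rightarrow> ('a \<Rightarrow> real) \<Rightarrow> 'a \<Rightarrow> real" where
  "Dt v = vf (\<lambda>x. sh x *\<^sub>R VE v x - (th v x * ch x) *\<^sub>R VP x)"

lemma x0_sq: "1 - x0 \<bullet> x0 > 0"
  using inner_self_less_1[OF x0_norm] by simp

lemma pole_form: "mink_form pole_time (- pole_scale *\<^sub>R x0) pole_time (- pole_scale *\<^sub>R x0) = -1"
  unfolding mink_form_def pole_time_def pole_scale_def using x0_sq
  by (simp add: divide_simps power2_eq_square) (simp add: algebra_simps)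

lemma pole_frame_form:
  "mink_form pole_time (- pole_scale *\<^sub>R x0) (- pole_scale * (x0 \<bullet> v)) (v + (pole_scale * (x0 \<bullet> v)) *\<^sub>R x0) = 0"
  unfolding mink_form_def pole_time_def pole_scale_def using x0_sq
  by (simp add: inner_add_right divide_simps power2_eq_square) (simp add: algebra_simps)

lemma frame_form:
  "mink_form (- pole_scale * (x0 \<bullet> v)) (v + (pole_scale * (x0 \<bullet> v)) *\<^sub>R x0)
     (- pole_scale * (x0 \<bullet> w)) (w + (pole_scale * (x0 \<bullet> w)) *\<^sub>R x0) = v \<bullet> w"
  unfolding mink_form_def pole_time_def pole_scale_def using x0_sq
  by (simp add: inner_add_right inner_add_left inner_commute divide_simps power2_eq_square)
     (simp add: algebra_simps)

lemma mink_form_sym: "mink_form \<alpha> w \<beta> v = mink_form \<beta> v \<alpha> w"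
  by (simp add: mink_form_def inner_commute)

lemma \<Omega>_D: "x \<in> \<Omega> \<Longrightarrow> norm x < 1 \<and> 1 - x \<bullet> x > 0 \<and> x \<noteq> x0"
  using inner_self_less_1 by (auto simp: punctured_def)

lemma ch_eq:
  assumes "norm x < 1"
  shows "ch x = 1 + 2 * (norm (x0 - x))\<^sup>2 / ((1 - (norm x0)\<^sup>2) * (1 - (norm x)\<^sup>2))"
  using x0_sq inner_self_less_1[OF assms]
  unfolding ch_def mink_fun_def pole_time_def pole_scale_def power2_norm_eq_inner
  by (simp add: inner_diff_left inner_diff_right inner_commute divide_simps) (simp add: algebra_simps)

lemma ch_gt_1:
  assumes "x \<in> \<Omega>"
  shows "ch x > 1"
  using \<Omega>_D[OF assms] x0_sq
  by (auto simp: ch_eq power2_norm_eq_inner intro!: divide_pos_pos mult_pos_pos)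

lemma rad_eq: "x \<in> \<Omega> \<Longrightarrow> rad x = arcosh (ch x)"
  using \<Omega>_D[of x] by (simp add: rad_def hyp_dist_def ch_eq)

lemma rad_pos: "x \<in> \<Omega> \<Longrightarrow> rad x > 0"
  using ch_gt_1[of x] by (simp add: rad_eq)

lemma cosh_rad: "x \<in> \<Omega> \<Longrightarrow> cosh (rad x) = ch x"
  using ch_gt_1[of x] by (simp add: rad_eq)

lemma sh_pos: "x \<in> \<Omega> \<Longrightarrow> sh x > 0"
  using rad_pos by (simp add: sh_def)

lemma sh_sq: "x \<in> \<Omega> \<Longrightarrow> (sh x)\<^sup>2 = (ch x)\<^sup>2 - 1"
  using cosh_rad[of x] by (simp add: sh_def cosh_square_eq flip: cosh_rad)

lemma ch_sq: "x \<in> \<Omega> \<Longrightarrow> (ch x)\<^sup>2 = (sh x)\<^sup>2 + 1"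
  by (simp add: sh_sq)

lemma \<Omega>_ball: "\<Omega> \<subseteq> ball 0 1"
  by (auto simp: punctured_def)

lemma smooth_ch: "smooth \<Omega> ch"
  unfolding ch_def by (rule smooth_mink_fun[OF open_punctured \<Omega>_ball])

lemma smooth_zc: "smooth \<Omega> (zc v)"
  unfolding zc_def by (rule smooth_mink_fun[OF open_punctured \<Omega>_ball])

lemma smooth_rad: "smooth \<Omega> rad"
proof (rule smooth_cong[OF open_punctured])
  show "smooth \<Omega> (\<lambda>x. arcosh (ch x))"
    by (rule smooth_compose[OF open_punctured smooth_arcosh_real smooth_ch]) (simp add: ch_gt_1)
qed (simp add: rad_eq)

lemma smooth_sh: "smooth \<Omega> sh"
  unfolding sh_def[abs_def]
  by (rule smooth_compose[OF open_punctured smooth_sinh_real smooth_rad]) simp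

lemma smooth_th: "smooth \<Omega> (th v)"
  unfolding th_def[abs_def] by (rule smooth_divide[OF open_punctured smooth_zc smooth_sh sh_pos])

lemma smooth_Xr:
  assumes "smooth \<Omega> u"
  shows "smooth \<Omega> (Xr u)"
  unfolding Xr_def
proof (rule smooth_vf[OF open_punctured assms])
  fix i :: 'a
  have "smooth \<Omega> (\<lambda>x. (VP x \<bullet> i) / sh x)"
    unfolding VP_def
    by (rule smooth_divide[OF open_punctured smooth_mink_vec_inner[OF open_punctured] smooth_sh sh_pos])
  then show "smooth \<Omega> (\<lambda>x. (1 / sh x) *\<^sub>R VP x \<bullet> i)" by simp
qed

lemma smooth_Dt_field: "smooth \<Omega> (\<lambda>x. (sh x *\<^sub>R VE v x - (th v x * ch x) *\<^sub>R VP x) \<bullet> i)"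
proof -
  have "smooth \<Omega> (\<lambda>x. sh x * (VE v x \<bullet> i) - th v x * ch x * (VP x \<bullet> i))"
    unfolding VP_def VE_def
    by (intro smooth_diff smooth_mult smooth_sh smooth_th smooth_ch open_punctured smooth_mink_vec_inner)
  then show ?thesis by (simp add: inner_diff_left)
qed

lemma smooth_Dt: "smooth \<Omega> u \<Longrightarrow> smooth \<Omega> (Dt v u)"
  unfolding Dt_def by (rule smooth_vf[OF open_punctured _ smooth_Dt_field])

lemma smooth_VP: "smooth \<Omega> u \<Longrightarrow> smooth \<Omega> (vf VP u)"
  unfolding VP_def by (rule smooth_vf_mink_vec[OF open_punctured])

lemma smooth_VE: "smooth \<Omega> u \<Longrightarrow> smooth \<Omega> (vf (VE v) u)"
  unfolding VE_def by (rule smooth_vf_mink_vec[OF open_punctured])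

lemmas diff\<Omega> = smooth_differentiable[where S = "punctured x0"]

lemma Xr_eq:
  assumes "x \<in> \<Omega>" "u differentiable at x"
  shows "Xr u x = vf VP u x / sh x"
  using linear_frechet_derivative[OF assms(2)] by (simp add: Xr_def vf_def linear_scale)

lemma Dt_eq:
  assumes "x \<in> \<Omega>" "u differentiable at x"
  shows "Dt v u x = sh x * vf (VE v) u x - th v x * ch x * vf VP u x"
  using linear_frechet_derivative[OF assms(2)] by (simp add: Dt_def vf_def linear_scale linear_diff)

lemma VP_ch: "x \<in> \<Omega> \<Longrightarrow> vf VP ch x = (sh x)\<^sup>2"
  using vf_mink_vec_mink_fun[of x pole_time "- pole_scale *\<^sub>R x0" pole_time "- pole_scale *\<^sub>R x0"]
    \<Omega>_D[of x]
  unfolding pole_form VP_def[symmetric] ch_def[symmetric] by (simp add: sh_sq) (simp add: power2_eq_square)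

lemma VP_zc: "x \<in> \<Omega> \<Longrightarrow> vf VP (zc v) x = ch x * zc v x"
  using vf_mink_vec_mink_fun[of x] \<Omega>_D[of x] pole_frame_form[of v]
  by (simp add: VP_def zc_def ch_def)

lemma VE_ch: "x \<in> \<Omega> \<Longrightarrow> vf (VE v) ch x = ch x * zc v x"
  using vf_mink_vec_mink_fun[of x] \<Omega>_D[of x] pole_frame_form[of v]
  by (simp add: VE_def zc_def ch_def mink_form_sym)

lemma VE_zc: "x \<in> \<Omega> \<Longrightarrow> vf (VE v) (zc w) x = v \<bullet> w + zc v x * zc w x"
  using vf_mink_vec_mink_fun[of x] \<Omega>_D[of x] frame_form[of v w]
  by (simp add: VE_def zc_def)

lemma VP_VE_bracket:
  assumes "x \<in> \<Omega>" "smooth \<Omega> u"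
  shows "vf VP (vf (VE v) u) x - vf (VE v) (vf VP u) x = zc v x * vf VP u x - ch x * vf (VE v) u x"
  unfolding VP_def VE_def zc_def ch_def
  by (rule vf_mink_vec_bracket[OF open_punctured \<Omega>_ball assms])

lemma VE_VE_bracket:
  assumes "x \<in> \<Omega>" "smooth \<Omega> u"
  shows "vf (VE v) (vf (VE w) u) x - vf (VE w) (vf (VE v) u) x
    = zc w x * vf (VE v) u x - zc v x * vf (VE w) u x"
  unfolding VE_def zc_def
  by (rule vf_mink_vec_bracket[OF open_punctured \<Omega>_ball assms])

text \<open>The next two vectors represent the linear functionals \<open>v \<mapsto> VE v x \<bullet> a\<close> and \<open>v \<mapsto> zc v x\<close>.\<close>

definition frame_grad :: "'a \<Rightarrow> 'a \<Rightarrow> 'a" where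
  "frame_grad x a = (1/2 * (1 - x \<bullet> x)) *\<^sub>R (a + (pole_scale * (x0 \<bullet> a)) *\<^sub>R x0)
     + (x \<bullet> a) *\<^sub>R (x + (pole_scale * (x0 \<bullet> x - 1)) *\<^sub>R x0)"

definition frame_pos :: "'a \<Rightarrow> 'a" where
  "frame_pos x = (1 / (1 - x \<bullet> x)) *\<^sub>R (2 *\<^sub>R x + (pole_scale * (2 * (x0 \<bullet> x) - 1 - x \<bullet> x)) *\<^sub>R x0)"

lemma VE_inner: "VE v x \<bullet> a = v \<bullet> frame_grad x a"
  by (simp add: VE_def mink_vec_def frame_grad_def inner_add_left inner_add_right inner_commute)
     (simp add: field_simps)

lemma zc_inner: "zc v x = v \<bullet> frame_pos x"
  by (simp add: zc_def mink_fun_def frame_pos_def inner_add_left inner_add_right inner_commute algebra_simps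
      add_divide_distrib diff_divide_distrib)

text \<open>Completeness of the Lorentz frame, written through its representing vectors: the sum
  over the spacelike gradients minus the timelike one is the inverse metric.\<close>

lemma frame_grad_inner:
  assumes "x \<in> \<Omega>"
  shows "frame_grad x a \<bullet> frame_grad x b - (VP x \<bullet> a) * (VP x \<bullet> b) = (a \<bullet> b) / (conf_factor x)\<^sup>2"
proof -
  define p q s a0 b0 a1 b1 c where "p = x0 \<bullet> x0" and "q = x \<bullet> x" and "s = x0 \<bullet> x"
    and "a0 = x0 \<bullet> a" and "b0 = x0 \<bullet> b" and "a1 = x \<bullet> a" and "b1 = x \<bullet> b" and "c = a \<bullet> b"
  have e: "x0 \<bullet> x0 = p" "x \<bullet> x = q" "x0 \<bullet> x = s" "x \<bullet> x0 = s" "x0 \<bullet> a = a0" "a \<bullet> x0 = a0"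
    "x0 \<bullet> b = b0" "b \<bullet> x0 = b0" "x \<bullet> a = a1" "a \<bullet> x = a1" "x \<bullet> b = b1" "b \<bullet> x = b1" "a \<bullet> b = c"
    by (simp_all add: p_def q_def s_def a0_def b0_def a1_def b1_def c_def inner_commute)
  have p: "1 - p > 0" using x0_sq by (simp add: p_def)
  define k where "k = 2 / (1 - p)"
  have k: "k * (1 - p) = 2"
    unfolding k_def times_divide_eq_left using p by (intro nonzero_mult_div_cancel_right) simp
  have P: "pole_scale = k" "pole_time = k - 1"
    using p by (simp_all add: pole_scale_def pole_time_def e k_def field_simps)
  define h where "h = (1 - q) / 2"
  have hq: "1/2 * (1 - q) = h" "q = 1 - 2 * h" by (simp_all add: h_def field_simps)
  have g: "frame_grad x a \<bullet> frame_grad x b =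
     h\<^sup>2 * (c + 2 * k * a0 * b0 + k\<^sup>2 * a0 * b0 * p)
     + h * b1 * (a1 + k * (s - 1) * a0 + k * a0 * s + k\<^sup>2 * a0 * (s - 1) * p)
     + h * a1 * (b1 + k * (s - 1) * b0 + k * b0 * s + k\<^sup>2 * b0 * (s - 1) * p)
     + a1 * b1 * (q + 2 * k * (s - 1) * s + (k * (s - 1))\<^sup>2 * p)"
    unfolding frame_grad_def P e hq(1)
    by (simp add: e inner_add_left inner_add_right power2_eq_square) (simp add: algebra_simps)
  have v: "VP x \<bullet> a = - h * k * a0 + (k - 1 - k * s) * a1"
    "VP x \<bullet> b = - h * k * b0 + (k - 1 - k * s) * b1"
    by (simp_all add: VP_def mink_vec_def P e inner_add_left inner_diff_left h_def field_simps)
  \<comment> \<open>The difference of the two sides is displayed as a multiple of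
    \<open>k * (1 - p) - 2\<close>, which is zero; the expansion is thus polynomial, with
    \<open>k\<close> treated as an independent variable.\<close>
  have "frame_grad x a \<bullet> frame_grad x b - (VP x \<bullet> a) * (VP x \<bullet> b) =
      h\<^sup>2 * c - (k * (1 - p) - 2) * (k * (h * a0 + (s - 1) * a1) * (h * b0 + (s - 1) * b1))"
    unfolding g v hq(2) by (simp add: power2_eq_square algebra_simps)
  also have "\<dots> = h\<^sup>2 * c" by (simp only: k) simp
  finally have "frame_grad x a \<bullet> frame_grad x b - (VP x \<bullet> a) * (VP x \<bullet> b) = h\<^sup>2 * c" .
  then show ?thesis
    by (simp add: conf_factor_alt e h_def power2_eq_square)
qed

text \<open>Completeness of the frame applied to the position vector on the hyperboloid, which is
  orthogonal to every tangent vector and has square -1.\<close>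

lemma frame_pos_inner:
  assumes "x \<in> \<Omega>"
  shows "frame_pos x \<bullet> frame_grad x a = ch x * (VP x \<bullet> a)"
    and "frame_pos x \<bullet> frame_pos x = (sh x)\<^sup>2"
proof -
  define p q s a0 a1 where "p = x0 \<bullet> x0" and "q = x \<bullet> x" and "s = x0 \<bullet> x"
    and "a0 = x0 \<bullet> a" and "a1 = x \<bullet> a"
  have e: "x0 \<bullet> x0 = p" "x \<bullet> x = q" "x0 \<bullet> x = s" "x \<bullet> x0 = s" "x0 \<bullet> a = a0" "a \<bullet> x0 = a0"
    "x \<bullet> a = a1" "a \<bullet> x = a1"
    by (simp_all add: p_def q_def s_def a0_def a1_def inner_commute)
  have p: "1 - p > 0" using x0_sq by (simp add: p_def)
  have q: "1 - q > 0" using \<Omega>_D[OF assms] by (simp add: q_def)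
  define k where "k = 2 / (1 - p)"
  have k: "k * (1 - p) = 2"
    unfolding k_def times_divide_eq_left using p by (intro nonzero_mult_div_cancel_right) simp
  have P: "pole_scale = k" "pole_time = k - 1"
    using p by (simp_all add: pole_scale_def pole_time_def e k_def field_simps)
  define Y where "Y = 2 *\<^sub>R x + (k * (2 * s - 1 - q)) *\<^sub>R x0"
  have Y: "frame_pos x = (1 / (1 - q)) *\<^sub>R Y"
    by (simp add: frame_pos_def Y_def P e)
  have c: "ch x = ((k - 1) * (1 + q) - 2 * k * s) / (1 - q)"
    by (simp add: ch_def mink_fun_def P e)
  have v: "VP x \<bullet> a = 1/2 * (- (1 - q) * k * a0 + 2 * (k - 1 - k * s) * a1)"
    by (simp add: VP_def mink_vec_def P e inner_add_left inner_diff_left algebra_simps)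
  have "Y \<bullet> frame_grad x a = (1/2 * (1 - q)) * (2 * a1 + k * (2 * s - 1 - q) * a0
      + k * a0 * (2 * s + k * (2 * s - 1 - q) * p))
      + a1 * (2 * q + k * (2 * s - 1 - q) * s + k * (s - 1) * (2 * s + k * (2 * s - 1 - q) * p))"
    by (simp add: Y_def frame_grad_def P e inner_add_left inner_add_right)
  also have "\<dots> = ((k - 1) * (1 + q) - 2 * k * s) * (1/2 * (- (1 - q) * k * a0 + 2 * (k - 1 - k * s) * a1))
      - (k * (1 - p) - 2) * (k * (2 * s - 1 - q) * ((1 - q) / 2 * a0 + a1 * (s - 1)))"
    by (simp add: field_simps)
  also have "\<dots> = ((k - 1) * (1 + q) - 2 * k * s) * (1/2 * (- (1 - q) * k * a0 + 2 * (k - 1 - k * s) * a1))"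
    by (simp only: k) simp
  finally have "Y \<bullet> frame_grad x a = ((k - 1) * (1 + q) - 2 * k * s) * (VP x \<bullet> a)"
    unfolding v .
  then show "frame_pos x \<bullet> frame_grad x a = ch x * (VP x \<bullet> a)"
    by (simp only: Y c inner_scaleR_left) simp
  have "Y \<bullet> Y = 4 * q + 4 * (k * (2 * s - 1 - q)) * s + (k * (2 * s - 1 - q))\<^sup>2 * p"
    by (simp add: Y_def e inner_add_left inner_add_right power2_eq_square algebra_simps)
  also have "\<dots> = ((k - 1) * (1 + q) - 2 * k * s)\<^sup>2 - (1 - q)\<^sup>2
      - (k * (1 - p) - 2) * (k * (2 * s - 1 - q)\<^sup>2)"
    by (simp add: power2_eq_square algebra_simps)
  also have "\<dots> = ((k - 1) * (1 + q) - 2 * k * s)\<^sup>2 - (1 - q)\<^sup>2"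
    by (simp only: k) simp
  finally have "frame_pos x \<bullet> frame_pos x = (((k - 1) * (1 + q) - 2 * k * s)\<^sup>2 - (1 - q)\<^sup>2) / (1 - q)\<^sup>2"
    by (simp add: Y power2_eq_square)
  also have "\<dots> = (ch x)\<^sup>2 - 1"
    using q unfolding c power_divide diff_divide_distrib[of _ "(1 - q)\<^sup>2"] by simp
  finally show "frame_pos x \<bullet> frame_pos x = (sh x)\<^sup>2"
    by (simp add: sh_sq[OF assms])
qed

section \<open>Gradient and Laplacian in the Lorentz frame\<close>

definition egrad :: "('a \<Rightarrow> real) \<Rightarrow> 'a \<Rightarrow> 'a" where
  "egrad u x = (\<Sum>i\<in>Basis. pderiv_dir i u x *\<^sub>R i)"

lemma vf_egrad: "u differentiable at x \<Longrightarrow> vf V u x = V x \<bullet> egrad u x"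
  by (simp add: vf_eq_sum egrad_def inner_sum_right mult.commute)

lemma sum_zc_sq: "x \<in> \<Omega> \<Longrightarrow> (\<Sum>i\<in>Basis. (zc i x)\<^sup>2) = (sh x)\<^sup>2"
  unfolding zc_inner power2_eq_square[of "_ \<bullet> _"] sum_Basis_inner_mult by (rule frame_pos_inner(2))

lemma sum_zc_VE:
  assumes "x \<in> \<Omega>" "u differentiable at x"
  shows "(\<Sum>i\<in>Basis. zc i x * vf (VE i) u x) = ch x * vf VP u x"
  unfolding zc_inner vf_egrad[OF assms(2)] VE_inner sum_Basis_inner_mult
  by (rule frame_pos_inner(1)[OF assms(1)])

lemma grad_sq_frame:
  assumes "x \<in> \<Omega>" "u differentiable at x"
  shows "grad_sq u x = (\<Sum>i\<in>Basis. (vf (VE i) u x)\<^sup>2) - (vf VP u x)\<^sup>2"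
proof -
  have "grad_sq u x = (egrad u x \<bullet> egrad u x) / (conf_factor x)\<^sup>2"
    using conf_factor_pos[of x] \<Omega>_D[OF assms(1)]
    by (simp add: grad_sq_def hyp_inner_def hyp_grad_def egrad_def power2_eq_square)
  then show ?thesis
    unfolding frame_grad_inner[OF assms(1), symmetric] vf_egrad[OF assms(2)] VE_inner
      power2_eq_square[of "_ \<bullet> _"] sum_Basis_inner_mult .
qed

lemma hyp_grad_frame:
  assumes "x \<in> \<Omega>" "u differentiable at x"
  shows "hyp_grad u x = (\<Sum>i\<in>Basis. vf (VE i) u x *\<^sub>R VE i x) - vf VP u x *\<^sub>R VP x"
proof (rule euclidean_eqI)
  fix b :: 'a assume "b \<in> Basis"
  have "hyp_grad u x \<bullet> b = (egrad u x \<bullet> b) / (conf_factor x)\<^sup>2"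
    by (simp add: hyp_grad_def egrad_def)
  also have "\<dots> = frame_grad x (egrad u x) \<bullet> frame_grad x b - (VP x \<bullet> egrad u x) * (VP x \<bullet> b)"
    by (rule frame_grad_inner[OF assms(1), symmetric])
  finally show "hyp_grad u x \<bullet> b =
      ((\<Sum>i\<in>Basis. vf (VE i) u x *\<^sub>R VE i x) - vf VP u x *\<^sub>R VP x) \<bullet> b"
    by (simp add: inner_diff_left inner_sum_left vf_egrad[OF assms(2)] VE_inner sum_Basis_inner_mult)
qed

text \<open>The gradient is a combination of frame fields with known divergences. Their first order
  contributions cancel by \<open>sum_zc_VE\<close>, which leaves the second derivatives along the
  frame with Lorentz signs.\<close>

lemma hyp_laplace_frame:
  assumes x: "x \<in> \<Omega>" and u: "smooth \<Omega> u"
  shows "hyp_laplace u x = (\<Sum>i\<in>Basis. vf (VE i) (vf (VE i) u) x) - vf VP (vf VP u) x"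
proof -
  let ?N = "real DIM('a)"
  \<comment> \<open>The index \<open>None\<close> stands for the timelike field; its minus sign is
    put into the coefficient \<open>f None\<close>.\<close>
  define I where "I = insert None (Some ` (Basis :: 'a set))"
  define al where "al j = (case j of None \<Rightarrow> pole_time | Some i \<Rightarrow> - pole_scale * (x0 \<bullet> i))" for j
  define w where "w j = (case j of None \<Rightarrow> - pole_scale *\<^sub>R x0
    | Some i \<Rightarrow> i + (pole_scale * (x0 \<bullet> i)) *\<^sub>R x0)" for j
  define f where "f j = (case j of None \<Rightarrow> (\<lambda>y. - vf VP u y) | Some i \<Rightarrow> vf (VE i) u)" for j
  have V: "mink_vec (al None) (w None) = VP" "mink_vec (al (Some i)) (w (Some i)) = VE i"
    "mink_fun (al None) (w None) = ch" "mink_fun (al (Some i)) (w (Some i)) = zc i" for i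
    by (simp_all add: al_def w_def VP_def VE_def ch_def zc_def)
  have sum_I: "sum h I = h None + (\<Sum>i\<in>Basis. h (Some i))" for h :: "'a option \<Rightarrow> 'b::comm_monoid_add"
    unfolding I_def by (subst sum.insert) (auto simp: sum.reindex)
  have eq: "hyp_grad u y = (\<Sum>j\<in>I. f j y *\<^sub>R mink_vec (al j) (w j) y)" if "y \<in> \<Omega>" for y
    unfolding hyp_grad_frame[OF that diff\<Omega>[OF u that]] sum_I V f_def by simp
  have "hyp_laplace u x = hyp_div (\<lambda>y. \<Sum>j\<in>I. f j y *\<^sub>R mink_vec (al j) (w j) y) x"
    unfolding hyp_laplace_def by (rule hyp_div_cong_open[OF open_punctured x eq])
  also have "\<dots> = (\<Sum>j\<in>I. vf (mink_vec (al j) (w j)) (f j) x + ?N * mink_fun (al j) (w j) x * f j x)"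
  proof (rule hyp_div_mink_vec_sum)
    show "norm x < 1" using \<Omega>_D[OF x] by simp
    show "f j differentiable at x" if "j \<in> I" for j
      using diff\<Omega>[OF smooth_VP[OF u] x] diff\<Omega>[OF smooth_VE[OF u] x]
      by (cases j) (auto simp: f_def)
  qed
  also have "\<dots> = (\<Sum>i\<in>Basis. vf (VE i) (vf (VE i) u) x) + vf VP (\<lambda>y. - vf VP u y) x
      + ?N * ((\<Sum>i\<in>Basis. zc i x * vf (VE i) u x) - ch x * vf VP u x)"
    unfolding sum_I V f_def by (simp add: sum.distrib sum_distrib_left algebra_simps)
  also have "vf VP (\<lambda>y. - vf VP u y) x = - vf VP (vf VP u) x"
    by (rule vf_minus[OF diff\<Omega>[OF smooth_VP[OF u] x]])
  finally show ?thesis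
    by (simp add: sum_zc_VE[OF x diff\<Omega>[OF u x]])
qed

section \<open>Radial and angular derivatives\<close>

lemma VP_sh: "x \<in> \<Omega> \<Longrightarrow> vf VP sh x = ch x * sh x"
  and VE_sh: "x \<in> \<Omega> \<Longrightarrow> vf (VE v) sh x = (ch x)\<^sup>2 * zc v x / sh x"
proof -
  assume x: "x \<in> \<Omega>"
  have d: "2 * sh x * vf V sh x = 2 * ch x * vf V ch x" for V
  proof -
    have "vf V (\<lambda>y. sh y * sh y) x = vf V (\<lambda>y. ch y * ch y - 1) x"
      by (rule vf_cong[OF open_punctured x]) (simp add: sh_sq flip: power2_eq_square)
    then show ?thesis
      using diff\<Omega>[OF smooth_sh x] diff\<Omega>[OF smooth_ch x]
      by (simp add: vf_mult vf_diff)
  qed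
  show "vf VP sh x = ch x * sh x"
    using d[of VP] sh_pos[OF x] VP_ch[OF x] by (simp add: power2_eq_square)
  show "vf (VE v) sh x = (ch x)\<^sup>2 * zc v x / sh x"
    using d[of "VE v"] sh_pos[OF x] VE_ch[OF x] by (simp add: power2_eq_square field_simps)
qed

lemma vf_divide_sh:
  assumes x: "x \<in> \<Omega>" and "f differentiable at x"
  shows "vf V (\<lambda>y. f y / sh y) x = vf V f x / sh x - f x * vf V sh x / (sh x)\<^sup>2"
proof -
  have s: "sh x \<noteq> 0" using sh_pos[OF x] by simp
  have "vf V (\<lambda>y. inverse (sh y)) x = (- inverse ((sh x)\<^sup>2)) * vf V sh x"
    by (rule vf_compose[OF diff\<Omega>[OF smooth_sh x]]) (use s in \<open>auto intro!: derivative_eq_intros simp: power2_eq_square\<close>)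
  moreover have "(\<lambda>y. inverse (sh y)) differentiable at x"
    using diff\<Omega>[OF smooth_sh x] s by (intro differentiable_inverse) auto
  ultimately show ?thesis
    using vf_mult[OF assms(2), of "\<lambda>y. inverse (sh y)" V] by (simp add: divide_inverse)
qed

lemma VP_th: "x \<in> \<Omega> \<Longrightarrow> vf VP (th v) x = 0"
  unfolding th_def[abs_def]
  using sh_pos[of x] by (simp add: vf_divide_sh diff\<Omega>[OF smooth_zc] VP_zc VP_sh power2_eq_square)

lemma Dt_sh: "x \<in> \<Omega> \<Longrightarrow> Dt v sh x = 0"
  using sh_pos[of x] by (simp add: Dt_eq diff\<Omega>[OF smooth_sh] VE_sh VP_sh th_def power2_eq_square)

lemma Dt_ch: "x \<in> \<Omega> \<Longrightarrow> Dt v ch x = 0"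
  using sh_pos[of x] by (simp add: Dt_eq diff\<Omega>[OF smooth_ch] VE_ch VP_ch th_def power2_eq_square)

lemma Dt_th: "x \<in> \<Omega> \<Longrightarrow> Dt v (th w) x = v \<bullet> w - th v x * th w x"
proof -
  assume x: "x \<in> \<Omega>"
  have s: "sh x > 0" using sh_pos[OF x] .
  have "vf (VE v) (th w) x = (v \<bullet> w + zc v x * zc w x) / sh x - zc w x * ((ch x)\<^sup>2 * zc v x / sh x) / (sh x)\<^sup>2"
    unfolding th_def[abs_def] by (simp add: vf_divide_sh x diff\<Omega>[OF smooth_zc] VE_zc VE_sh)
  then have "Dt v (th w) x =
      sh x * ((v \<bullet> w + zc v x * zc w x) / sh x - zc w x * ((ch x)\<^sup>2 * zc v x / sh x) / (sh x)\<^sup>2)"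
    by (simp add: Dt_eq x diff\<Omega>[OF smooth_th] VP_th)
  also have "\<dots> = v \<bullet> w + zc v x * zc w x * (1 - (ch x)\<^sup>2 / (sh x)\<^sup>2)"
    using s by (simp add: field_simps power2_eq_square)
  also have "1 - (ch x)\<^sup>2 / (sh x)\<^sup>2 = - 1 / (sh x)\<^sup>2"
    using s by (simp add: ch_sq[OF x] field_simps)
  finally show ?thesis by (simp add: th_def[of _ x] power2_eq_square)
qed

lemma Xr_rad: "x \<in> \<Omega> \<Longrightarrow> Xr rad x = 1"
  and Dt_rad: "x \<in> \<Omega> \<Longrightarrow> Dt v rad x = 0"
proof -
  assume x: "x \<in> \<Omega>"
  have s: "sh x > 0" using sh_pos[OF x] .
  have c: "ch x > 1" using ch_gt_1[OF x] .
  have d: "vf V rad x = vf V ch x / sqrt ((ch x)\<^sup>2 - 1)" for V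
  proof -
    have "vf V rad x = vf V (\<lambda>y. arcosh (ch y)) x"
      by (rule vf_cong[OF open_punctured x]) (simp add: rad_eq)
    also have "\<dots> = 1 / sqrt ((ch x)\<^sup>2 - 1) * vf V ch x"
      by (rule vf_compose[OF diff\<Omega>[OF smooth_ch x]]) (use c in \<open>auto intro!: derivative_eq_intros\<close>)
    finally show ?thesis by simp
  qed
  have q: "sqrt ((ch x)\<^sup>2 - 1) = sh x"
    using s by (simp add: sh_sq[OF x, symmetric])
  show "Xr rad x = 1"
    using s by (simp add: Xr_eq x diff\<Omega>[OF smooth_rad] d q VP_ch) (simp add: power2_eq_square)
  show "Dt v rad x = 0"
    using s by (simp add: Dt_eq x diff\<Omega>[OF smooth_rad] d q VP_ch VE_ch th_def) (simp add: power2_eq_square)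
qed

lemma sum_th_sq:
  assumes "x \<in> \<Omega>"
  shows "(\<Sum>i\<in>Basis. (th i x)\<^sup>2) = 1"
proof -
  have "(\<Sum>i\<in>Basis. (th i x)\<^sup>2) = (\<Sum>i\<in>Basis. (zc i x)\<^sup>2) / (sh x)\<^sup>2"
    by (simp add: th_def power_divide sum_divide_distrib)
  then show ?thesis using sum_zc_sq[OF assms] sh_pos[OF assms] by simp
qed

lemma sum_th_VE:
  assumes "x \<in> \<Omega>" "u differentiable at x"
  shows "(\<Sum>i\<in>Basis. th i x * vf (VE i) u x) = ch x * vf VP u x / sh x"
  using sum_zc_VE[OF assms] by (simp add: th_def sum_divide_distrib[symmetric])

lemma sum_th_Dt:
  assumes "x \<in> \<Omega>" "u differentiable at x"
  shows "(\<Sum>i\<in>Basis. th i x * Dt i u x) = 0"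
proof -
  have "(\<Sum>i\<in>Basis. th i x * Dt i u x) =
     sh x * (\<Sum>i\<in>Basis. th i x * vf (VE i) u x) - ch x * vf VP u x * (\<Sum>i\<in>Basis. (th i x)\<^sup>2)"
    by (simp add: Dt_eq assms sum_distrib_left sum_subtractf[symmetric] power2_eq_square algebra_simps)
  then show ?thesis
    using sh_pos[OF assms(1)] by (simp add: sum_th_VE assms sum_th_sq)
qed

lemma grad_sq_polar:
  assumes "x \<in> \<Omega>" "u differentiable at x"
  shows "grad_sq u x = (Xr u x)\<^sup>2 + (\<Sum>i\<in>Basis. (Dt i u x)\<^sup>2) / (sh x)\<^sup>2"
proof -
  have s: "sh x > 0" using sh_pos[OF assms(1)] .
  let ?P = "vf VP u x"
  have "(\<Sum>i\<in>Basis. (Dt i u x)\<^sup>2) = (sh x)\<^sup>2 * (\<Sum>i\<in>Basis. (vf (VE i) u x)\<^sup>2)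
      - 2 * sh x * ch x * ?P * (\<Sum>i\<in>Basis. th i x * vf (VE i) u x)
      + (ch x)\<^sup>2 * ?P\<^sup>2 * (\<Sum>i\<in>Basis. (th i x)\<^sup>2)"
    by (simp add: Dt_eq assms sum_distrib_left sum_subtractf[symmetric] sum.distrib[symmetric]
        power2_eq_square algebra_simps)
  also have "\<dots> = (sh x)\<^sup>2 * (\<Sum>i\<in>Basis. (vf (VE i) u x)\<^sup>2) - (ch x)\<^sup>2 * ?P\<^sup>2"
    using s by (simp add: sum_th_VE assms sum_th_sq) (simp add: power2_eq_square)
  finally have "(\<Sum>i\<in>Basis. (Dt i u x)\<^sup>2) / (sh x)\<^sup>2 =
      (\<Sum>i\<in>Basis. (vf (VE i) u x)\<^sup>2) - (ch x)\<^sup>2 * ?P\<^sup>2 / (sh x)\<^sup>2"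
    using s by (simp add: diff_divide_distrib)
  moreover have "(Xr u x)\<^sup>2 = ?P\<^sup>2 / (sh x)\<^sup>2"
    by (simp add: Xr_eq assms power_divide)
  moreover have "(ch x)\<^sup>2 * ?P\<^sup>2 / (sh x)\<^sup>2 = ?P\<^sup>2 + ?P\<^sup>2 / (sh x)\<^sup>2"
    using s by (simp add: ch_sq[OF assms(1)] field_simps)
  ultimately show ?thesis
    unfolding grad_sq_frame[OF assms] by simp
qed

lemma vf_Dt:
  assumes x: "x \<in> \<Omega>" and u: "smooth \<Omega> u"
  shows "vf V (Dt w u) x = vf V sh x * vf (VE w) u x + sh x * vf V (vf (VE w) u) x
    - (vf V (th w) x * ch x + th w x * vf V ch x) * vf VP u x - th w x * ch x * vf V (vf VP u) x"
proof -
  have "vf V (Dt w u) x = vf V (\<lambda>y. sh y * vf (VE w) u y - th w y * ch y * vf VP u y) x"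
    by (rule vf_cong[OF open_punctured x]) (simp add: Dt_eq diff\<Omega>[OF u])
  then show ?thesis
    using diff\<Omega>[OF smooth_sh x] diff\<Omega>[OF smooth_VE[OF u] x] diff\<Omega>[OF smooth_th x] diff\<Omega>[OF smooth_ch x]
      diff\<Omega>[OF smooth_VP[OF u] x]
    by (simp add: vf_diff vf_mult algebra_simps)
qed

text \<open>In polar coordinates \<open>Dt v\<close> differentiates only in \<theta>, with
  coefficients independent of the radius. In the frame this amounts to the bracket of
  \<open>VP\<close> and \<open>VE v\<close>.\<close>

lemma Xr_Dt_commute:
  assumes x: "x \<in> \<Omega>" and u: "smooth \<Omega> u"
  shows "Xr (Dt v u) x = Dt v (Xr u) x"
proof -
  have s: "sh x > 0" using sh_pos[OF x] .
  let ?E = "vf (VE v) u x" and ?P = "vf VP u x" and ?PE = "vf VP (vf (VE v) u) x"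
    and ?EP = "vf (VE v) (vf VP u) x" and ?PP = "vf VP (vf VP u) x"
  have "Xr (Dt v u) x = vf VP (Dt v u) x / sh x"
    by (rule Xr_eq[OF x diff\<Omega>[OF smooth_Dt[OF u] x]])
  also have "vf VP (Dt v u) x = ch x * sh x * ?E + sh x * ?PE - th v x * (sh x)\<^sup>2 * ?P - th v x * ch x * ?PP"
    by (simp add: vf_Dt[OF x u] VP_sh[OF x] VP_th[OF x] VP_ch[OF x])
  finally have l: "Xr (Dt v u) x = ch x * ?E + ?PE - th v x * sh x * ?P - th v x * ch x * ?PP / sh x"
    using s by (simp add: field_simps power2_eq_square)
  have "Dt v (Xr u) x = Dt v (\<lambda>y. vf VP u y / sh y) x"
    unfolding Dt_def by (rule vf_cong[OF open_punctured x]) (simp add: Xr_eq diff\<Omega>[OF u])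
  also have "\<dots> = Dt v (vf VP u) x / sh x"
    using vf_divide_sh[OF x diff\<Omega>[OF smooth_VP[OF u] x]] Dt_sh[OF x] by (simp add: Dt_def)
  also have "\<dots> = ?EP - th v x * ch x * ?PP / sh x"
    using s by (simp add: Dt_eq[OF x diff\<Omega>[OF smooth_VP[OF u] x]] field_simps)
  finally have r: "Dt v (Xr u) x = ?EP - th v x * ch x * ?PP / sh x" .
  have "zc v x = th v x * sh x" using s by (simp add: th_def)
  with VP_VE_bracket[OF x u, of v] show ?thesis unfolding l r by simp
qed

lemma Dt_Dt_eq:
  assumes x: "x \<in> \<Omega>" and u: "smooth \<Omega> u"
  shows "Dt v (Dt w u) x = (sh x)\<^sup>2 * vf (VE v) (vf (VE w) u) x
      - sh x * ch x * (th v x * vf VP (vf (VE w) u) x + th w x * vf (VE v) (vf VP u) x)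
      + th v x * th w x * (ch x)\<^sup>2 * vf VP (vf VP u) x - (v \<bullet> w - th v x * th w x) * ch x * vf VP u x"
proof -
  have "Dt v (Dt w u) x = sh x * Dt v (vf (VE w) u) x - Dt v (th w) x * ch x * vf VP u x
      - th w x * ch x * Dt v (vf VP u) x"
    using vf_Dt[OF x u, of "\<lambda>x. sh x *\<^sub>R VE v x - (th v x * ch x) *\<^sub>R VP x" w]
    unfolding Dt_def[symmetric] by (simp add: Dt_sh[OF x] Dt_ch[OF x])
  then show ?thesis
    unfolding Dt_th[OF x] Dt_eq[OF x diff\<Omega>[OF smooth_VE[OF u] x]] Dt_eq[OF x diff\<Omega>[OF smooth_VP[OF u] x]]
    by (simp add: algebra_simps power2_eq_square)
qed

text \<open>The tangential projections of two constant vectors do not commute; the right side is the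
  infinitesimal rotation in the plane of \<open>v\<close> and \<open>w\<close>. The curvature of the
  sphere enters the Bochner formula through this term.\<close>

lemma Dt_Dt_bracket:
  assumes x: "x \<in> \<Omega>" and u: "smooth \<Omega> u"
  shows "Dt v (Dt w u) x - Dt w (Dt v u) x = th v x * Dt w u x - th w x * Dt v u x"
proof -
  have s: "sh x > 0" using sh_pos[OF x] .
  let ?Ev = "vf (VE v) u x" and ?Ew = "vf (VE w) u x" and ?P = "vf VP u x"
  have z: "zc v x = th v x * sh x" "zc w x = th w x * sh x" using s by (simp_all add: th_def)
  have "Dt v (Dt w u) x - Dt w (Dt v u) x =
      (sh x)\<^sup>2 * (vf (VE v) (vf (VE w) u) x - vf (VE w) (vf (VE v) u) x)
      - sh x * ch x * (th v x * (vf VP (vf (VE w) u) x - vf (VE w) (vf VP u) x)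
         - th w x * (vf VP (vf (VE v) u) x - vf (VE v) (vf VP u) x))"
    unfolding Dt_Dt_eq[OF x u] by (simp add: inner_commute algebra_simps)
  also have "\<dots> = (sh x) * ((sh x)\<^sup>2 - (ch x)\<^sup>2) * (th w x * ?Ev - th v x * ?Ew)"
    unfolding VE_VE_bracket[OF x u] VP_VE_bracket[OF x u] z by (simp add: algebra_simps power2_eq_square)
  also have "\<dots> = th v x * Dt w u x - th w x * Dt v u x"
    unfolding Dt_eq[OF x diff\<Omega>[OF u x]] sh_sq[OF x] by (simp add: algebra_simps)
  finally show ?thesis .
qed

lemma sum_Dt_Dt:
  assumes x: "x \<in> \<Omega>" and u: "smooth \<Omega> u"
  shows "(\<Sum>i\<in>Basis. Dt i (Dt i u) x) = (sh x)\<^sup>2 * (\<Sum>i\<in>Basis. vf (VE i) (vf (VE i) u) x)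
    - (ch x)\<^sup>2 * vf VP (vf VP u) x - (real DIM('a) - 2) * ch x * vf VP u x"
proof -
  have s: "sh x > 0" using sh_pos[OF x] .
  let ?P = "vf VP u x" and ?PP = "vf VP (vf VP u) x"
  have th2: "(\<Sum>i\<in>Basis. th i x * th i x) = 1"
    using sum_th_sq[OF x] by (simp add: power2_eq_square)
  have "(\<Sum>i\<in>Basis. Dt i (Dt i u) x) = (sh x)\<^sup>2 * (\<Sum>i\<in>Basis. vf (VE i) (vf (VE i) u) x)
      - sh x * ch x * ((\<Sum>i\<in>Basis. th i x * vf VP (vf (VE i) u) x) + (\<Sum>i\<in>Basis. th i x * vf (VE i) (vf VP u) x))
      + (\<Sum>i\<in>Basis. th i x * th i x) * (ch x)\<^sup>2 * ?PP
      - (real DIM('a) - (\<Sum>i\<in>Basis. th i x * th i x)) * ch x * ?P"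
    unfolding Dt_Dt_eq[OF x u]
    by (simp add: sum.distrib sum_subtractf sum_distrib_left sum_distrib_right algebra_simps inner_Basis)
  also have "(\<Sum>i\<in>Basis. th i x * vf (VE i) (vf VP u) x) = ch x * ?PP / sh x"
    by (rule sum_th_VE[OF x diff\<Omega>[OF smooth_VP[OF u] x]])
  also have "(\<Sum>i\<in>Basis. th i x * vf VP (vf (VE i) u) x) = ch x * ?PP / sh x - ?P / sh x"
  proof -
    have d: "(\<lambda>y. th i y * vf (VE i) u y) differentiable at x" for i
      by (intro differentiable_mult diff\<Omega>[OF smooth_th x] diff\<Omega>[OF smooth_VE[OF u] x])
    \<comment> \<open>Since \<open>th i\<close> is constant along \<open>VP\<close>, the relation
      \<open>sum_th_VE\<close> can be differentiated as a whole.\<close>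
    have "(\<Sum>i\<in>Basis. th i x * vf VP (vf (VE i) u) x) = vf VP (\<lambda>y. \<Sum>i\<in>Basis. th i y * vf (VE i) u y) x"
      by (simp add: vf_sum d vf_mult diff\<Omega>[OF smooth_th x] diff\<Omega>[OF smooth_VE[OF u] x] VP_th[OF x])
    also have "\<dots> = vf VP (\<lambda>y. (ch y * vf VP u y) / sh y) x"
      by (rule vf_cong[OF open_punctured x]) (simp add: sum_th_VE diff\<Omega>[OF u])
    also have "\<dots> = ((sh x)\<^sup>2 * ?P + ch x * ?PP) / sh x - ch x * ?P * (ch x * sh x) / (sh x)\<^sup>2"
      using diff\<Omega>[OF smooth_ch x] diff\<Omega>[OF smooth_VP[OF u] x]
      by (subst vf_divide_sh[OF x]) (auto simp: vf_mult VP_ch[OF x] VP_sh[OF x] intro!: differentiable_mult)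
    also have "\<dots> = ch x * ?PP / sh x + ((sh x)\<^sup>2 - (ch x)\<^sup>2) * ?P / sh x"
      using s by (simp add: field_simps power2_eq_square)
    finally show ?thesis by (simp add: sh_sq[OF x])
  qed
  finally have "(\<Sum>i\<in>Basis. Dt i (Dt i u) x) = (sh x)\<^sup>2 * (\<Sum>i\<in>Basis. vf (VE i) (vf (VE i) u) x)
      - sh x * ch x * ((ch x * ?PP / sh x - ?P / sh x) + ch x * ?PP / sh x)
      + (ch x)\<^sup>2 * ?PP - (real DIM('a) - 1) * ch x * ?P"
    unfolding th2 by simp
  also have "\<dots> = (sh x)\<^sup>2 * (\<Sum>i\<in>Basis. vf (VE i) (vf (VE i) u) x)
      - (ch x)\<^sup>2 * ?PP - (real DIM('a) - 2) * ch x * ?P"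
    using s by (simp add: field_simps power2_eq_square)
  finally show ?thesis .
qed

lemma Xr_Xr_eq:
  assumes x: "x \<in> \<Omega>" and u: "smooth \<Omega> u"
  shows "Xr (Xr u) x = (vf VP (vf VP u) x - ch x * vf VP u x) / (sh x)\<^sup>2"
proof -
  have s: "sh x > 0" using sh_pos[OF x] .
  have "Xr (Xr u) x = vf VP (Xr u) x / sh x"
    by (rule Xr_eq[OF x diff\<Omega>[OF smooth_Xr[OF u] x]])
  also have "vf VP (Xr u) x = vf VP (\<lambda>y. vf VP u y / sh y) x"
    by (rule vf_cong[OF open_punctured x]) (simp add: Xr_eq diff\<Omega>[OF u])
  finally show ?thesis
    using s by (simp add: vf_divide_sh[OF x diff\<Omega>[OF smooth_VP[OF u] x]] VP_sh[OF x]
        field_simps power2_eq_square)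
qed

lemma hyp_laplace_polar:
  assumes x: "x \<in> \<Omega>" and u: "smooth \<Omega> u"
  shows "hyp_laplace u x = Xr (Xr u) x + (real DIM('a) - 1) * coth (rad x) * Xr u x
    + (\<Sum>i\<in>Basis. Dt i (Dt i u) x) / (sh x)\<^sup>2"
proof -
  have s: "sh x > 0" using sh_pos[OF x] .
  have c: "coth (rad x) = ch x / sh x"
    by (simp add: coth_def cosh_rad[OF x] sh_def)
  have "(ch x)\<^sup>2 = (sh x)\<^sup>2 + 1" using sh_sq[OF x] by simp
  then show ?thesis
    unfolding hyp_laplace_frame[OF x u] c sum_Dt_Dt[OF x u] Xr_Xr_eq[OF x u] Xr_eq[OF x diff\<Omega>[OF u x]]
    using s by (simp add: divide_simps power2_eq_square) (simp add: algebra_simps)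
qed

section \<open>Integration by parts along the radial and angular fields\<close>

lemma cpt_smooth_VP: "cpt_smooth x0 f \<Longrightarrow> cpt_smooth x0 (vf VP f)"
  unfolding VP_def by (rule cpt_smooth_vf[OF _ smooth_mink_vec_inner[OF open_punctured]])

lemma cpt_smooth_VE: "cpt_smooth x0 f \<Longrightarrow> cpt_smooth x0 (vf (VE v) f)"
  unfolding VE_def by (rule cpt_smooth_vf[OF _ smooth_mink_vec_inner[OF open_punctured]])

lemma cpt_smooth_smooth: "cpt_smooth x0 f \<Longrightarrow> smooth \<Omega> f"
  by (simp add: cpt_smooth_def)

lemma cpt_smooth_Xr:
  assumes "cpt_smooth x0 f" shows "cpt_smooth x0 (Xr f)"
proof (rule cpt_smooth_congD)
  have "smooth \<Omega> (\<lambda>x. 1 / sh x)"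
    by (rule smooth_divide[OF open_punctured smooth_const smooth_sh sh_pos])
  then show "cpt_smooth x0 (\<lambda>x. 1 / sh x * vf VP f x)"
    by (rule cpt_smooth_mult_left[OF cpt_smooth_VP[OF assms]])
qed (simp add: Xr_eq diff\<Omega>[OF cpt_smooth_smooth[OF assms]])

lemma cpt_smooth_Dt: "cpt_smooth x0 f \<Longrightarrow> cpt_smooth x0 (Dt v f)"
  unfolding Dt_def by (rule cpt_smooth_vf[OF _ smooth_Dt_field])

text \<open>\<open>VP\<close> is \<open>sh\<close> times the radial field, so the divergence
  identity is applied to \<open>f / sh\<close>. Differentiating \<open>1 / sh\<close> lowers the
  factor N of \<open>coth\<close> to N - 1, which gives the divergence of the radial field.\<close>

lemma integral_Xr:
  assumes f: "cpt_smooth x0 f"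
  shows "(\<integral>x. Xr f x + (real DIM('a) - 1) * coth (rad x) * f x \<partial>hyp_vol) = 0"
proof -
  let ?N = "real DIM('a)"
  have i: "smooth \<Omega> (\<lambda>x. 1 / sh x)"
    by (rule smooth_divide[OF open_punctured smooth_const smooth_sh sh_pos])
  have g: "cpt_smooth x0 (\<lambda>x. f x / sh x)"
    using cpt_smooth_mult_left[OF f i] by simp
  have h: "cpt_smooth x0 (\<lambda>x. vf VP (\<lambda>x. f x / sh x) x + ?N * ch x * (f x / sh x))"
    by (intro cpt_smooth_add cpt_smooth_mult_left[OF g] cpt_smooth_VP g smooth_mult smooth_const smooth_ch open_punctured)
  have eq: "vf VP (\<lambda>x. f x / sh x) x + ?N * ch x * (f x / sh x) = Xr f x + (?N - 1) * coth (rad x) * f x"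
    if x: "x \<in> \<Omega>" for x
  proof -
    have d: "f differentiable at x" using diff\<Omega>[OF cpt_smooth_smooth[OF f] x] .
    have c: "coth (rad x) = ch x / sh x"
      by (simp add: coth_def cosh_rad[OF x] sh_def)
    show ?thesis
      unfolding vf_divide_sh[OF x d] Xr_eq[OF x d] VP_sh[OF x] c
      using sh_pos[OF x] by (simp add: field_simps power2_eq_square)
  qed
  show ?thesis
    using hyp_vol_integral_cong[OF h eq]
      integral_divergence_mink_vec[OF g, of pole_time "- pole_scale *\<^sub>R x0"]
    by (simp add: VP_def ch_def)
qed

text \<open>The field of \<open>Dt v\<close> has divergence \<open>- (DIM('a) - 1) * th v\<close>, a
  mean curvature term of the unit sphere. It disappears later whenever it is contracted with angular
  derivatives, by \<open>sum_th_Dt\<close>.\<close>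

lemma integral_Dt:
  assumes f: "cpt_smooth x0 f"
  shows "(\<integral>x. Dt v f x - (real DIM('a) - 1) * th v x * f x \<partial>hyp_vol) = 0"
proof -
  let ?N = "real DIM('a)"
  let ?a = "\<lambda>x. sh x * f x" and ?b = "\<lambda>x. - (th v x * ch x) * f x"
  have a: "cpt_smooth x0 ?a" by (rule cpt_smooth_mult_left[OF f smooth_sh])
  have b: "cpt_smooth x0 ?b"
    by (rule cpt_smooth_mult_left[OF f]) (intro smooth_minus smooth_mult smooth_th smooth_ch open_punctured)
  let ?A = "\<lambda>x. vf (VE v) ?a x + ?N * zc v x * ?a x" and ?B = "\<lambda>x. vf VP ?b x + ?N * ch x * ?b x"
  have A: "cpt_smooth x0 ?A"
    by (intro cpt_smooth_add cpt_smooth_mult_left[OF a] cpt_smooth_VE a smooth_mult smooth_const smooth_zc open_punctured)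
  have B: "cpt_smooth x0 ?B"
    by (intro cpt_smooth_add cpt_smooth_mult_left[OF b] cpt_smooth_VP b smooth_mult smooth_const smooth_ch open_punctured)
  have "(\<integral>x. ?A x \<partial>hyp_vol) = 0"
    using integral_divergence_mink_vec[OF a] by (simp add: VE_def zc_def)
  moreover have "(\<integral>x. ?B x \<partial>hyp_vol) = 0"
    using integral_divergence_mink_vec[OF b, of pole_time "- pole_scale *\<^sub>R x0"] by (simp add: VP_def ch_def)
  ultimately have "(\<integral>x. ?A x + ?B x \<partial>hyp_vol) = 0"
    using hyp_vol_integral_cpt_smooth(1)[OF A] hyp_vol_integral_cpt_smooth(1)[OF B] by simp
  moreover have "?A x + ?B x = Dt v f x - (?N - 1) * th v x * f x" if x: "x \<in> \<Omega>" for x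
  proof -
    have d: "f differentiable at x" using diff\<Omega>[OF cpt_smooth_smooth[OF f] x] .
    have s: "sh x > 0" using sh_pos[OF x] .
    have z: "zc v x = th v x * sh x" using s by (simp add: th_def)
    have "vf (VE v) ?a x = (ch x)\<^sup>2 * th v x * f x + sh x * vf (VE v) f x"
      using s by (simp add: vf_mult diff\<Omega>[OF smooth_sh x] d VE_sh[OF x] z)
    moreover have "vf VP ?b x = - th v x * (sh x)\<^sup>2 * f x - th v x * ch x * vf VP f x"
    proof -
      have "vf VP (\<lambda>x. th v x * ch x * f x) x = th v x * (sh x)\<^sup>2 * f x + th v x * ch x * vf VP f x"
        by (simp add: vf_mult diff\<Omega>[OF smooth_th x] diff\<Omega>[OF smooth_ch x] d VP_th[OF x] VP_ch[OF x])
      then show ?thesis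
        using vf_minus[of "\<lambda>x. th v x * ch x * f x" x VP]
        by (simp add: diff\<Omega>[OF smooth_th x] diff\<Omega>[OF smooth_ch x] d)
    qed
    ultimately show ?thesis
      unfolding Dt_eq[OF x d] z using sh_sq[OF x] by (simp add: algebra_simps power2_eq_square) algebra
  qed
  ultimately show ?thesis
    using hyp_vol_integral_cong[OF cpt_smooth_add[OF A B]] by fastforce
qed

end

section \<open>Radial calculus\<close>

lemma smooth_ident: "smooth {0<..} (\<lambda>t::real. t)"
  using smooth_inner[of "{0::real<..}" 1] by simp

lemma smooth_sinh_pos: "smooth {0<..} (sinh :: real \<Rightarrow> real)"
  by (rule smooth_subset[OF smooth_sinh_real]) simp

lemma smooth_cosh_pos: "smooth {0<..} (cosh :: real \<Rightarrow> real)"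
proof -
  define F where "F n = (if even n then cosh else sinh :: real \<Rightarrow> real)" for n :: nat
  have "smooth {0<..} (F 0)"
    by (rule smooth_realI) (auto simp: F_def intro!: derivative_eq_intros)
  then show ?thesis by (simp add: F_def)
qed

lemma smooth_coth: "smooth {0<..} coth"
  unfolding coth_def[abs_def]
  by (rule smooth_divide[OF _ smooth_cosh_pos smooth_sinh_pos]) auto

lemmas smooth_pos_intros =
  smooth_const smooth_ident smooth_sinh_pos smooth_cosh_pos smooth_coth smooth_powr_real smooth_ln_real
  smooth_add[of "{0::real<..}", OF open_greaterThan] smooth_diff[of "{0::real<..}", OF open_greaterThan]
  smooth_minus[of "{0::real<..}", OF open_greaterThan]
  smooth_mult[of "{0::real<..}", OF open_greaterThan] smooth_power[of "{0::real<..}", OF open_greaterThan]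
  smooth_divide[of "{0::real<..}", OF open_greaterThan]

lemma coth_has_derivative:
  assumes "t > 0"
  shows "(coth has_real_derivative (- 1 / (sinh t)\<^sup>2)) (at t)"
proof -
  have s: "sinh t \<noteq> 0" using assms by simp
  have "((\<lambda>t. cosh t / sinh t) has_real_derivative
      (sinh t * sinh t - cosh t * cosh t) / (sinh t * sinh t)) (at t)"
    by (auto intro!: derivative_eq_intros s)
  moreover have "sinh t * sinh t - cosh t * cosh t = - 1"
    using cosh_square_eq[of t] by (simp add: power2_eq_square)
  ultimately show ?thesis
    unfolding coth_def[abs_def] by (simp add: power2_eq_square)
qed

lemma inverse_sinh_sq: "t > 0 \<Longrightarrow> 1 / (sinh t)\<^sup>2 = (coth t)\<^sup>2 - 1"
  using cosh_square_eq[of t] by (simp add: coth_def power_divide diff_divide_distrib field_simps)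

lemma tanh_artanh_real:
  fixes y :: real
  assumes "\<bar>y\<bar> < 1"
  shows "tanh (artanh y) = y"
proof -
  have y: "1 + y > 0" "1 - y > 0" using assms by auto
  have "exp (- 2 * artanh y) = inverse (exp (ln ((1 + y) / (1 - y))))"
    by (simp add: artanh_def exp_minus)
  also have "\<dots> = (1 - y) / (1 + y)"
    using y by (simp add: exp_ln)
  finally have e: "exp (- 2 * artanh y) = (1 - y) / (1 + y)" .
  show ?thesis
    unfolding tanh_real_altdef e using y by (simp add: field_simps)
qed

context hyp_pole
begin

section \<open>Geodesic rays as integral curves of the radial field\<close>

lemma polar_point_decomp:
  assumes "x \<in> \<Omega>"
  shows "polar_point x0 (rad x) (polar_dir x0 x) = x" and "norm (polar_dir x0 x) = 1"
proof -
  have x: "norm x < 1" "x \<noteq> x0" using \<Omega>_D[OF assms] by auto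
  define m where "m = moebius_add (- x0) x"
  have m: "moebius_add x0 m = x"
    using moebius_add_cancel_left[of "- x0" x] x0_norm x by (simp add: m_def)
  have "m \<noteq> 0" using m x by (auto simp: moebius_add_def)
  have "1 - (norm m)\<^sup>2 > 0"
  proof -
    define D where "D = 1 + 2 * (- x0 \<bullet> x) + (norm x0)\<^sup>2 * (norm x)\<^sup>2"
    have D: "D > 0" using moebius_add_denom_pos[of "- x0" x] x0_norm x by (simp add: D_def)
    have "(norm m)\<^sup>2 = ((norm x0)\<^sup>2 + 2 * (- x0 \<bullet> x) + (norm x)\<^sup>2) / D"
      using norm_moebius_add[of "- x0" x] x0_norm x by (simp add: m_def D_def)
    then have "1 - (norm m)\<^sup>2 = (1 - (norm x0)\<^sup>2) * (1 - (norm x)\<^sup>2) / D"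
      using D by (simp add: divide_simps) (simp add: D_def algebra_simps)
    then show ?thesis
      using D x x0_norm by (simp add: abs_square_less_1)
  qed
  then have m1: "norm m < 1" using abs_square_less_1[of "norm m"] by simp
  then show n: "norm (polar_dir x0 x) = 1"
    using \<open>m \<noteq> 0\<close> by (simp add: polar_dir_def m_def norm_sgn)
  define t where "t = 2 * artanh (norm m)"
  have tm: "tanh (t / 2) = norm m"
    using m1 by (simp add: t_def tanh_artanh_real)
  have "t \<ge> 0"
  proof (rule ccontr)
    assume "\<not> t \<ge> 0"
    then have "tanh (t / 2) < 0" by simp
    then show False using tm by simp
  qed
  have px: "polar_point x0 t (polar_dir x0 x) = x"
    using m \<open>m \<noteq> 0\<close> by (simp add: polar_point_def polar_dir_def m_def[symmetric] tm sgn_div_norm)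
  have "rad x = t"
    using hyp_dist_polar_point[of x0, OF _ n \<open>t \<ge> 0\<close>] x0_norm by (simp add: rad_def px hyp_space_def)
  then show "polar_point x0 (rad x) (polar_dir x0 x) = x" using px by simp
qed

lemma polar_point_in:
  assumes "norm \<theta> = 1" "t > 0"
  shows "polar_point x0 t \<theta> \<in> \<Omega>"
proof -
  define y where "y = tanh (t / 2) *\<^sub>R \<theta>"
  have y: "norm y < 1"
    using assms tanh_real_bounds[of "t/2"] by (auto simp: y_def abs_less_iff)
  define D where "D = 1 + 2 * (x0 \<bullet> y) + (norm x0)\<^sup>2 * (norm y)\<^sup>2"
  have D: "D > 0" using moebius_add_denom_pos[OF x0_norm y] by (simp add: D_def)
  have "(norm (moebius_add x0 y))\<^sup>2 = ((norm x0)\<^sup>2 + 2 * (x0 \<bullet> y) + (norm y)\<^sup>2) / D"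
    using norm_moebius_add[OF x0_norm y] by (simp add: D_def)
  then have "1 - (norm (moebius_add x0 y))\<^sup>2 = (1 - (norm x0)\<^sup>2) * (1 - (norm y)\<^sup>2) / D"
    using D by (simp add: divide_simps) (simp add: D_def algebra_simps)
  also have "\<dots> > 0" using D x0_norm y by (simp add: abs_square_less_1)
  finally have "norm (polar_point x0 t \<theta>) < 1"
    using abs_square_less_1[of "norm (moebius_add x0 y)"] by (simp add: polar_point_def y_def)
  moreover have "polar_point x0 t \<theta> \<noteq> x0"
  proof
    assume "polar_point x0 t \<theta> = x0"
    moreover have "hyp_dist x0 (polar_point x0 t \<theta>) = t"
      using assms x0_norm by (intro hyp_dist_polar_point) (auto simp: hyp_space_def)
    ultimately show False using assms by (simp add: hyp_dist_def)
  qed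
  ultimately show ?thesis by (auto simp: punctured_def)
qed

text \<open>The bridge from the polar coordinates of the statement to the frame. In the variable
  \<open>z = tanh (t / 2)\<close> the ray is a combination of \<open>x0\<close> and \<theta> with
  rational coefficients, and \<open>VP\<close> on the ray lies in the same span, so the two
  coefficients can be compared separately.\<close>

lemma polar_point_has_derivative:
  assumes th: "norm \<theta> = 1" and t: "t > 0"
  shows "((\<lambda>t. polar_point x0 t \<theta>) has_vector_derivative
    (1 / sinh t) *\<^sub>R VP (polar_point x0 t \<theta>)) (at t)"
proof -
  define p s where "p = x0 \<bullet> x0" and "s = x0 \<bullet> \<theta>"
  define A where "A z = (1 + 2 * s * z + z\<^sup>2) / (1 + 2 * s * z + p * z\<^sup>2)" for z
  define B where "B z = (1 - p) * z / (1 + 2 * s * z + p * z\<^sup>2)" for z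
  have g: "polar_point x0 t \<theta> = A (tanh (t / 2)) *\<^sub>R x0 + B (tanh (t / 2)) *\<^sub>R \<theta>" for t
    using th by (simp add: polar_point_def moebius_add_def A_def B_def p_def s_def
        power2_norm_eq_inner[of x0] power_mult_distrib scaleR_add_right mult_ac)
  define z where "z = tanh (t / 2)"
  have z: "0 < z" "z < 1" using t tanh_real_bounds[of "t/2"] by (auto simp: z_def)
  define D where "D = 1 + 2 * s * z + p * z\<^sup>2"
  have D: "D > 0"
  proof -
    have "norm (z *\<^sub>R \<theta>) < 1" using z th by simp
    from moebius_add_denom_pos[OF x0_norm this] show ?thesis
      using th z by (simp add: D_def s_def p_def power2_norm_eq_inner power_mult_distrib mult_ac norm_eq_1)
  qed
  have p: "1 - p > 0" using x0_sq by (simp add: p_def)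
  have zz: "z\<^sup>2 < 1" using z by (simp add: abs_square_less_1)
  have sinh_t: "sinh t = 2 * z / (1 - z\<^sup>2)"
  proof -
    have c: "cosh (t/2) > 0" by simp
    have "sinh t = 2 * sinh (t/2) * cosh (t/2)"
      using sinh_double[of "t/2"] by simp
    also have "\<dots> = 2 * z / (1 - z\<^sup>2)"
    proof -
      have "1 - z\<^sup>2 = 1 / (cosh (t/2))\<^sup>2"
        unfolding z_def tanh_def power_divide cosh_square_eq
        using add_nonneg_pos[of "(sinh (t/2))\<^sup>2" 1] by (simp add: divide_simps)
      then show ?thesis using c by (simp add: z_def tanh_def power2_eq_square)
    qed
    finally show ?thesis .
  qed
  have dz: "((\<lambda>t. tanh (t / 2)) has_real_derivative (1 - z\<^sup>2) / 2) (at t)"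
    by (auto intro!: derivative_eq_intros simp: z_def)
  have A': "(A has_real_derivative 2 * z * (1 - p) * (1 + s * z) / D\<^sup>2) (at z)"
  proof -
    have n: "1 + 2 * s * z + p * z\<^sup>2 \<noteq> 0" using D by (simp add: D_def)
    have "(A has_real_derivative ((2 * s + 2 * z) * (1 + 2 * s * z + p * z\<^sup>2)
        - (1 + 2 * s * z + z\<^sup>2) * (2 * s + p * (2 * z))) / ((1 + 2 * s * z + p * z\<^sup>2) * (1 + 2 * s * z + p * z\<^sup>2))) (at z)"
      unfolding A_def by (rule derivative_eq_intros refl n)+ simp
    also have "(2 * s + 2 * z) * (1 + 2 * s * z + p * z\<^sup>2) - (1 + 2 * s * z + z\<^sup>2) * (2 * s + p * (2 * z))
        = 2 * z * (1 - p) * (1 + s * z)"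
      by (simp add: power2_eq_square algebra_simps)
    finally show ?thesis by (simp add: D_def power2_eq_square)
  qed
  have B': "(B has_real_derivative (1 - p) * (1 - p * z\<^sup>2) / D\<^sup>2) (at z)"
  proof -
    have n: "1 + 2 * s * z + p * z\<^sup>2 \<noteq> 0" using D by (simp add: D_def)
    have "(B has_real_derivative ((1 - p) * (1 + 2 * s * z + p * z\<^sup>2)
        - ((1 - p) * z) * (2 * s + p * (2 * z))) / ((1 + 2 * s * z + p * z\<^sup>2) * (1 + 2 * s * z + p * z\<^sup>2))) (at z)"
      unfolding B_def by (rule derivative_eq_intros refl n)+ simp
    also have "(1 - p) * (1 + 2 * s * z + p * z\<^sup>2) - ((1 - p) * z) * (2 * s + p * (2 * z))
        = (1 - p) * (1 - p * z\<^sup>2)"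
      by (simp add: power2_eq_square algebra_simps)
    finally show ?thesis by (simp add: D_def power2_eq_square)
  qed
  have dA: "((\<lambda>t. A (tanh (t / 2))) has_real_derivative
      2 * z * (1 - p) * (1 + s * z) / D\<^sup>2 * ((1 - z\<^sup>2) / 2)) (at t)"
    using A' unfolding z_def by (rule DERIV_chain2[OF _ dz[unfolded z_def]])
  have dB: "((\<lambda>t. B (tanh (t / 2))) has_real_derivative
      (1 - p) * (1 - p * z\<^sup>2) / D\<^sup>2 * ((1 - z\<^sup>2) / 2)) (at t)"
    using B' unfolding z_def by (rule DERIV_chain2[OF _ dz[unfolded z_def]])
  have der: "((\<lambda>t. polar_point x0 t \<theta>) has_vector_derivative
      (2 * z * (1 - p) * (1 + s * z) / D\<^sup>2 * ((1 - z\<^sup>2) / 2)) *\<^sub>R x0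
      + ((1 - p) * (1 - p * z\<^sup>2) / D\<^sup>2 * ((1 - z\<^sup>2) / 2)) *\<^sub>R \<theta>) (at t)"
    unfolding g using dA dB
    by (intro has_vector_derivative_add)
       (auto intro!: derivative_eq_intros simp: has_vector_derivative_def has_field_derivative_def
         fun_eq_iff scaleR_scaleR mult_ac)
  define x where "x = A z *\<^sub>R x0 + B z *\<^sub>R \<theta>"
  have th2: "\<theta> \<bullet> \<theta> = 1" using th by (simp add: norm_eq_1)
  have Az: "A z = (1 + 2 * s * z + z\<^sup>2) / D" and Bz: "B z = (1 - p) * z / D"
    by (simp_all add: A_def B_def D_def)
  have q: "1 - x \<bullet> x = (1 - p) * (1 - z\<^sup>2) / D"
  proof -
    have "x \<bullet> x = (A z)\<^sup>2 * p + 2 * A z * B z * s + (B z)\<^sup>2"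
      by (simp add: x_def inner_add_left inner_add_right th2 p_def s_def inner_commute power2_eq_square algebra_simps)
    also have "\<dots> = ((1 + 2 * s * z + z\<^sup>2)\<^sup>2 * p + 2 * (1 + 2 * s * z + z\<^sup>2) * ((1 - p) * z) * s + ((1 - p) * z)\<^sup>2) / D\<^sup>2"
    proof -
      have "(a / D)\<^sup>2 * p + 2 * (a / D) * (b / D) * s + (b / D)\<^sup>2 = (a\<^sup>2 * p + 2 * a * b * s + b\<^sup>2) / D\<^sup>2" for a b
        using D by (simp add: field_simps power2_eq_square)
      then show ?thesis unfolding Az Bz .
    qed
    also have "(1 + 2 * s * z + z\<^sup>2)\<^sup>2 * p + 2 * (1 + 2 * s * z + z\<^sup>2) * ((1 - p) * z) * s + ((1 - p) * z)\<^sup>2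
        = (p + 2 * s * z + z\<^sup>2) * D"
      by (simp add: D_def power2_eq_square algebra_simps)
    finally have "x \<bullet> x = (p + 2 * s * z + z\<^sup>2) / D" using D by (simp add: power2_eq_square)
    then have "1 - x \<bullet> x = (D - (p + 2 * s * z + z\<^sup>2)) / D" using D by (simp add: diff_divide_distrib)
    then show ?thesis by (simp add: D_def algebra_simps)
  qed
  have ip: "(1 + p - 2 * (x0 \<bullet> x)) / (1 - p) = (1 - p * z\<^sup>2) / D"
  proof -
    have "x0 \<bullet> x = A z * p + B z * s"
      by (simp add: x_def inner_add_right p_def s_def)
    also have "\<dots> = ((1 + 2 * s * z + z\<^sup>2) * p + (1 - p) * z * s) / D"
    proof -
      have "a / D * p + b / D * s = (a * p + b * s) / D" for a b
        by (simp add: add_divide_distrib)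
      then show ?thesis unfolding Az Bz .
    qed
    finally have "1 + p - 2 * (x0 \<bullet> x) = ((1 + p) * D - 2 * ((1 + 2 * s * z + z\<^sup>2) * p + (1 - p) * z * s)) / D"
      using D by (simp add: diff_divide_distrib)
    also have "(1 + p) * D - 2 * ((1 + 2 * s * z + z\<^sup>2) * p + (1 - p) * z * s) = (1 - p) * (1 - p * z\<^sup>2)"
      by (simp add: D_def power2_eq_square algebra_simps)
    finally show ?thesis using p by simp
  qed
  have V: "VP x = - ((1 - x \<bullet> x) / (1 - p)) *\<^sub>R x0 + ((1 + p - 2 * (x0 \<bullet> x)) / (1 - p)) *\<^sub>R x"
  proof -
    have "VP x = (1/2 * ((1 - x \<bullet> x) * - pole_scale)) *\<^sub>R x0
        + (1/2 * (2 * (pole_time + - pole_scale * (x0 \<bullet> x)))) *\<^sub>R x"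
      unfolding VP_def mink_vec_def scaleR_add_right scaleR_scaleR inner_scaleR_left ..
    also have "1/2 * ((1 - x \<bullet> x) * - pole_scale) = - ((1 - x \<bullet> x) / (1 - p))"
      using p by (simp add: pole_scale_def p_def[symmetric] field_simps)
    also have "1/2 * (2 * (pole_time + - pole_scale * (x0 \<bullet> x))) = (1 + p - 2 * (x0 \<bullet> x)) / (1 - p)"
    proof -
      have "1/2 * (2 * (a / d + - (b / d) * y)) = (a - b * y) / d" for a b d y :: real
        by (simp add: diff_divide_distrib)
      then show ?thesis unfolding pole_scale_def pole_time_def p_def[symmetric] .
    qed
    finally show ?thesis .
  qed
  have "VP x = - ((1 - z\<^sup>2) / D) *\<^sub>R x0 + ((1 - p * z\<^sup>2) / D) *\<^sub>R x"
    unfolding V ip q using p by simp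
  also have "\<dots> = (- ((1 - z\<^sup>2) / D) + (1 - p * z\<^sup>2) / D * A z) *\<^sub>R x0 + ((1 - p * z\<^sup>2) / D * B z) *\<^sub>R \<theta>"
    by (simp add: x_def scaleR_add_right scaleR_diff_left)
  also have "- ((1 - z\<^sup>2) / D) + (1 - p * z\<^sup>2) / D * A z = 2 * z\<^sup>2 * (1 - p) * (1 + s * z) / D\<^sup>2"
  proof -
    have "- ((1 - z\<^sup>2) / D) + (1 - p * z\<^sup>2) / D * A z
        = (- (1 - z\<^sup>2) * D + (1 - p * z\<^sup>2) * (1 + 2 * s * z + z\<^sup>2)) / D\<^sup>2"
      unfolding Az using D by (simp add: field_simps power2_eq_square)
    also have "- (1 - z\<^sup>2) * D + (1 - p * z\<^sup>2) * (1 + 2 * s * z + z\<^sup>2) = 2 * z\<^sup>2 * (1 - p) * (1 + s * z)"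
      by (simp add: D_def power2_eq_square algebra_simps)
    finally show ?thesis .
  qed
  finally have VPx: "(1 / sinh t) *\<^sub>R VP x = (1 / sinh t * (2 * z\<^sup>2 * (1 - p) * (1 + s * z) / D\<^sup>2)) *\<^sub>R x0
      + (1 / sinh t * ((1 - p * z\<^sup>2) / D * B z)) *\<^sub>R \<theta>"
    by (simp add: scaleR_add_right)
  have c1: "1 / sinh t * (2 * z\<^sup>2 * (1 - p) * (1 + s * z) / D\<^sup>2)
      = 2 * z * (1 - p) * (1 + s * z) / D\<^sup>2 * ((1 - z\<^sup>2) / 2)"
    unfolding sinh_t using z zz D by (simp add: power2_eq_square)
  have c2: "1 / sinh t * ((1 - p * z\<^sup>2) / D * B z) = (1 - p) * (1 - p * z\<^sup>2) / D\<^sup>2 * ((1 - z\<^sup>2) / 2)"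
    unfolding sinh_t Bz using z zz D by (simp add: power2_eq_square mult_ac)
  have "polar_point x0 t \<theta> = x" by (simp add: g x_def z_def)
  then show ?thesis
    using der VPx unfolding c1 c2 by simp
qed

lemma radial_deriv_eq:
  assumes x: "x \<in> \<Omega>" and v: "v differentiable at x"
  shows "radial_deriv x0 v x = Xr v x"
proof -
  let ?\<theta> = "polar_dir x0 x"
  note pd = polar_point_decomp[OF x]
  have "((\<lambda>t. polar_point x0 t ?\<theta>) has_derivative (\<lambda>h. h *\<^sub>R ((1 / sh x) *\<^sub>R VP x))) (at (rad x))"
    using polar_point_has_derivative[OF pd(2) rad_pos[OF x]]
    by (simp add: has_vector_derivative_def pd(1) sh_def)
  moreover have "(v has_derivative frechet_derivative v (at x)) (at (polar_point x0 (rad x) ?\<theta>))"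
    unfolding pd(1) using v by (simp flip: frechet_derivative_works)
  ultimately have "((\<lambda>t. v (polar_point x0 t ?\<theta>)) has_derivative
      (\<lambda>h. frechet_derivative v (at x) (h *\<^sub>R ((1 / sh x) *\<^sub>R VP x)))) (at (rad x))"
    by (rule has_derivative_compose)
  then have "((\<lambda>t. v (polar_point x0 t ?\<theta>)) has_derivative (*) (Xr v x)) (at (rad x))"
    by (rule has_derivative_eq_rhs)
       (auto simp: fun_eq_iff Xr_def vf_def linear_scale[OF linear_frechet_derivative[OF v]])
  then have "((\<lambda>t. v (polar_point x0 t ?\<theta>)) has_real_derivative Xr v x) (at (rad x))"
    by (simp add: has_field_derivative_def)
  then show ?thesis
    unfolding radial_deriv_def rad_def[symmetric] by (rule DERIV_imp_deriv)
qed

lemma radial_deriv_cong: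
  assumes x: "x \<in> \<Omega>" and eq: "\<And>y. y \<in> \<Omega> \<Longrightarrow> u y = v y"
  shows "radial_deriv x0 u x = radial_deriv x0 v x"
proof -
  note pd = polar_point_decomp[OF x]
  have "eventually (\<lambda>t. t \<in> {0<..}) (nhds (rad x))"
    using rad_pos[OF x] by (intro eventually_nhds_in_open) auto
  then have "eventually (\<lambda>t. u (polar_point x0 t (polar_dir x0 x)) = v (polar_point x0 t (polar_dir x0 x)))
      (nhds (rad x))"
    by eventually_elim (use eq polar_point_in[OF pd(2)] in auto)
  then show ?thesis
    unfolding radial_deriv_def rad_def[symmetric] by (intro deriv_cong_ev) auto
qed

lemma Xr_cong: "x \<in> \<Omega> \<Longrightarrow> (\<And>y. y \<in> \<Omega> \<Longrightarrow> u y = v y) \<Longrightarrow> Xr u x = Xr v x"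
  unfolding Xr_def by (rule vf_cong[OF open_punctured])

lemma Dt_cong: "x \<in> \<Omega> \<Longrightarrow> (\<And>y. y \<in> \<Omega> \<Longrightarrow> u y = v y) \<Longrightarrow> Dt i u x = Dt i v x"
  unfolding Dt_def by (rule vf_cong[OF open_punctured])

definition Lr :: "('a \<Rightarrow> real) \<Rightarrow> 'a \<Rightarrow> real" where
  "Lr u x = Xr (Xr u) x + (real DIM('a) - 1) * coth (rad x) * Xr u x"

lemma radial_laplace_eq:
  assumes x: "x \<in> \<Omega>" and u: "smooth \<Omega> u"
  shows "radial_laplace x0 u x = Lr u x"
proof -
  have "radial_deriv x0 (radial_deriv x0 u) x = radial_deriv x0 (Xr u) x"
    by (rule radial_deriv_cong[OF x]) (simp add: radial_deriv_eq diff\<Omega>[OF u])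
  also have "\<dots> = Xr (Xr u) x"
    by (rule radial_deriv_eq[OF x diff\<Omega>[OF smooth_Xr[OF u] x]])
  finally show ?thesis
    by (simp add: radial_laplace_def Lr_def rad_def radial_deriv_eq[OF x diff\<Omega>[OF u x]])
qed

lemma cpt_smooth_test:
  assumes "u \<in> test_functions x0"
  shows "cpt_smooth x0 u"
proof -
  let ?K = "closure {x. u x \<noteq> 0}"
  have "smooth UNIV u"
    using assms by (simp add: test_functions_def smooth_def C_k_eq_Ck_on)
  then have "smooth \<Omega> u" by (rule smooth_subset) simp
  moreover have "\<forall>x\<in>\<Omega> - ?K. u x = 0"
    using closure_subset[of "{x. u x \<noteq> 0}"] by auto
  moreover have "compact ?K" "?K \<subseteq> \<Omega>"
    using assms unfolding test_functions_def hyp_space_def punctured_def by simp_all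
  ultimately show ?thesis unfolding cpt_smooth_def by blast
qed

lemma test_ext_zero:
  assumes "cpt_smooth x0 f"
  shows "ext_zero x0 f \<in> test_functions x0"
proof -
  obtain K where K: "compact K" "K \<subseteq> \<Omega>" "\<And>x. x \<in> \<Omega> - K \<Longrightarrow> f x = 0" and f: "smooth \<Omega> f"
    using assms unfolding cpt_smooth_def by blast
  have "{x. ext_zero x0 f x \<noteq> 0} \<subseteq> K"
    using K(3) by (auto simp: ext_zero_def split: if_splits)
  then have c: "closure {x. ext_zero x0 f x \<noteq> 0} \<subseteq> K"
    by (rule closure_minimal[OF _ compact_imp_closed[OF K(1)]])
  then have "compact (closure {x. ext_zero x0 f x \<noteq> 0})"
    using compact_imp_bounded[OF K(1)] bounded_subset by (simp add: compact_eq_bounded_closed) blast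
  then show ?thesis
    using c K(2) smooth_ext_zero[OF f K]
    by (auto simp: test_functions_def smooth_def C_k_eq_Ck_on hyp_space_def punctured_def)
qed

section \<open>Calculus with radial coefficients\<close>

lemma smooth_radial: "smooth {0<..} F \<Longrightarrow> smooth \<Omega> (\<lambda>x. F (rad x))"
  by (rule smooth_compose[OF open_punctured _ smooth_rad]) (auto simp: rad_pos)

lemma cpt_smooth_radial:
  "cpt_smooth x0 g \<Longrightarrow> smooth {0<..} F \<Longrightarrow> cpt_smooth x0 (\<lambda>x. F (rad x) * g x)"
  by (rule cpt_smooth_mult_left[OF _ smooth_radial])

lemma Xr_radial:
  "x \<in> \<Omega> \<Longrightarrow> (F has_real_derivative F') (at (rad x)) \<Longrightarrow> Xr (\<lambda>y. F (rad y)) x = F'"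
  using vf_compose[OF diff\<Omega>[OF smooth_rad]] Xr_rad by (simp add: Xr_def)

lemma Dt_radial:
  assumes "x \<in> \<Omega>" "F differentiable at (rad x)"
  shows "Dt v (\<lambda>y. F (rad y)) x = 0"
proof -
  obtain F' where "(F has_real_derivative F') (at (rad x))"
    using assms(2) real_differentiable_def by blast
  from vf_compose[OF diff\<Omega>[OF smooth_rad assms(1)] this] show ?thesis
    using Dt_rad[OF assms(1)] by (simp add: Dt_def)
qed

lemma Xr_mult:
  "smooth \<Omega> f \<Longrightarrow> smooth \<Omega> g \<Longrightarrow> x \<in> \<Omega> \<Longrightarrow> Xr (\<lambda>y. f y * g y) x = Xr f x * g x + f x * Xr g x"
  unfolding Xr_def by (simp add: vf_mult diff\<Omega>)

lemma Dt_mult: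
  "smooth \<Omega> f \<Longrightarrow> smooth \<Omega> g \<Longrightarrow> x \<in> \<Omega> \<Longrightarrow> Dt i (\<lambda>y. f y * g y) x = Dt i f x * g x + f x * Dt i g x"
  unfolding Dt_def by (simp add: vf_mult diff\<Omega>)

lemma Xr_radial_mult:
  assumes "smooth {0<..} F" "smooth \<Omega> g" "x \<in> \<Omega>" "(F has_real_derivative F') (at (rad x))"
  shows "Xr (\<lambda>y. F (rad y) * g y) x = F' * g x + F (rad x) * Xr g x"
  using Xr_mult[OF smooth_radial[OF assms(1)] assms(2,3)] Xr_radial[OF assms(3,4)] by simp

lemma Dt_radial_mult:
  assumes "smooth {0<..} F" "smooth \<Omega> g" "x \<in> \<Omega>"
  shows "Dt i (\<lambda>y. F (rad y) * g y) x = F (rad x) * Dt i g x"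
  using Dt_mult[OF smooth_radial[OF assms(1)] assms(2,3)] Dt_radial[OF assms(3)]
    smooth_differentiable[OF assms(1)] rad_pos[OF assms(3)] by simp

lemma cpt_smooth_mult: "cpt_smooth x0 f \<Longrightarrow> cpt_smooth x0 g \<Longrightarrow> cpt_smooth x0 (\<lambda>x. f x * g x)"
  using cpt_smooth_mult_left cpt_smooth_smooth by blast

lemma cpt_smooth_cmult: "cpt_smooth x0 f \<Longrightarrow> cpt_smooth x0 (\<lambda>x. c * f x)"
  using cpt_smooth_mult_left smooth_const by blast

lemma cpt_smooth_diff: "cpt_smooth x0 f \<Longrightarrow> cpt_smooth x0 g \<Longrightarrow> cpt_smooth x0 (\<lambda>x. f x - g x)"
  using cpt_smooth_add[OF _ cpt_smooth_cmult[of g "-1"]] by simp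

lemma cpt_smooth_power: "cpt_smooth x0 f \<Longrightarrow> cpt_smooth x0 (\<lambda>x. (f x)\<^sup>2)"
  using cpt_smooth_mult[of f f] by (simp add: power2_eq_square)

lemma cpt_smooth_Lr:
  assumes "cpt_smooth x0 u"
  shows "cpt_smooth x0 (Lr u)"
proof -
  have c: "smooth {0<..} (\<lambda>t. (real DIM('a) - 1) * coth t)"
    by (intro smooth_pos_intros)
  show ?thesis
    unfolding Lr_def[abs_def]
    by (rule cpt_smooth_add[OF cpt_smooth_Xr[OF cpt_smooth_Xr] cpt_smooth_radial[OF cpt_smooth_Xr c]])
       (rule assms)+
qed

abbreviation "HI f \<equiv> integral\<^sup>L hyp_vol f"

lemmas Int_integrable = hyp_vol_integral_cpt_smooth(1)[of x0]

lemma Int_add: "cpt_smooth x0 f \<Longrightarrow> cpt_smooth x0 g \<Longrightarrow> HI (\<lambda>x. f x + g x) = HI f + HI g"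
  by (simp add: Int_integrable)

lemma Int_diff: "cpt_smooth x0 f \<Longrightarrow> cpt_smooth x0 g \<Longrightarrow> HI (\<lambda>x. f x - g x) = HI f - HI g"
  by (simp add: Int_integrable)

lemma Int_sum: "(\<And>i. i \<in> I \<Longrightarrow> cpt_smooth x0 (f i)) \<Longrightarrow> HI (\<lambda>x. \<Sum>i\<in>I. f i x) = (\<Sum>i\<in>I. HI (f i))"
  by (rule Bochner_Integration.integral_sum) (rule Int_integrable)

lemma integral_radial_parts:
  assumes f: "cpt_smooth x0 f" and F: "smooth {0<..} F" and F': "smooth {0<..} F'"
    and der: "\<And>t. t > 0 \<Longrightarrow> (F has_real_derivative F' t) (at t)"
  shows "HI (\<lambda>x. F (rad x) * Xr f x) = - HI (\<lambda>x. (F' (rad x) + (real DIM('a) - 1) * coth (rad x) * F (rad x)) * f x)"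
proof -
  let ?G = "\<lambda>t. F' t + (real DIM('a) - 1) * coth t * F t"
  have a: "cpt_smooth x0 (\<lambda>x. F (rad x) * Xr f x)"
    by (rule cpt_smooth_radial[OF cpt_smooth_Xr[OF f] F])
  have b: "cpt_smooth x0 (\<lambda>x. ?G (rad x) * f x)"
    by (rule cpt_smooth_radial[OF f]) (intro smooth_pos_intros F F')
  have "HI (\<lambda>x. F (rad x) * Xr f x) + HI (\<lambda>x. ?G (rad x) * f x)
      = HI (\<lambda>x. F (rad x) * Xr f x + ?G (rad x) * f x)"
    by (rule Int_add[OF a b, symmetric])
  also have "\<dots> = HI (\<lambda>x. Xr (\<lambda>y. F (rad y) * f y) x + (real DIM('a) - 1) * coth (rad x) * (F (rad x) * f x))"
    by (rule hyp_vol_integral_cong[OF cpt_smooth_add[OF a b]])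
       (simp add: Xr_radial_mult[OF F cpt_smooth_smooth[OF f] _ der] rad_pos, simp add: algebra_simps)
  also have "\<dots> = 0" by (rule integral_Xr[OF cpt_smooth_radial[OF f F]])
  finally show ?thesis by simp
qed

lemma integral_Dt_parts:
  assumes f: "cpt_smooth x0 f" and g: "smooth \<Omega> g" and F: "smooth {0<..} F"
  shows "HI (\<lambda>x. F (rad x) * (g x * Dt i f x))
    = - HI (\<lambda>x. F (rad x) * (Dt i g x * f x)) + (real DIM('a) - 1) * HI (\<lambda>x. F (rad x) * (th i x * g x * f x))"
proof -
  have s: "smooth \<Omega> f" by (rule cpt_smooth_smooth[OF f])
  have gf: "cpt_smooth x0 (\<lambda>x. g x * f x)" by (rule cpt_smooth_mult_left[OF f g])
  have a: "cpt_smooth x0 (\<lambda>x. F (rad x) * (g x * Dt i f x))"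
    by (rule cpt_smooth_radial[OF cpt_smooth_mult_left[OF cpt_smooth_Dt[OF f] g] F])
  have b: "cpt_smooth x0 (\<lambda>x. F (rad x) * (Dt i g x * f x))"
    by (rule cpt_smooth_radial[OF cpt_smooth_mult_left[OF f smooth_Dt[OF g]] F])
  have c: "cpt_smooth x0 (\<lambda>x. F (rad x) * (th i x * g x * f x))"
    by (rule cpt_smooth_radial[OF cpt_smooth_mult_left[OF f smooth_mult[OF open_punctured smooth_th g]] F])
  have "HI (\<lambda>x. F (rad x) * (g x * Dt i f x)) + HI (\<lambda>x. F (rad x) * (Dt i g x * f x))
      - (real DIM('a) - 1) * HI (\<lambda>x. F (rad x) * (th i x * g x * f x))
      = HI (\<lambda>x. F (rad x) * (g x * Dt i f x) + F (rad x) * (Dt i g x * f x)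
          - (real DIM('a) - 1) * (F (rad x) * (th i x * g x * f x)))"
    using Int_diff[OF cpt_smooth_add[OF a b] cpt_smooth_cmult[OF c, of "real DIM('a) - 1"]] Int_add[OF a b] by simp
  also have "\<dots> = HI (\<lambda>x. Dt i (\<lambda>y. F (rad y) * (g y * f y)) x - (real DIM('a) - 1) * th i x * (F (rad x) * (g x * f x)))"
    by (rule hyp_vol_integral_cong[OF cpt_smooth_diff[OF cpt_smooth_add[OF a b] cpt_smooth_cmult[OF c]]])
       (simp add: Dt_radial_mult[OF F cpt_smooth_smooth[OF gf]] Dt_mult[OF g s], simp add: algebra_simps)
  also have "\<dots> = 0" by (rule integral_Dt[OF cpt_smooth_radial[OF gf F]])
  finally show ?thesis by simp
qed

section \<open>The radial identity and the spectral gap of the sphere\<close>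

lemma HI_cong: "cpt_smooth x0 f \<Longrightarrow> (\<And>x. x \<in> \<Omega> \<Longrightarrow> g x = f x) \<Longrightarrow> HI g = HI f"
  using hyp_vol_integral_cong[of x0 f g] by simp

lemma HI_lin2:
  assumes "cpt_smooth x0 f" "cpt_smooth x0 g" "\<And>x. x \<in> \<Omega> \<Longrightarrow> h x = a * f x + b * g x"
  shows "HI h = a * HI f + b * HI g"
  using HI_cong[OF cpt_smooth_add[OF cpt_smooth_cmult[OF assms(1)] cpt_smooth_cmult[OF assms(2)]] assms(3)]
    Int_add[OF cpt_smooth_cmult[OF assms(1)] cpt_smooth_cmult[OF assms(2)]] by simp

lemma HI_lin3:
  assumes "cpt_smooth x0 f" "cpt_smooth x0 g" "cpt_smooth x0 k"
    "\<And>x. x \<in> \<Omega> \<Longrightarrow> h x = a * f x + b * g x + c * k x"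
  shows "HI h = a * HI f + b * HI g + c * HI k"
  using HI_lin2[OF cpt_smooth_add[OF cpt_smooth_cmult[OF assms(1), of a] cpt_smooth_cmult[OF assms(2), of b]]
      assms(3), of h 1 c] assms(4)
    HI_lin2[OF assms(1,2), of "\<lambda>x. a * f x + b * g x" a b] by simp

lemma Xr_square: "smooth \<Omega> f \<Longrightarrow> x \<in> \<Omega> \<Longrightarrow> Xr (\<lambda>y. (f y)\<^sup>2) x = 2 * f x * Xr f x"
  using Xr_mult[of f f x] by (simp add: power2_eq_square)

text \<open>Every term is a combination of the seven integrals \<open>a\<close>, \<open>b\<close>,
  \<open>c\<close>, \<open>d\<close>, \<open>e\<close>, \<open>s\<close>, \<open>q\<close>. In
  \<open>e\<close> and \<open>s\<close> the integrand contains half the radial derivative of a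
  square; integrating by parts expresses both through \<open>a\<close>, \<open>b\<close>,
  \<open>c\<close>, \<open>d\<close>, and the claim becomes an identity of coefficients.\<close>

lemma rellich_identity:
  assumes u: "cpt_smooth x0 u"
  defines "n \<equiv> real DIM('a)"
  shows "HI (\<lambda>x. (Lr u x)\<^sup>2) =
      n\<^sup>2 / 4 * ((n - 4) / 2)\<^sup>2 * HI (\<lambda>x. (u x)\<^sup>2 / rad x ^ 4)
    + n\<^sup>2 * (n - 4) * (n - 1) / 8 * HI (\<lambda>x. (rad x * coth (rad x) - 1) / rad x ^ 4 * (u x)\<^sup>2)
    + n * (n - 1) / 2 * HI (\<lambda>x. (rad x * coth (rad x) - 1) / (rad x)\<^sup>2 * (Xr u x)\<^sup>2)
    + n\<^sup>2 / 4 * HI (\<lambda>x. (Xr u x + (n - 4) / 2 / rad x * u x)\<^sup>2 / (rad x)\<^sup>2)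
    + HI (\<lambda>x. (Lr u x - n / (2 * rad x) * Xr u x)\<^sup>2)"
proof -
  let ?P = "Xr u" and ?L = "Lr u"
  have P: "cpt_smooth x0 ?P" by (rule cpt_smooth_Xr[OF u])
  have L: "cpt_smooth x0 ?L" by (rule cpt_smooth_Lr[OF u])
  have su: "smooth \<Omega> u" and sP: "smooth \<Omega> ?P"
    using u P by (simp_all add: cpt_smooth_smooth)
  note u2 = cpt_smooth_power[OF u] and P2 = cpt_smooth_power[OF P] and L2 = cpt_smooth_power[OF L]
    and uP = cpt_smooth_mult[OF u P] and LP = cpt_smooth_mult[OF L P]
  have A: "cpt_smooth x0 (\<lambda>x. 1 / rad x ^ 4 * (u x)\<^sup>2)"
    by (rule cpt_smooth_radial[OF u2, of "\<lambda>t. 1 / t ^ 4"]) (intro smooth_pos_intros, simp)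
  have B: "cpt_smooth x0 (\<lambda>x. coth (rad x) / rad x ^ 3 * (u x)\<^sup>2)"
    by (rule cpt_smooth_radial[OF u2, of "\<lambda>t. coth t / t ^ 3"]) (intro smooth_pos_intros, simp)
  have C: "cpt_smooth x0 (\<lambda>x. 1 / (rad x)\<^sup>2 * (?P x)\<^sup>2)"
    by (rule cpt_smooth_radial[OF P2, of "\<lambda>t. 1 / t\<^sup>2"]) (intro smooth_pos_intros, simp)
  have D: "cpt_smooth x0 (\<lambda>x. coth (rad x) / rad x * (?P x)\<^sup>2)"
    by (rule cpt_smooth_radial[OF P2, of "\<lambda>t. coth t / t"]) (intro smooth_pos_intros, simp)
  have E: "cpt_smooth x0 (\<lambda>x. 1 / rad x ^ 3 * (u x * ?P x))"
    by (rule cpt_smooth_radial[OF uP, of "\<lambda>t. 1 / t ^ 3"]) (intro smooth_pos_intros, simp)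
  have S: "cpt_smooth x0 (\<lambda>x. 1 / rad x * (?L x * ?P x))"
    by (rule cpt_smooth_radial[OF LP, of "\<lambda>t. 1 / t"]) (intro smooth_pos_intros, simp)
  define a b c d e s where "a = HI (\<lambda>x. 1 / rad x ^ 4 * (u x)\<^sup>2)"
    and "b = HI (\<lambda>x. coth (rad x) / rad x ^ 3 * (u x)\<^sup>2)"
    and "c = HI (\<lambda>x. 1 / (rad x)\<^sup>2 * (?P x)\<^sup>2)" and "d = HI (\<lambda>x. coth (rad x) / rad x * (?P x)\<^sup>2)"
    and "e = HI (\<lambda>x. 1 / rad x ^ 3 * (u x * ?P x))" and "s = HI (\<lambda>x. 1 / rad x * (?L x * ?P x))"
  define q where "q = HI (\<lambda>x. (?L x)\<^sup>2)"
  have e: "2 * e = 3 * a - (n - 1) * b"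
  proof -
    have "2 * e = HI (\<lambda>x. 1 / rad x ^ 3 * Xr (\<lambda>y. (u y)\<^sup>2) x)"
      unfolding e_def using HI_lin2[OF E E, of "\<lambda>x. 1 / rad x ^ 3 * Xr (\<lambda>y. (u y)\<^sup>2) x" 1 1]
      by (simp add: Xr_square[OF su])
    also have "\<dots> = - HI (\<lambda>x. (- 3 / rad x ^ 4 + (n - 1) * coth (rad x) * (1 / rad x ^ 3)) * (u x)\<^sup>2)"
      unfolding n_def
    proof (rule integral_radial_parts[OF u2, of "\<lambda>t. 1 / t ^ 3" "\<lambda>t. - 3 / t ^ 4"])
      show "smooth {0<..} (\<lambda>t::real. 1 / t ^ 3)" "smooth {0<..} (\<lambda>t::real. - 3 / t ^ 4)"
        by (intro smooth_pos_intros, simp)+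
      show "((\<lambda>t. 1 / t ^ 3) has_real_derivative - 3 / t ^ 4) (at t)" if "t > 0" for t :: real
        using that by (auto intro!: derivative_eq_intros simp: field_simps eval_nat_numeral)
    qed
    also have "HI (\<lambda>x. (- 3 / rad x ^ 4 + (n - 1) * coth (rad x) * (1 / rad x ^ 3)) * (u x)\<^sup>2)
        = (-3) * a + (n - 1) * b"
      unfolding a_def b_def by (rule HI_lin2[OF A B]) (simp add: algebra_simps add_divide_distrib diff_divide_distrib)
    finally show ?thesis by simp
  qed
  have s: "2 * s = c + (n - 1) * d"
  proof -
    have "HI (\<lambda>x. 1 / rad x * Xr (\<lambda>y. (?P y)\<^sup>2) x) = 2 * s + (- 2 * (n - 1)) * d"
      unfolding s_def d_def
    proof (rule HI_lin2[OF S D])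
      fix x assume x: "x \<in> \<Omega>"
      have L: "?L x = Xr ?P x + (n - 1) * coth (rad x) * ?P x" by (simp add: Lr_def n_def)
      have "1 / t * (2 * p * q) = 2 * (1 / t * ((q + m * k * p) * p)) + - 2 * m * (k / t * p\<^sup>2)"
        for p q k m t :: real by (simp add: power2_eq_square algebra_simps add_divide_distrib)
      then show "1 / rad x * Xr (\<lambda>y. (?P y)\<^sup>2) x =
          2 * (1 / rad x * (?L x * ?P x)) + - 2 * (n - 1) * (coth (rad x) / rad x * (?P x)\<^sup>2)"
        unfolding L Xr_square[OF sP x] .
    qed
    moreover have "HI (\<lambda>x. 1 / rad x * Xr (\<lambda>y. (?P y)\<^sup>2) x) = - HI (\<lambda>x. (- 1 / (rad x)\<^sup>2 + (n - 1) * coth (rad x) * (1 / rad x)) * (?P x)\<^sup>2)"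
      unfolding n_def
    proof (rule integral_radial_parts[OF P2, of "\<lambda>t. 1 / t" "\<lambda>t. - 1 / t\<^sup>2"])
      show "smooth {0<..} (\<lambda>t::real. 1 / t)" "smooth {0<..} (\<lambda>t::real. - 1 / t\<^sup>2)"
        by (intro smooth_pos_intros, simp)+
      show "((\<lambda>t. 1 / t) has_real_derivative - 1 / t\<^sup>2) (at t)" if "t > 0" for t :: real
        using that by (auto intro!: derivative_eq_intros simp: power2_eq_square)
    qed
    moreover have "HI (\<lambda>x. (- 1 / (rad x)\<^sup>2 + (n - 1) * coth (rad x) * (1 / rad x)) * (?P x)\<^sup>2)
        = (-1) * c + (n - 1) * d"
      unfolding c_def d_def by (rule HI_lin2[OF C D]) (simp add: algebra_simps add_divide_distrib diff_divide_distrib)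
    ultimately show ?thesis by (simp add: algebra_simps)
  qed
  have t1: "HI (\<lambda>x. (u x)\<^sup>2 / rad x ^ 4) = a"
    by (simp add: a_def)
  have t2: "HI (\<lambda>x. (rad x * coth (rad x) - 1) / rad x ^ 4 * (u x)\<^sup>2) = 1 * b + (-1) * a"
    unfolding a_def b_def
  proof (rule HI_lin2[OF B A])
    fix x assume "x \<in> \<Omega>"
    then have "rad x > 0" by (rule rad_pos)
    then show "(rad x * coth (rad x) - 1) / rad x ^ 4 * (u x)\<^sup>2
        = 1 * (coth (rad x) / rad x ^ 3 * (u x)\<^sup>2) + - 1 * (1 / rad x ^ 4 * (u x)\<^sup>2)"
      by (simp add: field_simps eval_nat_numeral)
  qed
  have t3: "HI (\<lambda>x. (rad x * coth (rad x) - 1) / (rad x)\<^sup>2 * (?P x)\<^sup>2) = 1 * d + (-1) * c"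
    unfolding c_def d_def
  proof (rule HI_lin2[OF D C])
    fix x assume "x \<in> \<Omega>"
    then have "rad x > 0" by (rule rad_pos)
    then show "(rad x * coth (rad x) - 1) / (rad x)\<^sup>2 * (?P x)\<^sup>2
        = 1 * (coth (rad x) / rad x * (?P x)\<^sup>2) + - 1 * (1 / (rad x)\<^sup>2 * (?P x)\<^sup>2)"
      by (simp add: field_simps power2_eq_square)
  qed
  have t4: "HI (\<lambda>x. (?P x + (n - 4) / 2 / rad x * u x)\<^sup>2 / (rad x)\<^sup>2)
      = 1 * c + (n - 4) * e + (n - 4)\<^sup>2 / 4 * a"
    unfolding c_def e_def a_def
  proof (rule HI_lin3[OF C E A])
    fix x assume "x \<in> \<Omega>"
    then have "rad x > 0" by (rule rad_pos)
    then show "(?P x + (n - 4) / 2 / rad x * u x)\<^sup>2 / (rad x)\<^sup>2 = 1 * (1 / (rad x)\<^sup>2 * (?P x)\<^sup>2)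
        + (n - 4) * (1 / rad x ^ 3 * (u x * ?P x)) + (n - 4)\<^sup>2 / 4 * (1 / rad x ^ 4 * (u x)\<^sup>2)"
      by (simp add: field_simps eval_nat_numeral)
  qed
  have t5: "HI (\<lambda>x. (?L x - n / (2 * rad x) * ?P x)\<^sup>2) = 1 * q + (- n) * s + n\<^sup>2 / 4 * c"
    unfolding q_def s_def c_def
  proof (rule HI_lin3[OF L2 S C])
    fix x assume "x \<in> \<Omega>"
    then have "rad x > 0" by (rule rad_pos)
    then show "(?L x - n / (2 * rad x) * ?P x)\<^sup>2 = 1 * (?L x)\<^sup>2 + - n * (1 / rad x * (?L x * ?P x))
        + n\<^sup>2 / 4 * (1 / (rad x)\<^sup>2 * (?P x)\<^sup>2)"
      by (simp add: field_simps eval_nat_numeral)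
  qed
  have ee: "e = (3 * a - (n - 1) * b) / 2" and ss: "s = (c + (n - 1) * d) / 2"
    using e s by simp_all
  show ?thesis
    unfolding t1 t2 t3 t4 t5 unfolding q_def[symmetric] ee ss
    by (simp add: field_simps power2_eq_square)
qed

section \<open>The Laplacian of the unit sphere and its spectral gap\<close>

text \<open>\<open>Tl\<close> and \<open>Gam\<close> are the Laplacian and the squared gradient of the unit sphere.\<close>

definition Tl :: "('a \<Rightarrow> real) \<Rightarrow> 'a \<Rightarrow> real" where
  "Tl u x = (\<Sum>i\<in>Basis. Dt i (Dt i u) x)"

definition Gam :: "('a \<Rightarrow> real) \<Rightarrow> 'a \<Rightarrow> real" where
  "Gam u x = (\<Sum>i\<in>Basis. (Dt i u x)\<^sup>2)"

lemma cpt_smooth_Tl: "cpt_smooth x0 u \<Longrightarrow> cpt_smooth x0 (Tl u)"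
  unfolding Tl_def[abs_def] by (intro cpt_smooth_sum cpt_smooth_Dt)

lemma cpt_smooth_Gam: "cpt_smooth x0 u \<Longrightarrow> cpt_smooth x0 (Gam u)"
  unfolding Gam_def[abs_def] by (intro cpt_smooth_sum cpt_smooth_power cpt_smooth_Dt)

lemma smooth_Tl: "smooth \<Omega> u \<Longrightarrow> smooth \<Omega> (Tl u)"
  unfolding Tl_def[abs_def] by (intro smooth_sum smooth_Dt open_punctured)

lemma Dt_sum:
  assumes "\<And>i. i \<in> I \<Longrightarrow> smooth \<Omega> (f i)" "x \<in> \<Omega>"
  shows "Dt v (\<lambda>y. \<Sum>i\<in>I. f i y) x = (\<Sum>i\<in>I. Dt v (f i) x)"
  unfolding Dt_def using assms by (intro vf_sum diff\<Omega>)

lemma Dt_add: "smooth \<Omega> f \<Longrightarrow> smooth \<Omega> g \<Longrightarrow> x \<in> \<Omega> \<Longrightarrow> Dt v (\<lambda>y. f y + g y) x = Dt v f x + Dt v g x"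
  unfolding Dt_def by (simp add: vf_add diff\<Omega>)

lemma Dt_diff: "smooth \<Omega> f \<Longrightarrow> smooth \<Omega> g \<Longrightarrow> x \<in> \<Omega> \<Longrightarrow> Dt v (\<lambda>y. f y - g y) x = Dt v f x - Dt v g x"
  unfolding Dt_def by (simp add: vf_diff diff\<Omega>)

text \<open>Applying \<open>Dt v\<close> to the relation \<open>sum_th_Dt\<close> gives this; the
  right side is the contribution of the derivative of \<open>th j\<close>.\<close>

lemma sum_th_Dt_Dt:
  assumes u: "smooth \<Omega> u" and x: "x \<in> \<Omega>" and v: "v \<in> Basis"
  shows "(\<Sum>j\<in>Basis. th j x * Dt v (Dt j u) x) = - Dt v u x"
proof -
  have s: "smooth \<Omega> (\<lambda>y. th j y * Dt j u y)" for j
    by (intro smooth_mult smooth_th smooth_Dt u open_punctured)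
  have "0 = Dt v (\<lambda>y. \<Sum>j\<in>Basis. th j y * Dt j u y) x"
    using Dt_cong[OF x, of "\<lambda>y. \<Sum>j\<in>Basis. th j y * Dt j u y" "\<lambda>_. 0" v]
    by (simp add: sum_th_Dt diff\<Omega>[OF u]) (simp add: Dt_def)
  also have "\<dots> = (\<Sum>j\<in>Basis. (v \<bullet> j - th v x * th j x) * Dt j u x + th j x * Dt v (Dt j u) x)"
    by (simp add: Dt_sum[OF s x] Dt_mult[OF smooth_th smooth_Dt[OF u] x] Dt_th[OF x])
  also have "\<dots> = (\<Sum>j\<in>Basis. (v \<bullet> j) * Dt j u x) - th v x * (\<Sum>j\<in>Basis. th j x * Dt j u x)
      + (\<Sum>j\<in>Basis. th j x * Dt v (Dt j u) x)"
    by (simp add: sum.distrib sum_subtractf left_diff_distrib sum_distrib_left mult.assoc)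
  also have "(\<Sum>j\<in>Basis. (v \<bullet> j) * Dt j u x) = Dt v u x"
  proof -
    have "(\<Sum>j\<in>Basis. (v \<bullet> j) * Dt j u x) = (\<Sum>j\<in>Basis. if j = v then Dt v u x else 0)"
      by (intro sum.cong refl) (auto simp: inner_Basis v)
    then show ?thesis using v by simp
  qed
  finally show ?thesis by (simp add: sum_th_Dt[OF x diff\<Omega>[OF u x]])
qed

text \<open>The Bochner formula in ambient components. The Ricci curvature of the sphere contributes
  N - 2 and the second fundamental form -1, together N - 3. The last term is the normal part, which
  vanishes after contraction with \<open>Dt j u\<close>.\<close>

lemma Tl_Dt:
  assumes u: "smooth \<Omega> u" and x: "x \<in> \<Omega>" and j: "j \<in> Basis"
  shows "Tl (Dt j u) x = Dt j (Tl u) x + (real DIM('a) - 3) * Dt j u x - 2 * th j x * Tl u x"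
proof -
  note [simp] = smooth_Dt smooth_th smooth_mult[OF open_punctured] smooth_add[OF open_punctured]
    smooth_diff[OF open_punctured]
  have t: "Dt i (Dt i (Dt j u)) x = Dt j (Dt i (Dt i u)) x
     + (2 * th i x * Dt i (Dt j u) x - 2 * th j x * Dt i (Dt i u) x)
     + ((1 - (th i x)\<^sup>2) * Dt j u x - (i \<bullet> j) * Dt i u x + th j x * (th i x * Dt i u x))
     + (th i x * (Dt j (Dt i u) x - Dt i (Dt j u) x))"
    if i: "i \<in> Basis" for i
  proof -
    have "Dt i (Dt i (Dt j u)) x = Dt i (\<lambda>y. Dt j (Dt i u) y + (th i y * Dt j u y - th j y * Dt i u y)) x"
      by (rule Dt_cong[OF x]) (use Dt_Dt_bracket[OF _ u, of _ i j] in force)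
    also have "\<dots> = Dt i (Dt j (Dt i u)) x + ((1 - (th i x)\<^sup>2) * Dt j u x + th i x * Dt i (Dt j u) x
        - (i \<bullet> j - th i x * th j x) * Dt i u x - th j x * Dt i (Dt i u) x)"
      using i by (simp add: u x Dt_add Dt_diff Dt_mult Dt_th inner_Basis power2_eq_square)
    also have "Dt i (Dt j (Dt i u)) x = Dt j (Dt i (Dt i u)) x + th i x * Dt j (Dt i u) x - th j x * Dt i (Dt i u) x"
      using Dt_Dt_bracket[OF x smooth_Dt[OF u], of i j i] by simp
    finally show ?thesis by (simp add: algebra_simps)
  qed
  have th2: "(\<Sum>i\<in>Basis. (th i x)\<^sup>2) = 1" by (rule sum_th_sq[OF x])
  have ij: "(\<Sum>i\<in>Basis. (i \<bullet> j) * Dt i u x) = Dt j u x"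
  proof -
    have "(\<Sum>i\<in>Basis. (i \<bullet> j) * Dt i u x) = (\<Sum>i\<in>Basis. if i = j then Dt j u x else 0)"
      by (intro sum.cong refl) (auto simp: inner_Basis j)
    then show ?thesis using j by simp
  qed
  have "Tl (Dt j u) x = (\<Sum>i\<in>Basis. Dt j (Dt i (Dt i u)) x
     + (2 * th i x * Dt i (Dt j u) x - 2 * th j x * Dt i (Dt i u) x)
     + ((1 - (th i x)\<^sup>2) * Dt j u x - (i \<bullet> j) * Dt i u x + th j x * (th i x * Dt i u x))
     + (th i x * (Dt j (Dt i u) x - Dt i (Dt j u) x)))"
    unfolding Tl_def by (rule sum.cong[OF refl t])
  also have "\<dots> = (\<Sum>i\<in>Basis. Dt j (Dt i (Dt i u)) x)
     + (2 * (\<Sum>i\<in>Basis. th i x * Dt i (Dt j u) x) - 2 * th j x * (\<Sum>i\<in>Basis. Dt i (Dt i u) x))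
     + ((real DIM('a) - (\<Sum>i\<in>Basis. (th i x)\<^sup>2)) * Dt j u x - (\<Sum>i\<in>Basis. (i \<bullet> j) * Dt i u x)
        + th j x * (\<Sum>i\<in>Basis. th i x * Dt i u x))
     + ((\<Sum>i\<in>Basis. th i x * Dt j (Dt i u) x) - (\<Sum>i\<in>Basis. th i x * Dt i (Dt j u) x))"
    by (simp add: sum.distrib sum_subtractf sum_distrib_left sum_distrib_right algebra_simps)
  also have "(\<Sum>i\<in>Basis. Dt j (Dt i (Dt i u)) x) = Dt j (Tl u) x"
    unfolding Tl_def[abs_def] by (rule Dt_sum[symmetric]) (simp_all add: u x)
  finally show ?thesis
    unfolding ij th2 sum_th_Dt[OF x diff\<Omega>[OF smooth_Dt[OF u] x]] sum_th_Dt[OF x diff\<Omega>[OF u x]]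
      sum_th_Dt_Dt[OF u x j] Tl_def[symmetric]
    by (simp add: algebra_simps)
qed

text \<open>The components \<open>D\<^sub>i D\<^sub>j u + \<theta>\<^sub>j D\<^sub>i u\<close> are those of the spherical Hessian, whose trace is \<open>Tl u\<close>;
  subtracting the multiple of the projection \<open>\<delta>\<^sub>i\<^sub>j - \<theta>\<^sub>i \<theta>\<^sub>j\<close> with the same trace leaves a sum of
  squares.\<close>

lemma hessian_trace_bound:
  assumes u: "smooth \<Omega> u" and x: "x \<in> \<Omega>" and N: "DIM('a) \<ge> 2"
  shows "(Tl u x)\<^sup>2 / (real DIM('a) - 1) \<le>
    (\<Sum>i\<in>Basis. \<Sum>j\<in>Basis. (Dt i (Dt j u) x)\<^sup>2) - Gam u x"
proof -
  define n where "n = real DIM('a) - 1"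
  have n: "n > 0" using N by (simp add: n_def)
  define H where "H i j = Dt i (Dt j u) x + th j x * Dt i u x" for i j
  define P where "P i j = i \<bullet> j - th i x * th j x" for i j :: 'a
  have th2: "(\<Sum>i\<in>Basis. th i x * th i x) = 1"
    using sum_th_sq[OF x] by (simp add: power2_eq_square)
  have thD: "(\<Sum>i\<in>Basis. th i x * Dt i v x) = 0" if "smooth \<Omega> v" for v
    by (rule sum_th_Dt[OF x diff\<Omega>[OF that x]])
  have del: "(\<Sum>j\<in>Basis. (i \<bullet> j) * f j) = f i" if "i \<in> Basis" for i :: 'a and f :: "'a \<Rightarrow> real"
  proof -
    have "(\<Sum>j\<in>Basis. (i \<bullet> j) * f j) = (\<Sum>j\<in>Basis. if j = i then f i else 0)"
      by (intro sum.cong refl) (auto simp: inner_Basis that)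
    then show ?thesis using that by simp
  qed
  have HP: "(\<Sum>i\<in>Basis. \<Sum>j\<in>Basis. P i j * H i j) = Tl u x"
  proof -
    have "(\<Sum>i\<in>Basis. \<Sum>j\<in>Basis. P i j * H i j) = (\<Sum>i\<in>Basis. \<Sum>j\<in>Basis. (i \<bullet> j) * H i j)
        - (\<Sum>i\<in>Basis. \<Sum>j\<in>Basis. th j x * (th i x * H i j))"
      by (simp add: P_def sum_subtractf algebra_simps)
    also have "(\<Sum>i\<in>Basis. \<Sum>j\<in>Basis. (i \<bullet> j) * H i j) = (\<Sum>i\<in>Basis. H i i)"
      by (intro sum.cong refl del)
    also have "\<dots> = Tl u x"
      by (simp add: H_def sum.distrib Tl_def thD[OF u])
    also have "(\<Sum>i\<in>Basis. \<Sum>j\<in>Basis. th j x * (th i x * H i j)) =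
        (\<Sum>j\<in>Basis. th j x * ((\<Sum>i\<in>Basis. th i x * Dt i (Dt j u) x) + th j x * (\<Sum>i\<in>Basis. th i x * Dt i u x)))"
      by (subst sum.swap) (simp add: H_def sum_distrib_left sum.distrib algebra_simps)
    also have "\<dots> = 0" by (simp add: thD u smooth_Dt)
    finally show ?thesis by simp
  qed
  have PP: "(\<Sum>i\<in>Basis. \<Sum>j\<in>Basis. P i j * P i j) = n"
  proof -
    have "(\<Sum>i\<in>Basis. \<Sum>j\<in>Basis. P i j * P i j) = (\<Sum>i\<in>Basis. \<Sum>j\<in>Basis. (i \<bullet> j) * (i \<bullet> j - 2 * th i x * th j x))
        + (\<Sum>i\<in>Basis. th i x * th i x) * (\<Sum>j\<in>Basis. th j x * th j x)"
      unfolding sum_product by (simp add: P_def sum.distrib[symmetric] algebra_simps)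
    also have "(\<Sum>i\<in>Basis. \<Sum>j\<in>Basis. (i \<bullet> j) * (i \<bullet> j - 2 * th i x * th j x))
        = (\<Sum>i\<in>Basis. 1 - 2 * (th i x * th i x))"
      by (intro sum.cong refl) (subst del, assumption, simp)
    also have "\<dots> = real DIM('a) - 2 * (\<Sum>i\<in>Basis. th i x * th i x)"
      by (simp add: sum_subtractf sum_distrib_left)
    finally show ?thesis by (simp add: th2 n_def)
  qed
  have HH: "(\<Sum>i\<in>Basis. \<Sum>j\<in>Basis. H i j * H i j) = (\<Sum>i\<in>Basis. \<Sum>j\<in>Basis. (Dt i (Dt j u) x)\<^sup>2) - Gam u x"
  proof -
    have "(\<Sum>j\<in>Basis. H i j * H i j) = (\<Sum>j\<in>Basis. (Dt i (Dt j u) x)\<^sup>2) - (Dt i u x)\<^sup>2"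
      if i: "i \<in> Basis" for i
    proof -
      have "(\<Sum>j\<in>Basis. H i j * H i j) = (\<Sum>j\<in>Basis. (Dt i (Dt j u) x)\<^sup>2)
          + 2 * Dt i u x * (\<Sum>j\<in>Basis. th j x * Dt i (Dt j u) x)
          + (Dt i u x)\<^sup>2 * (\<Sum>j\<in>Basis. th j x * th j x)"
        by (simp add: H_def sum_distrib_left sum.distrib[symmetric] power2_eq_square algebra_simps)
      then show ?thesis
        by (simp add: sum_th_Dt_Dt[OF u x i] th2 power2_eq_square)
    qed
    then show ?thesis by (simp add: sum_subtractf Gam_def)
  qed
  define c where "c = Tl u x / n"
  have "0 \<le> (\<Sum>i\<in>Basis. \<Sum>j\<in>Basis. (H i j - c * P i j) * (H i j - c * P i j))"
    by (intro sum_nonneg) simp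
  also have "\<dots> = (\<Sum>i\<in>Basis. \<Sum>j\<in>Basis. H i j * H i j) - 2 * c * (\<Sum>i\<in>Basis. \<Sum>j\<in>Basis. P i j * H i j)
      + c * c * (\<Sum>i\<in>Basis. \<Sum>j\<in>Basis. P i j * P i j)"
    by (simp add: sum_distrib_left sum.distrib[symmetric] sum_subtractf[symmetric] algebra_simps)
  also have "\<dots> = (\<Sum>i\<in>Basis. \<Sum>j\<in>Basis. H i j * H i j) - (Tl u x)\<^sup>2 / n"
    unfolding HP PP using n by (simp add: c_def field_simps power2_eq_square)
  finally show ?thesis
    unfolding HH n_def by simp
qed

lemma HI_sum_radial:
  assumes "\<And>i. i \<in> I \<Longrightarrow> cpt_smooth x0 (g i)" "smooth {0<..} F"
  shows "(\<Sum>i\<in>I. HI (\<lambda>x. F (rad x) * g i x)) = HI (\<lambda>x. F (rad x) * (\<Sum>i\<in>I. g i x))"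
proof -
  have "HI (\<lambda>x. \<Sum>i\<in>I. F (rad x) * g i x) = (\<Sum>i\<in>I. HI (\<lambda>x. F (rad x) * g i x))"
    by (rule Int_sum) (rule cpt_smooth_radial[OF assms(1,2)])
  then show ?thesis by (simp add: sum_distrib_left)
qed

lemma HI_zero:
  fixes f :: "'a \<Rightarrow> real"
  shows "(\<And>x. x \<in> \<Omega> \<Longrightarrow> f x = 0) \<Longrightarrow> HI f = 0"
  using HI_cong[OF cpt_smooth_zero, of f] by simp

lemma integral_Tl_parts:
  assumes f: "cpt_smooth x0 f" and g: "smooth \<Omega> g" and F: "smooth {0<..} F"
  shows "HI (\<lambda>x. F (rad x) * (g x * Tl f x)) = - HI (\<lambda>x. F (rad x) * (\<Sum>i\<in>Basis. Dt i g x * Dt i f x))"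
proof -
  have Df: "cpt_smooth x0 (Dt i f)" for i by (rule cpt_smooth_Dt[OF f])
  have a: "cpt_smooth x0 (\<lambda>x. g x * Dt i (Dt i f) x)" for i
    by (rule cpt_smooth_mult_left[OF cpt_smooth_Dt[OF Df] g])
  have b: "cpt_smooth x0 (\<lambda>x. Dt i g x * Dt i f x)" for i
    by (rule cpt_smooth_mult_left[OF Df smooth_Dt[OF g]])
  have c: "cpt_smooth x0 (\<lambda>x. th i x * g x * Dt i f x)" for i
    by (rule cpt_smooth_mult_left[OF Df smooth_mult[OF open_punctured smooth_th g]])
  have "HI (\<lambda>x. F (rad x) * (g x * Tl f x)) = HI (\<lambda>x. F (rad x) * (\<Sum>i\<in>Basis. g x * Dt i (Dt i f) x))"
    by (simp add: Tl_def sum_distrib_left)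
  also have "\<dots> = (\<Sum>i\<in>Basis. HI (\<lambda>x. F (rad x) * (g x * Dt i (Dt i f) x)))"
    by (rule HI_sum_radial[OF a F, symmetric])
  also have "\<dots> = (\<Sum>i\<in>Basis. - HI (\<lambda>x. F (rad x) * (Dt i g x * Dt i f x))
      + (real DIM('a) - 1) * HI (\<lambda>x. F (rad x) * (th i x * g x * Dt i f x)))"
    by (intro sum.cong refl integral_Dt_parts Df g F)
  also have "\<dots> = - HI (\<lambda>x. F (rad x) * (\<Sum>i\<in>Basis. Dt i g x * Dt i f x))
      + (real DIM('a) - 1) * HI (\<lambda>x. F (rad x) * (\<Sum>i\<in>Basis. th i x * g x * Dt i f x))"
    unfolding sum.distrib sum_negf sum_distrib_left[symmetric] HI_sum_radial[OF b F] HI_sum_radial[OF c F] ..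
  also have "HI (\<lambda>x. F (rad x) * (\<Sum>i\<in>Basis. th i x * g x * Dt i f x)) = 0"
  proof (rule HI_zero)
    fix x assume x: "x \<in> \<Omega>"
    have "(\<Sum>i\<in>Basis. th i x * g x * Dt i f x) = g x * (\<Sum>i\<in>Basis. th i x * Dt i f x)"
      by (simp add: sum_distrib_left mult_ac)
    then show "F (rad x) * (\<Sum>i\<in>Basis. th i x * g x * Dt i f x) = 0"
      by (simp add: sum_th_Dt[OF x diff\<Omega>[OF cpt_smooth_smooth[OF f] x]])
  qed
  finally show ?thesis by simp
qed

text \<open>The weight is constant on spheres, so angular integration by parts passes through it.
  The integrated Bochner formula gives \<open>S = (Tl u)\<^sup>2 - (n - 2) * Gam u\<close> under the
  weighted integral, with \<open>n = N - 1\<close>; the trace bound for the Hessian then yields the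
  claim times \<open>n - 1\<close>, which is positive in dimension at least 3.\<close>

lemma spherical_gap:
  assumes u: "cpt_smooth x0 u" and F: "smooth {0<..} F" and pos: "\<And>t. t > 0 \<Longrightarrow> F t \<ge> 0"
    and N: "DIM('a) \<ge> 3"
  shows "(real DIM('a) - 1) * HI (\<lambda>x. F (rad x) * Gam u x) \<le> HI (\<lambda>x. F (rad x) * (Tl u x)\<^sup>2)"
proof -
  define n where "n = real DIM('a) - 1"
  have n: "n \<ge> 2" using N by (simp add: n_def)
  have su: "smooth \<Omega> u" by (rule cpt_smooth_smooth[OF u])
  have D: "cpt_smooth x0 (Dt j u)" for j by (rule cpt_smooth_Dt[OF u])
  have T: "cpt_smooth x0 (Tl u)" by (rule cpt_smooth_Tl[OF u])
  note cT = cpt_smooth_radial[OF cpt_smooth_power[OF T] F] and cG = cpt_smooth_radial[OF cpt_smooth_Gam[OF u] F]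
  have DD: "cpt_smooth x0 (\<lambda>x. (Dt i (Dt j u) x)\<^sup>2)" for i j
    by (intro cpt_smooth_power cpt_smooth_Dt u)
  define S where "S x = (\<Sum>i\<in>Basis. \<Sum>j\<in>Basis. (Dt i (Dt j u) x)\<^sup>2)" for x
  have S: "cpt_smooth x0 S" unfolding S_def[abs_def] by (intro cpt_smooth_sum DD)
  define M where "M x = (\<Sum>j\<in>Basis. Dt j (Tl u) x * Dt j u x)" for x
  have M: "cpt_smooth x0 M"
    unfolding M_def[abs_def] by (intro cpt_smooth_sum cpt_smooth_mult cpt_smooth_Dt T u)
  have m: "HI (\<lambda>x. F (rad x) * M x) = - HI (\<lambda>x. F (rad x) * (Tl u x)\<^sup>2)"
    using integral_Tl_parts[OF u smooth_Tl[OF su] F] by (simp add: M_def power2_eq_square)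
  have "HI (\<lambda>x. F (rad x) * S x) = (\<Sum>j\<in>Basis. HI (\<lambda>x. F (rad x) * (\<Sum>i\<in>Basis. Dt i (Dt j u) x * Dt i (Dt j u) x)))"
  proof -
    have "HI (\<lambda>x. F (rad x) * S x) = HI (\<lambda>x. F (rad x) * (\<Sum>j\<in>Basis. \<Sum>i\<in>Basis. Dt i (Dt j u) x * Dt i (Dt j u) x))"
      unfolding S_def power2_eq_square by (subst sum.swap) simp
    then show ?thesis
      by (subst HI_sum_radial[OF _ F]) (auto intro!: cpt_smooth_sum cpt_smooth_mult cpt_smooth_Dt u)
  qed
  also have "\<dots> = (\<Sum>j\<in>Basis. - HI (\<lambda>x. F (rad x) * (Dt j u x * Tl (Dt j u) x)))"
    using integral_Tl_parts[OF D smooth_Dt[OF su] F] by simp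
  also have "\<dots> = - HI (\<lambda>x. F (rad x) * (\<Sum>j\<in>Basis. Dt j u x * Tl (Dt j u) x))"
    unfolding sum_negf by (subst HI_sum_radial[OF _ F]) (auto intro!: cpt_smooth_mult cpt_smooth_Tl D)
  also have "HI (\<lambda>x. F (rad x) * (\<Sum>j\<in>Basis. Dt j u x * Tl (Dt j u) x))
      = 1 * HI (\<lambda>x. F (rad x) * M x) + (n - 2) * HI (\<lambda>x. F (rad x) * Gam u x)"
  proof (rule HI_lin2[OF cpt_smooth_radial[OF M F] cG])
    fix x assume x: "x \<in> \<Omega>"
    have "(\<Sum>j\<in>Basis. Dt j u x * Tl (Dt j u) x) =
        (\<Sum>j\<in>Basis. Dt j u x * (Dt j (Tl u) x + (n - 2) * Dt j u x - 2 * th j x * Tl u x))"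
      by (intro sum.cong refl) (simp add: Tl_Dt[OF su x] n_def)
    also have "\<dots> = M x + (n - 2) * Gam u x - 2 * Tl u x * (\<Sum>j\<in>Basis. th j x * Dt j u x)"
      by (simp add: M_def Gam_def sum.distrib sum_subtractf sum_distrib_left power2_eq_square algebra_simps)
    also have "\<dots> = M x + (n - 2) * Gam u x"
      by (simp add: sum_th_Dt[OF x diff\<Omega>[OF su x]])
    finally have e: "(\<Sum>j\<in>Basis. Dt j u x * Tl (Dt j u) x) = M x + (n - 2) * Gam u x" .
    show "F (rad x) * (\<Sum>j\<in>Basis. Dt j u x * Tl (Dt j u) x) =
        1 * (F (rad x) * M x) + (n - 2) * (F (rad x) * Gam u x)"
      unfolding e by (simp add: algebra_simps)
  qed
  finally have s: "HI (\<lambda>x. F (rad x) * S x) =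
      HI (\<lambda>x. F (rad x) * (Tl u x)\<^sup>2) - (n - 2) * HI (\<lambda>x. F (rad x) * Gam u x)"
    by (simp add: m)
  let ?I = "\<lambda>x. 1 * (F (rad x) * S x) + (-1) * (F (rad x) * Gam u x) + (- 1 / n) * (F (rad x) * (Tl u x)\<^sup>2)"
  have "0 \<le> HI ?I"
  proof (rule hyp_vol_integral_nonneg)
    show "cpt_smooth x0 ?I"
      by (intro cpt_smooth_add cpt_smooth_cmult cT cG cpt_smooth_radial[OF S F])
    fix x assume x: "x \<in> \<Omega>"
    have "(Tl u x)\<^sup>2 / n \<le> S x - Gam u x"
      using hessian_trace_bound[OF su x] N by (simp add: S_def n_def)
    then have "0 \<le> F (rad x) * (S x - Gam u x - (Tl u x)\<^sup>2 / n)"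
      using pos[OF rad_pos[OF x]] by simp
    then show "0 \<le> ?I x" by (simp add: algebra_simps)
  qed
  also have "HI ?I = 1 * HI (\<lambda>x. F (rad x) * S x) + (-1) * HI (\<lambda>x. F (rad x) * Gam u x)
      + (- 1 / n) * HI (\<lambda>x. F (rad x) * (Tl u x)\<^sup>2)"
    by (rule HI_lin3[OF cpt_smooth_radial[OF S F] cG cT]) simp
  finally have "0 \<le> (1 - 1 / n) * HI (\<lambda>x. F (rad x) * (Tl u x)\<^sup>2) - (n - 1) * HI (\<lambda>x. F (rad x) * Gam u x)"
    unfolding s by (simp add: algebra_simps)
  then have "0 \<le> (n - 1) * (HI (\<lambda>x. F (rad x) * (Tl u x)\<^sup>2) / n - HI (\<lambda>x. F (rad x) * Gam u x))"
    using n by (simp add: field_simps)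
  then have "0 \<le> HI (\<lambda>x. F (rad x) * (Tl u x)\<^sup>2) / n - HI (\<lambda>x. F (rad x) * Gam u x)"
    using n by (simp add: zero_le_mult_iff)
  then show ?thesis
    using n unfolding n_def[symmetric] by (simp add: field_simps)
qed

end

section \<open>The angular inequality\<close>

lemma nonneg_if_DERIV_nonneg:
  fixes f :: "real \<Rightarrow> real"
  assumes "\<And>t. t \<ge> 0 \<Longrightarrow> (f has_real_derivative f' t) (at t)" "\<And>t. t \<ge> 0 \<Longrightarrow> f' t \<ge> 0" "f 0 = 0" "t \<ge> 0"
  shows "f t \<ge> 0"
  using DERIV_nonneg_imp_nondecreasing[OF assms(4), of f] assms by (metis)

text \<open>The bounds say that \<open>coth t\<close> is at least \<open>1 / t\<close> and at least
  \<open>1 / t + 5 * t / (15 + t\<^sup>2)\<close>, truncations of its continued fraction. Inside the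
  proof each function vanishes at 0, and from the second on its derivative is \<open>x\<close> times
  the preceding one.\<close>

lemma cosh_sinh_bounds:
  fixes t :: real
  assumes "t \<ge> 0"
  shows "t * cosh t - sinh t \<ge> 0"
    and "(15 * t + t ^ 3) * cosh t - (15 + 6 * t\<^sup>2) * sinh t \<ge> 0"
proof -
  have s: "sinh x \<ge> 0" if "x \<ge> 0" for x :: real using that by simp
  have 1: "x * cosh x - sinh x \<ge> 0" if "x \<ge> 0" for x :: real
    by (rule nonneg_if_DERIV_nonneg[where f = "\<lambda>x. x * cosh x - sinh x" and f' = "\<lambda>x. x * sinh x"])
       (use that s in \<open>auto intro!: derivative_eq_intros\<close>)
  have 2: "(3 + x\<^sup>2) * sinh x - 3 * x * cosh x \<ge> 0" if "x \<ge> 0" for x :: real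
  proof (rule nonneg_if_DERIV_nonneg[where f = "\<lambda>x. (3 + x\<^sup>2) * sinh x - 3 * x * cosh x"
        and f' = "\<lambda>x. x * (x * cosh x - sinh x)"])
    show "((\<lambda>x. (3 + x\<^sup>2) * sinh x - 3 * x * cosh x) has_real_derivative x * (x * cosh x - sinh x)) (at x)"
      for x :: real
      by (auto intro!: derivative_eq_intros simp: power2_eq_square algebra_simps)
  qed (use that 1 in auto)
  have 3: "(15 * x + x ^ 3) * cosh x - (15 + 6 * x\<^sup>2) * sinh x \<ge> 0" if "x \<ge> 0" for x :: real
  proof (rule nonneg_if_DERIV_nonneg[where f = "\<lambda>x. (15 * x + x ^ 3) * cosh x - (15 + 6 * x\<^sup>2) * sinh x"
        and f' = "\<lambda>x. x * ((3 + x\<^sup>2) * sinh x - 3 * x * cosh x)"])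
    show "((\<lambda>x. (15 * x + x ^ 3) * cosh x - (15 + 6 * x\<^sup>2) * sinh x) has_real_derivative
        x * ((3 + x\<^sup>2) * sinh x - 3 * x * cosh x)) (at x)" for x :: real
      by (auto intro!: derivative_eq_intros simp: power2_eq_square power3_eq_cube algebra_simps)
  qed (use that 2 in auto)
  show "t * cosh t - sinh t \<ge> 0" using 1[OF assms] .
  show "(15 * t + t ^ 3) * cosh t - (15 + 6 * t\<^sup>2) * sinh t \<ge> 0" using 3[OF assms] .
qed

lemma coth_ge_1: "t > 0 \<Longrightarrow> coth t \<ge> 1"
  using sinh_less_cosh_real[of t] by (simp add: coth_def)

lemma coth_ge_inverse: "t > 0 \<Longrightarrow> coth t \<ge> 1 / t"
  using cosh_sinh_bounds(1)[of t] by (simp add: coth_def field_simps)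

text \<open>Both sides agree in the limit \<open>t \<rightarrow> 0\<close>, so near the pole the
  continued fraction bound for \<open>coth t - 1 / t\<close> is inserted; the left side increases
  with that difference. For \<open>t > 2\<close> the bounds \<open>coth t \<ge> 1\<close> and
  \<open>1 / t \<le> 1/2\<close> give 27/4.\<close>

lemma coth_quadratic:
  assumes t: "t > 0"
  shows "3 * ((coth t - 1 / t) * (7 * coth t - 5 * (1 / t))) \<ge> 2"
proof (cases "t \<le> 2")
  case True
  have s: "sinh t > 0" using t by simp
  have lin: "coth t - 1 / t \<ge> 5 * t / (15 + t\<^sup>2)"
  proof -
    have "(15 + t\<^sup>2) * (t * cosh t - sinh t) - 5 * t\<^sup>2 * sinh t \<ge> 0"
      using cosh_sinh_bounds(2)[of t] t by (simp add: power2_eq_square power3_eq_cube algebra_simps)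
    then have "0 \<le> ((15 + t\<^sup>2) * (t * cosh t - sinh t) - 5 * t\<^sup>2 * sinh t) / ((15 + t\<^sup>2) * t * sinh t)"
      using s t by (intro divide_nonneg_nonneg) (auto intro!: mult_nonneg_nonneg add_nonneg_nonneg)
    also have "\<dots> = coth t - 1 / t - 5 * t / (15 + t\<^sup>2)"
    proof -
      have "15 + t\<^sup>2 > 0" by (intro add_pos_nonneg) auto
      then show ?thesis using s t by (simp add: coth_def field_simps power2_eq_square)
    qed
    finally show ?thesis by simp
  qed
  define e where "e = 5 * t / (15 + t\<^sup>2)"
  have q: "15 + t\<^sup>2 > 0" by (intro add_pos_nonneg) auto
  have e: "e > 0" using q t by (simp add: e_def)
  have "2 \<le> 3 * (e * (7 * e + 2 * (1 / t)))"
  proof -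
    define Q where "Q = 15 + t\<^sup>2"
    have Q: "Q > 0" using q by (simp add: Q_def)
    have "3 * (e * (7 * e + 2 * (1 / t))) - 2 = (525 * t\<^sup>2 + 30 * Q - 2 * Q\<^sup>2) / Q\<^sup>2"
      unfolding e_def Q_def[symmetric] using Q t by (simp add: field_simps power2_eq_square)
    also have "525 * t\<^sup>2 + 30 * Q - 2 * Q\<^sup>2 = t\<^sup>2 * (495 - 2 * t\<^sup>2)"
      by (simp add: Q_def power2_eq_square algebra_simps)
    finally have "3 * (e * (7 * e + 2 * (1 / t))) - 2 = t\<^sup>2 * (495 - 2 * t\<^sup>2) / Q\<^sup>2" .
    moreover have "t\<^sup>2 \<le> 2\<^sup>2" using True t by (intro power_mono) auto
    ultimately have "3 * (e * (7 * e + 2 * (1 / t))) - 2 \<ge> 0" by simp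
    then show ?thesis by simp
  qed
  also have "\<dots> \<le> 3 * ((coth t - 1 / t) * (7 * (coth t - 1 / t) + 2 * (1 / t)))"
    using lin e t by (intro mult_left_mono mult_mono add_mono) (auto simp: e_def)
  finally show ?thesis by (simp add: algebra_simps)
next
  case False
  then have i: "1 / t \<le> 1 / 2" by (simp add: field_simps)
  have c: "coth t \<ge> 1" using coth_ge_1[OF t] .
  have "1 / 2 * (9 / 2) \<le> (coth t - 1 / t) * (7 * coth t - 5 * (1 / t))"
    using i c by (intro mult_mono) linarith+
  then show ?thesis by simp
qed

text \<open>The coefficient of \<open>Gam u\<close> left over in \<open>angular_inequality\<close>,
  divided by \<open>h\<close>. In order, the summands come from the cross term, the spectral gap,
  the Hardy inequality and the two terms to be dominated.\<close>

lemma rellich_weight_nonneg: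
  fixes N t :: real
  assumes N: "N \<ge> 5" and t: "t > 0"
  defines "C \<equiv> coth t" and "h \<equiv> 1 / (sinh t)\<^sup>2"
  defines "g \<equiv> 1 / t - (N - 2) / 2 * C"
  shows "- (2 * h + 4 * C\<^sup>2 - 2 * (N - 1) * C\<^sup>2) + (N - 1) * h
    - (- 2 * C * g - 1 / t\<^sup>2 + (N - 2) / 2 * h + (N - 1) * C * g + g\<^sup>2)
    - N * (N - 1) / 2 * ((t * C - 1) / t\<^sup>2) - N\<^sup>2 / 4 / t\<^sup>2 \<ge> 0" (is "?E \<ge> 0")
proof -
  define y where "y = 1 / t"
  have h: "h = C\<^sup>2 - 1" unfolding h_def C_def by (rule inverse_sinh_sq[OF t])
  have y: "1 / t = y" "1 / t\<^sup>2 = y\<^sup>2" "(t * C - 1) / t\<^sup>2 = y * C - y\<^sup>2" "N\<^sup>2 / 4 / t\<^sup>2 = N\<^sup>2 / 4 * y\<^sup>2"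
    using t by (simp_all add: y_def power2_eq_square field_simps)
  have C: "C \<ge> 1" "C \<ge> y" "y > 0"
    using coth_ge_1[OF t] coth_ge_inverse[OF t] t by (simp_all add: C_def y_def)
  have q: "3 * ((C - y) * (7 * C - 5 * y)) \<ge> 2"
    using coth_quadratic[OF t] by (simp add: C_def y_def)
  \<comment> \<open>Expansion in powers of \<open>N - 5\<close>: the coefficients of the first and
    second power are nonnegative because \<open>coth t\<close> dominates 1 and \<open>1 / t\<close>,
    and the constant term is exactly \<open>coth_quadratic\<close>.\<close>
  have "4 * ?E = (N - 5)\<^sup>2 * (C - y)\<^sup>2 + (N - 5) * (2 * ((C - y) * (5 * C - 4 * y)) + (4 * C\<^sup>2 - 2))
      + (3 * ((C - y) * (7 * C - 5 * y)) - 2)"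
    unfolding y h g_def by (simp add: field_simps power2_eq_square)
  also have "\<dots> \<ge> 0"
  proof (intro add_nonneg_nonneg mult_nonneg_nonneg)
    have "C\<^sup>2 \<ge> 1" using C by (simp add: one_le_power)
    then show "0 \<le> 4 * C\<^sup>2 - 2" by simp
  qed (use N C q in auto)
  finally have "0 \<le> 4 * ?E" .
  moreover have "0 \<le> 4 * z \<Longrightarrow> 0 \<le> z" for z :: real by simp
  ultimately show ?thesis by blast
qed

context hyp_pole
begin

section \<open>The cross term and the Hardy inequality\<close>

lemma Dt_Lr:
  assumes u: "smooth \<Omega> u" and x: "x \<in> \<Omega>"
  shows "Dt i (Lr u) x = Lr (Dt i u) x"
proof -
  have c: "smooth {0<..} (\<lambda>t. (real DIM('a) - 1) * coth t)" by (intro smooth_pos_intros)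
  have "Dt i (Lr u) x = Dt i (Xr (Xr u)) x + Dt i (\<lambda>y. (real DIM('a) - 1) * coth (rad y) * Xr u y) x"
    unfolding Lr_def[abs_def]
    by (rule Dt_add[OF smooth_Xr[OF smooth_Xr[OF u]] smooth_mult[OF open_punctured smooth_radial[OF c] smooth_Xr[OF u]] x])
  also have "Dt i (\<lambda>y. (real DIM('a) - 1) * coth (rad y) * Xr u y) x = (real DIM('a) - 1) * coth (rad x) * Dt i (Xr u) x"
    by (rule Dt_radial_mult[OF c smooth_Xr[OF u] x])
  also have "Dt i (Xr (Xr u)) x = Xr (Dt i (Xr u)) x"
    by (rule Xr_Dt_commute[OF x smooth_Xr[OF u], symmetric])
  also have "Xr (Dt i (Xr u)) x = Xr (Xr (Dt i u)) x"
    by (rule Xr_cong[OF x]) (simp add: Xr_Dt_commute u)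
  finally show ?thesis
    by (simp add: Lr_def[abs_def] Xr_Dt_commute[OF x u])
qed

lemma integral_radial_square:
  assumes v: "cpt_smooth x0 v" and F: "smooth {0<..} F" and F': "smooth {0<..} F'"
    and der: "\<And>t. t > 0 \<Longrightarrow> (F has_real_derivative F' t) (at t)"
  shows "2 * HI (\<lambda>x. F (rad x) * (v x * Xr v x))
    = - HI (\<lambda>x. (F' (rad x) + (real DIM('a) - 1) * coth (rad x) * F (rad x)) * (v x)\<^sup>2)"
proof -
  have c: "cpt_smooth x0 (\<lambda>x. F (rad x) * (v x * Xr v x))"
    by (intro cpt_smooth_radial F cpt_smooth_mult cpt_smooth_Xr v)
  have "2 * HI (\<lambda>x. F (rad x) * (v x * Xr v x)) = HI (\<lambda>x. F (rad x) * Xr (\<lambda>y. (v y)\<^sup>2) x)"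
    using HI_lin2[OF c c, of "\<lambda>x. F (rad x) * Xr (\<lambda>y. (v y)\<^sup>2) x" 1 1]
    by (simp add: Xr_square[OF cpt_smooth_smooth[OF v]])
  also have "\<dots> = - HI (\<lambda>x. (F' (rad x) + (real DIM('a) - 1) * coth (rad x) * F (rad x)) * (v x)\<^sup>2)"
    by (rule integral_radial_parts[OF cpt_smooth_power[OF v] F F' der])
  finally show ?thesis .
qed

text \<open>The first integration by parts splits off \<open>(Xr v)\<^sup>2\<close>; its
  boundary-free remainder with \<open>coth\<close> cancels the first order part of
  \<open>Lr\<close>. The second treats \<open>v * Xr v\<close> as half the derivative of a
  square.\<close>

lemma integral_Lr_parts:
  assumes v: "cpt_smooth x0 v" and F: "smooth {0<..} F" "smooth {0<..} F'" "smooth {0<..} F''"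
    and der: "\<And>t. t > 0 \<Longrightarrow> (F has_real_derivative F' t) (at t)"
      "\<And>t. t > 0 \<Longrightarrow> (F' has_real_derivative F'' t) (at t)"
  shows "HI (\<lambda>x. F (rad x) * (Lr v x * v x)) = - HI (\<lambda>x. F (rad x) * (Xr v x)\<^sup>2)
    + 1/2 * HI (\<lambda>x. (F'' (rad x) + (real DIM('a) - 1) * coth (rad x) * F' (rad x)) * (v x)\<^sup>2)"
proof -
  let ?n = "real DIM('a) - 1"
  have sv: "smooth \<Omega> v" by (rule cpt_smooth_smooth[OF v])
  have X: "cpt_smooth x0 (Xr v)" by (rule cpt_smooth_Xr[OF v])
  have vX: "cpt_smooth x0 (\<lambda>x. v x * Xr v x)" by (rule cpt_smooth_mult[OF v X])
  have a: "cpt_smooth x0 (\<lambda>x. F (rad x) * Xr (\<lambda>y. v y * Xr v y) x)"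
    by (rule cpt_smooth_radial[OF cpt_smooth_Xr[OF vX] F(1)])
  have b: "cpt_smooth x0 (\<lambda>x. F (rad x) * (Xr v x)\<^sup>2)"
    by (rule cpt_smooth_radial[OF cpt_smooth_power[OF X] F(1)])
  have c: "cpt_smooth x0 (\<lambda>x. ?n * coth (rad x) * F (rad x) * (v x * Xr v x))"
    by (rule cpt_smooth_radial[OF vX]) (intro smooth_pos_intros F(1))
  have d: "cpt_smooth x0 (\<lambda>x. F' (rad x) * (v x * Xr v x))"
    by (rule cpt_smooth_radial[OF vX F(2)])
  have "HI (\<lambda>x. F (rad x) * (Lr v x * v x)) =
      1 * HI (\<lambda>x. F (rad x) * Xr (\<lambda>y. v y * Xr v y) x) + (-1) * HI (\<lambda>x. F (rad x) * (Xr v x)\<^sup>2)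
      + 1 * HI (\<lambda>x. ?n * coth (rad x) * F (rad x) * (v x * Xr v x))"
  proof (rule HI_lin3[OF a b c])
    fix x assume x: "x \<in> \<Omega>"
    show "F (rad x) * (Lr v x * v x) = 1 * (F (rad x) * Xr (\<lambda>y. v y * Xr v y) x)
        + - 1 * (F (rad x) * (Xr v x)\<^sup>2) + 1 * (?n * coth (rad x) * F (rad x) * (v x * Xr v x))"
      by (simp add: Xr_mult[OF sv smooth_Xr[OF sv] x] Lr_def power2_eq_square) (simp add: algebra_simps)
  qed
  also have "HI (\<lambda>x. F (rad x) * Xr (\<lambda>y. v y * Xr v y) x) =
      - HI (\<lambda>x. (F' (rad x) + ?n * coth (rad x) * F (rad x)) * (v x * Xr v x))"
    by (rule integral_radial_parts[OF vX F(1,2) der(1)])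
  also have "HI (\<lambda>x. (F' (rad x) + ?n * coth (rad x) * F (rad x)) * (v x * Xr v x))
      = 1 * HI (\<lambda>x. F' (rad x) * (v x * Xr v x)) + 1 * HI (\<lambda>x. ?n * coth (rad x) * F (rad x) * (v x * Xr v x))"
    by (rule HI_lin2[OF d c]) (simp add: algebra_simps)
  finally show ?thesis
    using integral_radial_square[OF v F(2,3) der(2)] by simp
qed

text \<open>Expand the nonnegative integral of \<open>h * (Xr v - g * v)\<^sup>2\<close> and
  integrate the mixed term by parts. The function \<open>g\<close> is free; the natural choice is
  the logarithmic derivative of a positive radial comparison function.\<close>

lemma integral_hardy:
  assumes v: "cpt_smooth x0 v" and h: "smooth {0<..} h" and g: "smooth {0<..} g" and k': "smooth {0<..} k'"
    and pos: "\<And>t. t > 0 \<Longrightarrow> h t \<ge> 0"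
    and der: "\<And>t. t > 0 \<Longrightarrow> ((\<lambda>t. h t * g t) has_real_derivative k' t) (at t)"
  shows "HI (\<lambda>x. h (rad x) * (Xr v x)\<^sup>2) \<ge>
    - HI (\<lambda>x. (k' (rad x) + (real DIM('a) - 1) * coth (rad x) * (h (rad x) * g (rad x))
        + h (rad x) * (g (rad x))\<^sup>2) * (v x)\<^sup>2)"
proof -
  let ?n = "real DIM('a) - 1"
  let ?k = "\<lambda>t. h t * g t"
  have X: "cpt_smooth x0 (Xr v)" by (rule cpt_smooth_Xr[OF v])
  have k: "smooth {0<..} ?k" by (intro smooth_pos_intros h g)
  have a: "cpt_smooth x0 (\<lambda>x. h (rad x) * (Xr v x)\<^sup>2)"
    by (rule cpt_smooth_radial[OF cpt_smooth_power[OF X] h])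
  have b: "cpt_smooth x0 (\<lambda>x. ?k (rad x) * (v x * Xr v x))"
    by (rule cpt_smooth_radial[OF cpt_smooth_mult[OF v X] k])
  have c: "cpt_smooth x0 (\<lambda>x. h (rad x) * (g (rad x))\<^sup>2 * (v x)\<^sup>2)"
    by (rule cpt_smooth_radial[OF cpt_smooth_power[OF v]]) (intro smooth_pos_intros h g)
  have d: "cpt_smooth x0 (\<lambda>x. (k' (rad x) + ?n * coth (rad x) * ?k (rad x)) * (v x)\<^sup>2)"
    by (rule cpt_smooth_radial[OF cpt_smooth_power[OF v]]) (intro smooth_pos_intros h g k')
  have "0 \<le> HI (\<lambda>x. h (rad x) * (Xr v x - g (rad x) * v x)\<^sup>2)"
  proof (rule hyp_vol_integral_nonneg)
    show "cpt_smooth x0 (\<lambda>x. h (rad x) * (Xr v x - g (rad x) * v x)\<^sup>2)"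
      by (intro cpt_smooth_radial[OF _ h] cpt_smooth_power cpt_smooth_diff X cpt_smooth_radial[OF v g])
    show "0 \<le> h (rad x) * (Xr v x - g (rad x) * v x)\<^sup>2" if "x \<in> \<Omega>" for x
      using pos[OF rad_pos[OF that]] by simp
  qed
  also have "\<dots> = 1 * HI (\<lambda>x. h (rad x) * (Xr v x)\<^sup>2) + (-2) * HI (\<lambda>x. ?k (rad x) * (v x * Xr v x))
      + 1 * HI (\<lambda>x. h (rad x) * (g (rad x))\<^sup>2 * (v x)\<^sup>2)"
    by (rule HI_lin3[OF a b c]) (simp add: power2_eq_square algebra_simps)
  finally have "HI (\<lambda>x. h (rad x) * (Xr v x)\<^sup>2) \<ge> 2 * HI (\<lambda>x. ?k (rad x) * (v x * Xr v x))
      - HI (\<lambda>x. h (rad x) * (g (rad x))\<^sup>2 * (v x)\<^sup>2)" by simp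
  moreover have "HI (\<lambda>x. (k' (rad x) + ?n * coth (rad x) * ?k (rad x) + h (rad x) * (g (rad x))\<^sup>2) * (v x)\<^sup>2)
      = 1 * HI (\<lambda>x. (k' (rad x) + ?n * coth (rad x) * ?k (rad x)) * (v x)\<^sup>2)
       + 1 * HI (\<lambda>x. h (rad x) * (g (rad x))\<^sup>2 * (v x)\<^sup>2)"
    by (rule HI_lin2[OF d c]) (simp add: algebra_simps)
  ultimately show ?thesis
    using integral_radial_square[OF v k k' der] by simp
qed

lemma Gam_Xr: "smooth \<Omega> u \<Longrightarrow> x \<in> \<Omega> \<Longrightarrow> Gam (Xr u) x = (\<Sum>i\<in>Basis. (Xr (Dt i u) x)\<^sup>2)"
  by (simp add: Gam_def Xr_Dt_commute)

lemma HI_Gam: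
  assumes "cpt_smooth x0 u" "smooth {0<..} F"
  shows "HI (\<lambda>x. F (rad x) * Gam u x) = (\<Sum>i\<in>Basis. HI (\<lambda>x. F (rad x) * (Dt i u x)\<^sup>2))"
  unfolding Gam_def by (rule HI_sum_radial[symmetric]) (intro cpt_smooth_power cpt_smooth_Dt assms)+

lemma HI_Gam_Xr:
  assumes u: "cpt_smooth x0 u" and F: "smooth {0<..} F"
  shows "HI (\<lambda>x. F (rad x) * Gam (Xr u) x) = (\<Sum>i\<in>Basis. HI (\<lambda>x. F (rad x) * (Xr (Dt i u) x)\<^sup>2))"
proof -
  have c: "cpt_smooth x0 (\<lambda>x. (Xr (Dt i u) x)\<^sup>2)" for i
    by (intro cpt_smooth_power cpt_smooth_Xr cpt_smooth_Dt u)
  have "HI (\<lambda>x. F (rad x) * Gam (Xr u) x) = HI (\<lambda>x. F (rad x) * (\<Sum>i\<in>Basis. (Xr (Dt i u) x)\<^sup>2))"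
    by (rule HI_cong[OF cpt_smooth_radial[OF cpt_smooth_sum[OF c] F]])
       (simp add: Gam_Xr[OF cpt_smooth_smooth[OF u]])
  then show ?thesis by (simp add: HI_sum_radial[OF c F])
qed

text \<open>Squaring produces twice the cross term, hence \<open>Gam (Xr u)\<close> twice. One copy
  is the second summand on the right, the other is traded by Hardy for \<open>Gam u\<close>; with
  the spectral gap only integrals of \<open>Gam u\<close> with radial weights remain.\<close>

lemma angular_inequality:
  assumes u: "cpt_smooth x0 u" and N: "DIM('a) \<ge> 5"
  defines "n \<equiv> real DIM('a)"
  shows "HI (\<lambda>x. (Lr u x + Tl u x / (sh x)\<^sup>2)\<^sup>2) \<ge> HI (\<lambda>x. (Lr u x)\<^sup>2)
    + HI (\<lambda>x. Gam (Xr u) x / (sh x)\<^sup>2)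
    + HI (\<lambda>x. (n * (n - 1) / 2 * ((rad x * coth (rad x) - 1) / (rad x)\<^sup>2) + n\<^sup>2 / 4 / (rad x)\<^sup>2) * (Gam u x / (sh x)\<^sup>2))"
proof -
  define h :: "real \<Rightarrow> real" where "h t = 1 / (sinh t)\<^sup>2" for t
  define h' where "h' t = - 2 * coth t * h t" for t
  define h'' where "h'' t = 2 * (h t)\<^sup>2 + 4 * (coth t)\<^sup>2 * h t" for t
  \<comment> \<open>The logarithmic derivative of \<open>t * sinh t powr (- (n - 2) / 2)\<close>. At
    the pole it behaves like \<open>- (n - 4) / (2 * t)\<close>, the optimal choice for the
    Euclidean Hardy inequality with weight \<open>1 / t\<^sup>2\<close>.\<close>
  define g where "g t = 1 / t - (n - 2) / 2 * coth t" for t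
  define k' where "k' t = - 2 * coth t * (h t * g t) + h t * (- 1 / t\<^sup>2 + (n - 2) / 2 * h t)" for t
  define w where "w t = (n * (n - 1) / 2 * ((t * coth t - 1) / t\<^sup>2) + n\<^sup>2 / 4 / t\<^sup>2) * h t" for t
  have sh: "smooth {0<..} h"
    unfolding h_def[abs_def] by (intro smooth_pos_intros) simp
  have sg: "smooth {0<..} g"
    unfolding g_def[abs_def] by (intro smooth_pos_intros) simp
  have sh': "smooth {0<..} h'" and sh'': "smooth {0<..} h''"
    unfolding h'_def[abs_def] h''_def[abs_def] by (intro smooth_pos_intros sh)+
  have sk': "smooth {0<..} k'"
    unfolding k'_def[abs_def] by (intro smooth_pos_intros sh sg) simp
  have sw: "smooth {0<..} w"
    unfolding w_def[abs_def] by (intro smooth_pos_intros sh) simp_all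
  have dh: "(h has_real_derivative h' t) (at t)" if t: "t > 0" for t
  proof -
    have "sinh t \<noteq> 0" using t by simp
    then show ?thesis
      unfolding h_def[abs_def] h'_def coth_def
      by (auto intro!: derivative_eq_intros simp: h_def field_simps eval_nat_numeral)
  qed
  have dh': "(h' has_real_derivative h'' t) (at t)" if t: "t > 0" for t
  proof -
    have "((\<lambda>t. - 2 * coth t * h t) has_real_derivative (- 2 * (- 1 / (sinh t)\<^sup>2)) * h t + (- 2 * coth t) * h' t) (at t)"
      by (auto intro!: derivative_eq_intros coth_has_derivative[OF t] dh[OF t])
    moreover have "(- 2 * (- 1 / (sinh t)\<^sup>2)) * h t + (- 2 * coth t) * h' t = h'' t"
      by (simp add: h''_def h'_def power2_eq_square) (simp add: h_def power2_eq_square)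
    ultimately show ?thesis unfolding h'_def[abs_def] by simp
  qed
  have dk: "((\<lambda>t. h t * g t) has_real_derivative k' t) (at t)" if t: "t > 0" for t
  proof -
    have dg: "(g has_real_derivative (- 1 / t\<^sup>2 + (n - 2) / 2 * h t)) (at t)"
    proof -
      have "((\<lambda>t. 1 / t - (n - 2) / 2 * coth t) has_real_derivative
          - 1 / t\<^sup>2 - (n - 2) / 2 * (- 1 / (sinh t)\<^sup>2)) (at t)"
      proof (rule DERIV_diff[OF _ DERIV_cmult[OF coth_has_derivative[OF t]]])
        show "((\<lambda>t. 1 / t) has_real_derivative - 1 / t\<^sup>2) (at t)"
          using t by (auto intro!: derivative_eq_intros simp: power2_eq_square)
      qed
      then show ?thesis by (simp add: g_def[abs_def] h_def)
    qed
    have "((\<lambda>t. h t * g t) has_real_derivative h' t * g t + (- 1 / t\<^sup>2 + (n - 2) / 2 * h t) * h t) (at t)"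
      by (rule DERIV_mult[OF dh[OF t] dg])
    then show ?thesis by (simp add: k'_def h'_def mult_ac)
  qed
  have hpos: "h t \<ge> 0" for t by (simp add: h_def)
  have hs: "h (rad x) = 1 / (sh x)\<^sup>2" for x by (simp add: h_def sh_def)
  have su: "smooth \<Omega> u" by (rule cpt_smooth_smooth[OF u])
  have L: "cpt_smooth x0 (Lr u)" and T: "cpt_smooth x0 (Tl u)" and D: "cpt_smooth x0 (Dt i u)" for i
    by (intro cpt_smooth_Lr cpt_smooth_Tl cpt_smooth_Dt u)+
  have G: "cpt_smooth x0 (Gam u)" and GX: "cpt_smooth x0 (Gam (Xr u))"
    by (intro cpt_smooth_Gam cpt_smooth_Xr u)+
  have LT: "cpt_smooth x0 (\<lambda>x. h (rad x) * (Lr u x * Tl u x))"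
    by (rule cpt_smooth_radial[OF cpt_smooth_mult[OF L T] sh])
  have sh2: "smooth {0<..} (\<lambda>t. (h t)\<^sup>2)" by (intro smooth_pos_intros sh)
  have T2: "cpt_smooth x0 (\<lambda>x. (h (rad x))\<^sup>2 * (Tl u x)\<^sup>2)"
    by (rule cpt_smooth_radial[OF cpt_smooth_power[OF T] sh2])
  have lhs: "HI (\<lambda>x. (Lr u x + Tl u x / (sh x)\<^sup>2)\<^sup>2) = 1 * HI (\<lambda>x. (Lr u x)\<^sup>2)
      + 2 * HI (\<lambda>x. h (rad x) * (Lr u x * Tl u x)) + 1 * HI (\<lambda>x. (h (rad x))\<^sup>2 * (Tl u x)\<^sup>2)"
    by (rule HI_lin3[OF cpt_smooth_power[OF L] LT T2]) (simp add: hs power2_eq_square algebra_simps)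
  have gap: "(n - 1) * HI (\<lambda>x. (h (rad x))\<^sup>2 * Gam u x) \<le> HI (\<lambda>x. (h (rad x))\<^sup>2 * (Tl u x)\<^sup>2)"
    unfolding n_def by (rule spherical_gap[OF u sh2]) (use N in auto)
  let ?W = "\<lambda>t. h'' t + (n - 1) * coth t * h' t"
  have sW: "smooth {0<..} ?W" by (intro smooth_pos_intros sh' sh'')
  \<comment> \<open>Because \<open>Lr\<close> commutes with \<open>Dt i\<close>, the cross term
    splits into one radial problem for each angular component \<open>Dt i u\<close>.\<close>
  have cross: "HI (\<lambda>x. h (rad x) * (Lr u x * Tl u x)) =
      HI (\<lambda>x. h (rad x) * Gam (Xr u) x) - 1/2 * HI (\<lambda>x. ?W (rad x) * Gam u x)"
  proof -
    have "HI (\<lambda>x. h (rad x) * (Lr u x * Tl u x)) = - HI (\<lambda>x. h (rad x) * (\<Sum>i\<in>Basis. Dt i (Lr u) x * Dt i u x))"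
      by (rule integral_Tl_parts[OF u cpt_smooth_smooth[OF L] sh])
    also have "HI (\<lambda>x. h (rad x) * (\<Sum>i\<in>Basis. Dt i (Lr u) x * Dt i u x)) =
        HI (\<lambda>x. h (rad x) * (\<Sum>i\<in>Basis. Lr (Dt i u) x * Dt i u x))"
      by (rule HI_cong[OF cpt_smooth_radial[OF cpt_smooth_sum[OF cpt_smooth_mult[OF cpt_smooth_Lr[OF D] D]] sh]])
         (simp add: Dt_Lr[OF su])
    also have "\<dots> = (\<Sum>i\<in>Basis. HI (\<lambda>x. h (rad x) * (Lr (Dt i u) x * Dt i u x)))"
      by (rule HI_sum_radial[OF cpt_smooth_mult[OF cpt_smooth_Lr[OF D] D] sh, symmetric])
    also have "\<dots> = (\<Sum>i\<in>Basis. - HI (\<lambda>x. h (rad x) * (Xr (Dt i u) x)\<^sup>2)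
        + 1/2 * HI (\<lambda>x. ?W (rad x) * (Dt i u x)\<^sup>2))"
      unfolding n_def by (intro sum.cong refl integral_Lr_parts[OF D sh sh' sh'' dh dh'])
    also have "\<dots> = - HI (\<lambda>x. h (rad x) * Gam (Xr u) x) + 1/2 * HI (\<lambda>x. ?W (rad x) * Gam u x)"
      unfolding sum.distrib sum_negf sum_distrib_left[symmetric] HI_Gam_Xr[OF u sh] HI_Gam[OF u sW] ..
    finally show ?thesis by simp
  qed
  let ?K = "\<lambda>t. k' t + (n - 1) * coth t * (h t * g t) + h t * (g t)\<^sup>2"
  have sK: "smooth {0<..} ?K" by (intro smooth_pos_intros sk' sh sg)
  have hardy: "HI (\<lambda>x. h (rad x) * Gam (Xr u) x) \<ge> - HI (\<lambda>x. ?K (rad x) * Gam u x)"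
    unfolding HI_Gam_Xr[OF u sh] HI_Gam[OF u sK] sum_negf[symmetric]
    unfolding n_def
    by (rule sum_mono, rule integral_hardy[OF D sh sg sk' hpos dk])
  let ?R = "\<lambda>x. (- ?W (rad x) + (n - 1) * (h (rad x))\<^sup>2 - ?K (rad x) - w (rad x)) * Gam u x"
  have cG: "cpt_smooth x0 (\<lambda>x. F (rad x) * Gam u x)" if "smooth {0<..} F" for F
    by (rule cpt_smooth_radial[OF G that])
  have "0 \<le> HI ?R"
  proof (rule hyp_vol_integral_nonneg)
    show "cpt_smooth x0 ?R"
      by (rule cG[of "\<lambda>t. - ?W t + (n - 1) * (h t)\<^sup>2 - ?K t - w t"]) (intro smooth_pos_intros sW sh2 sK sw)
    fix x assume x: "x \<in> \<Omega>"
    define t where "t = rad x"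
    have t: "t > 0" using rad_pos[OF x] by (simp add: t_def)
    have "- ?W t + (n - 1) * (h t)\<^sup>2 - ?K t - w t = h t * (
      - (2 * h t + 4 * (coth t)\<^sup>2 - 2 * (n - 1) * (coth t)\<^sup>2) + (n - 1) * h t
      - (- 2 * coth t * g t - 1 / t\<^sup>2 + (n - 2) / 2 * h t + (n - 1) * coth t * g t + (g t)\<^sup>2)
      - n * (n - 1) / 2 * ((t * coth t - 1) / t\<^sup>2) - n\<^sup>2 / 4 / t\<^sup>2)"
      unfolding h''_def h'_def k'_def w_def
      by (simp add: right_diff_distrib distrib_left power2_eq_square mult_ac)
    also have "\<dots> \<ge> 0"
      unfolding g_def h_def using N t
      by (intro mult_nonneg_nonneg rellich_weight_nonneg) (auto simp: n_def)
    finally show "0 \<le> ?R x"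
      unfolding t_def Gam_def by (intro mult_nonneg_nonneg sum_nonneg) auto
  qed
  also have "HI ?R = (-1) * HI (\<lambda>x. ?W (rad x) * Gam u x) + (n - 1) * HI (\<lambda>x. (h (rad x))\<^sup>2 * Gam u x)
      + 1 * HI (\<lambda>x. (- ?K (rad x) - w (rad x)) * Gam u x)"
    by (rule HI_lin3[OF cG[OF sW] cG[OF sh2] cG[of "\<lambda>t. - ?K t - w t"]])
       (intro smooth_pos_intros sK sw, simp add: algebra_simps)
  also have "HI (\<lambda>x. (- ?K (rad x) - w (rad x)) * Gam u x)
      = (-1) * HI (\<lambda>x. ?K (rad x) * Gam u x) + (-1) * HI (\<lambda>x. w (rad x) * Gam u x)"
    by (rule HI_lin2[OF cG[OF sK] cG[OF sw]]) (simp add: algebra_simps)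
  finally have R: "0 \<le> - HI (\<lambda>x. ?W (rad x) * Gam u x) + (n - 1) * HI (\<lambda>x. (h (rad x))\<^sup>2 * Gam u x)
      - HI (\<lambda>x. ?K (rad x) * Gam u x) - HI (\<lambda>x. w (rad x) * Gam u x)" by simp
  have r1: "(\<lambda>x. Gam (Xr u) x / (sh x)\<^sup>2) = (\<lambda>x. h (rad x) * Gam (Xr u) x)"
    by (simp add: hs)
  have r2: "(\<lambda>x. (n * (n - 1) / 2 * ((rad x * coth (rad x) - 1) / (rad x)\<^sup>2) + n\<^sup>2 / 4 / (rad x)\<^sup>2) * (Gam u x / (sh x)\<^sup>2))
      = (\<lambda>x. w (rad x) * Gam u x)"
    by (simp add: w_def hs)
  show ?thesis
    unfolding lhs r1 r2 cross using gap hardy R by simp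
qed

section \<open>The weights in the last two terms\<close>

lemma powr_weight:
  assumes "t > 0" "DIM('a) \<ge> 2"
  shows "1 / t ^ (DIM('a) - 2) * (t powr ((real DIM('a) - 4) / 2))\<^sup>2 = 1 / t\<^sup>2"
proof -
  have "(t powr ((real DIM('a) - 4) / 2))\<^sup>2 = t powr (real DIM('a) - 4)"
    by (simp add: power2_eq_square powr_add[symmetric])
  also have "\<dots> = t powr (real (DIM('a) - 2) - 2)" using assms by (simp add: of_nat_diff)
  also have "\<dots> = t ^ (DIM('a) - 2) / t\<^sup>2"
    using assms(1) by (simp add: powr_diff powr_realpow)
  finally show ?thesis using assms(1) by simp
qed

lemma Xr_powr_mult:
  assumes u: "smooth \<Omega> u" and x: "x \<in> \<Omega>"
  shows "Xr (\<lambda>y. rad y powr a * u y) x = rad x powr a * (Xr u x + a / rad x * u x)"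
proof -
  have "((\<lambda>t. t powr a) has_real_derivative a * rad x powr (a - 1)) (at (rad x))"
    using rad_pos[OF x] by (auto intro!: derivative_eq_intros)
  from Xr_radial_mult[OF smooth_powr_real u x this] show ?thesis
    using rad_pos[OF x] by (simp add: powr_diff field_simps)
qed

definition last_weight :: "real \<Rightarrow> real" where
  "last_weight t = sinh t ^ (DIM('a) - 1) / t powr (real DIM('a) / 2)"

lemma smooth_last_weight: "smooth {0<..} last_weight"
  unfolding last_weight_def[abs_def] by (intro smooth_pos_intros) simp

lemma last_weight_sq:
  assumes "t > 0"
  shows "t ^ DIM('a) / sinh t ^ (2 * (DIM('a) - 1)) * (last_weight t)\<^sup>2 = 1"
proof -
  have "(t powr (real DIM('a) / 2))\<^sup>2 = t ^ DIM('a)"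
    using assms by (simp add: power2_eq_square powr_add[symmetric] powr_realpow)
  then show ?thesis
    using assms by (simp add: last_weight_def power_divide power_mult[symmetric] mult.commute)
qed

text \<open>The logarithmic derivative of the weight is
  \<open>(N - 1) * coth t - N / (2 * t)\<close>; its first part completes the second radial
  derivative to \<open>Lr u\<close>.\<close>

lemma Xr_last_weight_mult:
  assumes u: "smooth \<Omega> u" and x: "x \<in> \<Omega>"
  shows "Xr (\<lambda>y. last_weight (rad y) * Xr u y) x
    = last_weight (rad x) * (Lr u x - real DIM('a) / (2 * rad x) * Xr u x)"
proof -
  let ?t = "rad x" and ?N = "DIM('a)"
  have t: "?t > 0" using rad_pos[OF x] .
  have s: "sinh ?t \<noteq> 0" and p: "?t powr (real ?N / 2) \<noteq> 0" using t by simp_all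
  have "(last_weight has_real_derivative
      (real (?N - 1) * sinh ?t ^ (?N - 1 - 1) * cosh ?t * ?t powr (real ?N / 2)
        - sinh ?t ^ (?N - 1) * (real ?N / 2 * ?t powr (real ?N / 2 - 1)))
      / (?t powr (real ?N / 2) * ?t powr (real ?N / 2))) (at ?t)"
    unfolding last_weight_def[abs_def] using t p by (auto intro!: derivative_eq_intros)
  moreover have "(real (?N - 1) * sinh ?t ^ (?N - 1 - 1) * cosh ?t * ?t powr (real ?N / 2)
        - sinh ?t ^ (?N - 1) * (real ?N / 2 * ?t powr (real ?N / 2 - 1)))
      / (?t powr (real ?N / 2) * ?t powr (real ?N / 2))
      = last_weight ?t * ((real ?N - 1) * coth ?t - real ?N / (2 * ?t))"
  proof -
    \<comment> \<open>When \<open>?N - 1\<close> is 0 the truncated exponent does no harm, since the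
      factor in front vanishes.\<close>
    have a: "real (?N - 1) * sinh ?t ^ (?N - 1 - 1) = (real ?N - 1) * sinh ?t ^ (?N - 1) / sinh ?t"
    proof -
      have "real ?N - 1 = real (?N - 1)" by (simp add: of_nat_diff Suc_leI)
      then show ?thesis using s by (cases "?N - 1") simp_all
    qed
    have b: "?t powr (real ?N / 2 - 1) = ?t powr (real ?N / 2) / ?t"
      using t by (simp add: powr_diff)
    have alg: "((n - 1) * S / s * c * p - S * (n / 2 * (p / r))) / (p * p) = S / p * ((n - 1) * (c / s) - n / (2 * r))"
      if "p \<noteq> 0" "r \<noteq> 0" "s \<noteq> 0" for n S s c p r :: real
      using that by (simp add: field_simps)
    show ?thesis
      unfolding a b last_weight_def coth_def using alg[OF p _ s] t by simp
  qed
  ultimately have d: "(last_weight has_real_derivative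
      last_weight ?t * ((real ?N - 1) * coth ?t - real ?N / (2 * ?t))) (at ?t)" by simp
  show ?thesis
    unfolding Xr_radial_mult[OF smooth_last_weight smooth_Xr[OF u] x d] by (simp add: Lr_def algebra_simps)
qed

end

section \<open>Radial test functions\<close>

text \<open>The powers of \<open>1 / x\<close> are included to make the family closed under
  differentiation up to linear combinations; \<open>flat 0\<close> is the standard smooth function
  that vanishes on a half line.\<close>

definition flat :: "nat \<Rightarrow> real \<Rightarrow> real" where
  "flat n x = (if x > 0 then (1 / x) ^ n * exp (- (1 / x)) else 0)"

lemma flat_tendsto_0: "(flat n \<longlongrightarrow> 0) (at 0)"
proof (rule filterlim_split_at)
  show "(flat n \<longlongrightarrow> 0) (at_left 0)"
    by (rule tendsto_eventually) (auto simp: flat_def eventually_at_left_field intro: exI[of _ "-1"])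
  have "((\<lambda>x::real. inverse x ^ n / exp (inverse x)) \<longlongrightarrow> 0) (at_right 0)"
    by (rule filterlim_compose[OF tendsto_power_div_exp_0 filterlim_inverse_at_top_right])
  then show "(flat n \<longlongrightarrow> 0) (at_right 0)"
  proof (rule Lim_transform_eventually)
    show "eventually (\<lambda>x. inverse x ^ n / exp (inverse x) = flat n x) (at_right 0)"
      using eventually_at_right_less[of 0]
      by eventually_elim (simp add: flat_def exp_minus inverse_eq_divide)
  qed
qed

lemma flat_has_derivative:
  "(flat n has_real_derivative (flat (n + 2) x - real n * flat (n + 1) x)) (at x)"
proof (cases x "0::real" rule: linorder_cases)
  case less
  have "((\<lambda>_. 0) has_real_derivative 0) (at x)" by simp
  then have "(flat n has_real_derivative 0) (at x)"
    by (rule has_field_derivative_transform_within_open[where S = "{..<0}"]) (use less in \<open>auto simp: flat_def\<close>)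
  then show ?thesis using less by (simp add: flat_def)
next
  case equal
  \<comment> \<open>At 0 the difference quotient of one member is the next member, so
    differentiability there is just its limit.\<close>
  have "(\<lambda>h. (flat n (0 + h) - flat n 0) / h) = flat (n + 1)"
    by (auto simp: flat_def fun_eq_iff)
  then show ?thesis
    using flat_tendsto_0[of "n + 1"] by (simp add: DERIV_def equal) (simp add: flat_def)
next
  case greater
  have "((\<lambda>x. (1 / x) ^ n * exp (- (1 / x))) has_real_derivative
     (real n * (1 / x) ^ (n - 1) * (- 1 / x\<^sup>2)) * exp (- (1 / x)) + exp (- (1 / x)) * (1 / x\<^sup>2) * (1 / x) ^ n) (at x)"
    using greater by (auto intro!: derivative_eq_intros simp: power2_eq_square)
  moreover have "(real n * (1 / x) ^ (n - 1) * (- 1 / x\<^sup>2)) * exp (- (1 / x)) + exp (- (1 / x)) * (1 / x\<^sup>2) * (1 / x) ^ n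
      = flat (n + 2) x - real n * flat (n + 1) x"
    using greater by (cases n) (simp_all add: flat_def power2_eq_square field_simps)
  ultimately have "((\<lambda>x. (1 / x) ^ n * exp (- (1 / x))) has_real_derivative
      flat (n + 2) x - real n * flat (n + 1) x) (at x)"
    by (simp only:)
  then show ?thesis
    by (rule has_field_derivative_transform_within_open[where S = "{0<..}"])
       (use greater in \<open>auto simp: flat_def\<close>)
qed

lemma smooth_flat: "smooth UNIV (flat n)"
  unfolding smooth_def
proof
  show "Ck_on k UNIV (flat n)" for k
  proof (induction k arbitrary: n)
    case 0
    show ?case
      using DERIV_isCont[OF flat_has_derivative] by (auto intro!: continuous_at_imp_continuous_on)
  next
    case (Suc k)
    have d: "(flat n has_derivative (\<lambda>h. (flat (n + 2) x - real n * flat (n + 1) x) * h)) (at x)" for x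
      using flat_has_derivative[of n x] by (simp add: has_field_derivative_def)
    have "pderiv_dir 1 (flat n) = (\<lambda>x. flat (n + 2) x + (- real n) * flat (n + 1) x)"
      by (rule ext) (simp add: pderiv_dir_eq[OF d])
    moreover have "Ck_on k UNIV (\<lambda>x. flat (n + 2) x + (- real n) * flat (n + 1) x)"
      by (intro Ck_on_add Ck_on_mult Ck_on_const Suc open_UNIV)
    moreover have "flat n differentiable at x" for x
      using d by (rule differentiableI)
    ultimately show ?case by simp
  qed
qed

lemma smooth_affine: "smooth UNIV (\<lambda>x::real. a * x + b)"
  using smooth_inner[of "UNIV :: real set" a]
  by (intro smooth_add) (auto simp: mult.commute)

lemma smooth_flat_affine: "smooth UNIV (\<lambda>x. flat n (a * x + b))"
  by (rule smooth_compose[OF _ smooth_flat smooth_affine]) auto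

definition bump :: "real \<Rightarrow> real" where
  "bump s = flat 0 (1 * s + (- 2)) * flat 0 (- 1 * s + 3)"

text \<open>A majorant of the indicator of the support of \<open>bump\<close>: on [2, 3] both
  arguments of \<open>flat 0\<close> are at least 1/3, hence the normalization. Error terms with
  derivatives of \<open>bump\<close> are bounded by it, since they need not be small relative to
  \<open>bump\<close> itself.\<close>

definition wide_bump :: "real \<Rightarrow> real" where
  "wide_bump s = (flat 0 (1/3 * s + (- 1/3)) * flat 0 (- 1/3 * s + 4/3)) / (flat 0 (1/3))\<^sup>2"

lemma smooth_bump: "smooth UNIV bump"
  unfolding bump_def[abs_def] by (intro smooth_mult smooth_flat_affine open_UNIV)

lemma smooth_wide_bump: "smooth UNIV wide_bump"
  unfolding wide_bump_def[abs_def]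
proof (rule smooth_divide)
  show "(flat 0 (1/3))\<^sup>2 > 0" by (simp add: flat_def)
qed (intro smooth_mult smooth_flat_affine smooth_const open_UNIV)+

lemma flat_nonneg: "flat n x \<ge> 0"
  by (simp add: flat_def)

lemma flat_0_mono: "x \<le> y \<Longrightarrow> flat 0 x \<le> flat 0 y"
  by (auto simp: flat_def frac_le)

lemma bump_out: "s \<notin> {2<..<3} \<Longrightarrow> bump s = 0"
  by (auto simp: bump_def flat_def)

lemma wide_bump_out: "s \<notin> {1<..<4} \<Longrightarrow> wide_bump s = 0"
  by (auto simp: wide_bump_def flat_def)

lemma wide_bump_nonneg: "wide_bump s \<ge> 0"
  by (simp add: wide_bump_def flat_nonneg)

lemma wide_bump_ge_1:
  assumes "s \<in> {2..3}"
  shows "wide_bump s \<ge> 1"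
proof -
  have "flat 0 (1/3) * flat 0 (1/3) \<le> flat 0 (1/3 * s + (- 1/3)) * flat 0 (- 1/3 * s + 4/3)"
    using assms by (intro mult_mono flat_0_mono flat_nonneg) auto
  moreover have "flat 0 (1/3) > 0" by (simp add: flat_def)
  ultimately show ?thesis by (simp add: wide_bump_def power2_eq_square)
qed

lemma smooth_real_pderiv:
  fixes F :: "real \<Rightarrow> real"
  assumes "smooth S F" "t \<in> S"
  shows "(F has_real_derivative pderiv_dir 1 F t) (at t)"
proof -
  have "linear (frechet_derivative F (at t))"
    by (rule linear_frechet_derivative[OF smooth_differentiable[OF assms]])
  then have "frechet_derivative F (at t) h = pderiv_dir 1 F t * h" for h
    using linear_scale[of "frechet_derivative F (at t)" h 1] by (simp add: pderiv_dir_def)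
  then have "frechet_derivative F (at t) = (*) (pderiv_dir 1 F t)" by (rule ext)
  then show ?thesis
    using smooth_has_derivative[OF assms] by (simp add: has_field_derivative_def)
qed

text \<open>The primitive that starts at 0 stays 0 before the support, and the vanishing total
  integral brings it back to 0 after it. The interval [0, 5] merely contains the support with room
  on both sides.\<close>

lemma antiderivative_compact_support:
  fixes f :: "real \<Rightarrow> real"
  assumes f: "smooth UNIV f" and out: "\<And>s. s \<notin> {1<..<4} \<Longrightarrow> f s = 0" and 0: "integral {0..5} f = 0"
  obtains G where "smooth UNIV G" "\<And>s. (G has_real_derivative f s) (at s)" "\<And>s. s \<notin> {1<..<4} \<Longrightarrow> G s = 0"
proof
  define G where "G s = integral {0..s} f" for s
  have cont: "continuous_on T f" for T
    using smooth_continuous_on[OF f] continuous_on_subset by blast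
  have int: "f integrable_on {a..b}" for a b
    by (rule integrable_continuous_interval[OF cont])
  have low: "G s = 0" if "s \<le> 1" for s
    unfolding G_def using that by (intro integral_unique has_integral_is_0 out) auto
  show G: "(G has_real_derivative f s) (at s)" for s
  proof (cases "s < 1")
    case True
    have "((\<lambda>_. 0) has_real_derivative f s) (at s)" using True out by auto
    then show ?thesis
      by (rule has_field_derivative_transform_within_open[where S = "{..<1}"]) (use True low in auto)
  next
    case False
    then have "(G has_real_derivative f s) (at s within {0..s + 1})"
      unfolding G_def by (intro integral_has_real_derivative cont) auto
    moreover have "at s within {0..s + 1} = at s"
      using False by (intro at_within_interior) auto
    ultimately show ?thesis by simp
  qed
  show "smooth UNIV G"
    by (rule smooth_real_DERIV[OF open_UNIV G f])
  show "G s = 0" if "s \<notin> {1<..<4}" for s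
  proof (cases "s \<le> 1")
    case False
    then have s: "s \<ge> 4" using that by auto
    have "integral {4..b} f = 0" for b
      by (intro integral_unique has_integral_is_0 out) auto
    then have "G s = integral {0..4} f" "integral {0..5} f = integral {0..4} f"
      using Henstock_Kurzweil_Integration.integral_combine[where f = f and a = 0 and c = 4 and b = s]
        Henstock_Kurzweil_Integration.integral_combine[where f = f and a = 0 and c = 4 and b = 5] s int by (simp_all add: G_def)
    then show ?thesis using 0 by simp
  qed (rule low)
qed

lemma bounded_smooth_support:
  fixes f :: "real \<Rightarrow> real"
  assumes "smooth UNIV f" "\<And>s. s \<notin> {2..3} \<Longrightarrow> f s = 0"
  obtains M where "M > 0" "\<And>s. \<bar>f s\<bar> \<le> M"
proof -
  have "compact (f ` {2..3})"
    by (intro compact_continuous_image compact_Icc continuous_on_subset[OF smooth_continuous_on[OF assms(1)]]) auto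
  then obtain B where B: "\<And>s. s \<in> {2..3} \<Longrightarrow> \<bar>f s\<bar> \<le> B"
    using compact_imp_bounded by (fastforce simp: bounded_iff)
  show ?thesis
  proof
    show "max B 1 > 0" by simp
    show "\<bar>f s\<bar> \<le> max B 1" for s
      using B[of s] assms(2)[of s] by (cases "s \<in> {2..3}") auto
  qed
qed

lemma integral_bump_sq_pos: "integral {0..5} (\<lambda>s. (bump s)\<^sup>2) > 0"
proof (rule ccontr)
  have cont: "continuous_on {0..5} (\<lambda>s. (bump s)\<^sup>2)"
    by (intro continuous_on_power continuous_on_subset[OF smooth_continuous_on[OF smooth_bump]]) auto
  have "integral {0..5} (\<lambda>s. (bump s)\<^sup>2) \<ge> 0"
    by (intro integral_nonneg integrable_continuous_interval cont) auto
  moreover assume "\<not> integral {0..5} (\<lambda>s. (bump s)\<^sup>2) > 0"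
  ultimately have "integral {0..5} (\<lambda>s. (bump s)\<^sup>2) = 0" by linarith
  then have "\<forall>s\<in>{0..5}. (bump s)\<^sup>2 = 0"
    using integral_eq_0_iff[OF cont] by auto
  then have "bump (5/2) = 0" by simp
  then show False by (simp add: bump_def flat_def)
qed

text \<open>The last bound says that \<open>t * coth t - 1 \<le> t\<close>: the deviation of the
  hyperbolic radial Laplacian from the Euclidean one is small near the pole.\<close>

lemma sinh_bounds:
  fixes t :: real
  assumes "t \<ge> 0"
  shows "t \<le> sinh t" "sinh t \<le> t * cosh t" "t * cosh t \<le> (1 + t) * sinh t"
proof -
  have "sinh t - t \<ge> 0"
    by (rule nonneg_if_DERIV_nonneg[where f = "\<lambda>t. sinh t - t" and f' = "\<lambda>t. cosh t - 1"])
       (use assms cosh_real_ge_1 in \<open>auto intro!: derivative_eq_intros\<close>)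
  then show "t \<le> sinh t" by simp
  show "sinh t \<le> t * cosh t" using cosh_sinh_bounds(1)[OF assms] by simp
  have "(1 + t) * sinh t - t * cosh t \<ge> 0"
  proof (rule nonneg_if_DERIV_nonneg[where f = "\<lambda>t. (1 + t) * sinh t - t * cosh t"
        and f' = "\<lambda>t. sinh t + t * (cosh t - sinh t)"])
    show "((\<lambda>t. (1 + t) * sinh t - t * cosh t) has_real_derivative sinh x + x * (cosh x - sinh x)) (at x)" for x :: real
      by (auto intro!: derivative_eq_intros simp: algebra_simps)
    show "0 \<le> sinh x + x * (cosh x - sinh x)" if "x \<ge> 0" for x :: real
      using that sinh_less_cosh_real[of x] by (intro add_nonneg_nonneg mult_nonneg_nonneg) auto
  qed (use assms in auto)
  then show "t * cosh t \<le> (1 + t) * sinh t" by simp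
qed

text \<open>A power times a profile that varies slowly in \<open>ln t\<close>. The shape survives
  differentiation: the exponent drops by one and a derivative of the profile costs a factor
  \<open>1 / R\<close>.\<close>

definition log_scaled :: "real \<Rightarrow> (real \<Rightarrow> real) \<Rightarrow> real \<Rightarrow> real \<Rightarrow> real" where
  "log_scaled p f R t = t powr p * f (- ln t / R)"

lemma smooth_log_arg:
  fixes f :: "real \<Rightarrow> real"
  assumes "smooth UNIV f"
  shows "smooth {0<..} (\<lambda>t. f (- ln t / R))"
proof (rule smooth_compose[OF open_greaterThan assms])
  have "smooth {0<..} (\<lambda>t. (- 1 / R) * ln t)" by (intro smooth_pos_intros)
  then show "smooth {0<..} (\<lambda>t. - ln t / R)" by simp
qed simp

lemma smooth_log_scaled: "smooth UNIV f \<Longrightarrow> smooth {0<..} (log_scaled p f R)"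
  unfolding log_scaled_def[abs_def] by (intro smooth_pos_intros smooth_log_arg)

lemma log_arg_has_derivative:
  assumes "(f has_real_derivative f') (at (- ln t / R))" "t > 0"
  shows "((\<lambda>t. f (- ln t / R)) has_real_derivative - (f' / (R * t))) (at t)"
proof -
  have "((\<lambda>t. - ln t / R) has_real_derivative - (1 / (R * t))) (at t)"
  proof (cases "R = 0")
    case False
    then show ?thesis using assms(2) by (auto intro!: derivative_eq_intros simp: field_simps)
  qed simp
  from DERIV_chain2[OF assms(1) this] show ?thesis by simp
qed

lemma log_scaled_has_derivative:
  assumes f: "\<And>s. (f has_real_derivative f' s) (at s)" and t: "t > 0"
  shows "(log_scaled p f R has_real_derivative log_scaled (p - 1) (\<lambda>s. p * f s - f' s / R) R t) (at t)"
proof -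
  have "((\<lambda>t. t powr p) has_real_derivative p * t powr (p - 1)) (at t)"
    using t by (auto intro!: derivative_eq_intros)
  from DERIV_mult[OF this log_arg_has_derivative[OF f t]] show ?thesis
    using t unfolding log_scaled_def[abs_def] by (simp add: powr_diff field_simps)
qed

context hyp_pole
begin

section \<open>Radial functions supported in annuli\<close>

lemma exists_rad:
  assumes "t > 0"
  obtains x where "x \<in> \<Omega>" "rad x = t"
proof -
  obtain i :: 'a where i: "i \<in> Basis" using nonempty_Basis by blast
  show ?thesis
  proof
    show "polar_point x0 t i \<in> \<Omega>" using i assms by (intro polar_point_in) auto
    show "rad (polar_point x0 t i) = t"
      unfolding rad_def using i assms x0_norm by (intro hyp_dist_polar_point) (auto simp: hyp_space_def)
  qed
qed

lemma compact_annulus: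
  assumes "0 < a"
  obtains K where "compact K" "K \<subseteq> \<Omega>" "\<And>x. x \<in> \<Omega> \<Longrightarrow> a \<le> rad x \<Longrightarrow> rad x \<le> b \<Longrightarrow> x \<in> K"
proof
  define m where "m x = (1 - (norm x0)\<^sup>2) * (1 - (norm x)\<^sup>2)" for x :: 'a
  \<comment> \<open>The bounds on \<open>cosh r\<close> with the denominator \<open>m\<close>
    cleared, so that the set is closed in the whole space. On the unit sphere \<open>m\<close>
    vanishes and the second bound forces \<open>x = x0\<close>, so no boundary point belongs to
    it.\<close>
  define K where "K = cball 0 1 \<inter> {x. (cosh a - 1) * m x \<le> 2 * (norm (x0 - x))\<^sup>2}
    \<inter> {x. 2 * (norm (x0 - x))\<^sup>2 \<le> (cosh b - 1) * m x}"
  have x0m: "1 - (norm x0)\<^sup>2 > 0" using x0_norm by (simp add: abs_square_less_1)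
  have mpos: "m x > 0" if "norm x < 1" for x
    using that x0m by (simp add: m_def abs_square_less_1)
  show "compact K"
    unfolding K_def m_def
    by (intro compact_Int_closed closed_Collect_le compact_cball continuous_intros)
  show "K \<subseteq> \<Omega>"
  proof
    fix x assume x: "x \<in> K"
    have "norm x \<noteq> 1"
    proof
      assume "norm x = 1"
      then have "m x = 0" by (simp add: m_def)
      then have "x = x0" using x by (simp add: K_def)
      then show False using \<open>norm x = 1\<close> x0_norm by simp
    qed
    then have n: "norm x < 1" using x by (simp add: K_def)
    have "x \<noteq> x0"
    proof
      assume "x = x0"
      moreover have "(cosh a - 1) * m x > 0"
        using mpos[OF n] assms cosh_real_nonneg_less_iff[of 0 a]
        by (intro mult_pos_pos) auto
      ultimately show False using x by (simp add: K_def)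
    qed
    then show "x \<in> \<Omega>" using n by (simp add: punctured_def)
  qed
  fix x assume x: "x \<in> \<Omega>" "a \<le> rad x" "rad x \<le> b"
  have n: "norm x < 1" using \<Omega>_D[OF x(1)] by simp
  have mp: "m x > 0" by (rule mpos[OF n])
  have c: "ch x - 1 = 2 * (norm (x0 - x))\<^sup>2 / m x"
    using ch_eq[OF n] by (simp add: m_def)
  have "cosh a \<le> ch x" "ch x \<le> cosh b"
    using x assms rad_pos[OF x(1)] by (simp_all add: cosh_rad[OF x(1), symmetric] cosh_real_nonneg_le_iff)
  then have "cosh a - 1 \<le> 2 * (norm (x0 - x))\<^sup>2 / m x" "2 * (norm (x0 - x))\<^sup>2 / m x \<le> cosh b - 1"
    unfolding c[symmetric] by simp_all
  then show "x \<in> K" using mp n by (simp add: K_def field_simps)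
qed

lemma cpt_smooth_radial_bump:
  assumes F: "smooth {0<..} F" and a: "0 < a" and out: "\<And>t. t > 0 \<Longrightarrow> t < a \<or> b < t \<Longrightarrow> F t = 0"
  shows "cpt_smooth x0 (\<lambda>x. F (rad x))"
proof -
  obtain K where K: "compact K" "K \<subseteq> \<Omega>" "\<And>x. x \<in> \<Omega> \<Longrightarrow> a \<le> rad x \<Longrightarrow> rad x \<le> b \<Longrightarrow> x \<in> K"
    using compact_annulus[OF a, of b] by blast
  have "F (rad x) = 0" if "x \<in> \<Omega> - K" for x
    using K(3)[of x] that out[OF rad_pos[of x]] by fastforce
  then show ?thesis
    unfolding cpt_smooth_def using smooth_radial[OF F] K(1,2) by blast
qed

lemma log_arg_support:
  fixes t R :: real
  assumes "t > 0" "R > 0" "t < exp (- 4 * R) \<or> exp (- R) < t"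
  shows "- ln t / R \<notin> {1<..<4}"
proof -
  have "ln t < - 4 * R \<or> - R < ln t"
  proof -
    have "exp (ln t) < exp (- 4 * R) \<or> exp (- R) < exp (ln t)" using assms(1,3) by simp
    then show ?thesis by (simp only: exp_less_cancel_iff)
  qed
  then show ?thesis using assms(2) by (auto simp: field_simps)
qed

lemma cpt_smooth_log:
  assumes F: "smooth {0<..} F" and f: "smooth UNIV f" "\<And>s. s \<notin> {1<..<4} \<Longrightarrow> f s = 0" and R: "R > 0"
  shows "cpt_smooth x0 (\<lambda>x. F (rad x) * f (- ln (rad x) / R))"
proof (rule cpt_smooth_radial_bump[of "\<lambda>t. F t * f (- ln t / R)" "exp (- 4 * R)" "exp (- R)"])
  show "smooth {0<..} (\<lambda>t. F t * f (- ln t / R))"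
    by (intro smooth_pos_intros F smooth_log_arg f)
  show "F t * f (- ln t / R) = 0" if "t > 0" "t < exp (- 4 * R) \<or> exp (- R) < t" for t
    using f(2)[OF log_arg_support[OF that(1) R that(2)]] by simp
qed simp

text \<open>Up to the constant area of the unit sphere, integration against this weight is integration in the
  variable \<open>ln r\<close> on the real line.\<close>

definition log_weight :: "real \<Rightarrow> real" where
  "log_weight t = 1 / (t * sinh t ^ (DIM('a) - 1))"

lemma smooth_log_weight: "smooth {0<..} log_weight"
  unfolding log_weight_def[abs_def] by (intro smooth_pos_intros) simp

text \<open>For the radial field with coefficient \<open>f / sinh r ^ (N - 1)\<close> the density
  cancels in the divergence, which becomes \<open>- 1 / R\<close> times the integrand.\<close>

lemma integral_log_weight_derivative:
  assumes f: "smooth UNIV f" and out: "\<And>s. s \<notin> {1<..<4} \<Longrightarrow> f s = 0" and R: "R > 0"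
    and der: "\<And>s. (f has_real_derivative f' s) (at s)"
  shows "HI (\<lambda>x. log_weight (rad x) * f' (- ln (rad x) / R)) = 0"
proof -
  let ?N = "DIM('a)"
  let ?H = "\<lambda>t. 1 / sinh t ^ (?N - 1) * f (- ln t / R)"
  have w: "smooth {0<..} (\<lambda>t. 1 / sinh t ^ (?N - 1))" by (intro smooth_pos_intros) simp
  have c: "cpt_smooth x0 (\<lambda>x. ?H (rad x))" by (rule cpt_smooth_log[OF w f out R])
  have "HI (\<lambda>x. Xr (\<lambda>x. ?H (rad x)) x + (real ?N - 1) * coth (rad x) * ?H (rad x)) = 0"
    by (rule integral_Xr[OF c])
  moreover have "HI (\<lambda>x. log_weight (rad x) * f' (- ln (rad x) / R))
      = - R * HI (\<lambda>x. Xr (\<lambda>x. ?H (rad x)) x + (real ?N - 1) * coth (rad x) * ?H (rad x))"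
  proof -
    have "cpt_smooth x0 (\<lambda>x. Xr (\<lambda>x. ?H (rad x)) x + (real ?N - 1) * coth (rad x) * ?H (rad x))"
      by (intro cpt_smooth_add cpt_smooth_Xr c cpt_smooth_radial[OF c, of "\<lambda>t. (real ?N - 1) * coth t"])
         (intro smooth_pos_intros)
    from cpt_smooth_cmult[OF this, of "- R"]
    have "HI (\<lambda>x. log_weight (rad x) * f' (- ln (rad x) / R)) =
        HI (\<lambda>x. - R * (Xr (\<lambda>x. ?H (rad x)) x + (real ?N - 1) * coth (rad x) * ?H (rad x)))"
    proof (rule HI_cong)
      fix x assume x: "x \<in> \<Omega>"
      define t where "t = rad x"
      have t: "t > 0" using rad_pos[OF x] by (simp add: t_def)
      have s: "sinh t > 0" using t by simp
      have n: "real (?N - 1) = real ?N - 1" by (simp add: of_nat_diff Suc_leI)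
      have "((\<lambda>t. 1 / sinh t ^ (?N - 1)) has_real_derivative
          - (real (?N - 1) * sinh t ^ (?N - 1 - 1) * cosh t) / (sinh t ^ (?N - 1) * sinh t ^ (?N - 1))) (at t)"
        using s by (auto intro!: derivative_eq_intros)
      moreover have "(real (?N - 1) * sinh t ^ (?N - 1 - 1) * cosh t) / (sinh t ^ (?N - 1) * sinh t ^ (?N - 1))
          = (real ?N - 1) * coth t / sinh t ^ (?N - 1)"
        unfolding n[symmetric] using s by (cases "?N - 1") (simp_all add: coth_def)
      ultimately have "((\<lambda>t. 1 / sinh t ^ (?N - 1)) has_real_derivative
          - ((real ?N - 1) * coth t / sinh t ^ (?N - 1))) (at t)" by simp
      from DERIV_mult[OF this log_arg_has_derivative[OF der t]]
      have d: "(?H has_real_derivative - ((real ?N - 1) * coth t / sinh t ^ (?N - 1)) * f (- ln t / R)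
          + - (f' (- ln t / R) / (R * t)) * (1 / sinh t ^ (?N - 1))) (at (rad x))"
        by (simp add: t_def)
      then show "log_weight (rad x) * f' (- ln (rad x) / R) =
          - R * (Xr (\<lambda>x. ?H (rad x)) x + (real ?N - 1) * coth (rad x) * ?H (rad x))"
        unfolding Xr_radial[OF x d] t_def[symmetric]
        using R t by (simp add: log_weight_def field_simps)
    qed
    then show ?thesis by simp
  qed
  ultimately show ?thesis by simp
qed

text \<open>Both weighted integrals are the same unknown multiple of their one-dimensional
  counterparts. The combination \<open>k\<close> has mean zero, so it has a compactly supported
  primitive and its weighted integral vanishes; the multiple is never computed.\<close>

lemma integral_log_weight_proportional:
  assumes f: "smooth UNIV f" "\<And>s. s \<notin> {1<..<4} \<Longrightarrow> f s = 0"
    and g: "smooth UNIV g" "\<And>s. s \<notin> {1<..<4} \<Longrightarrow> g s = 0" and R: "R > 0"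
  shows "integral {0..5} g * HI (\<lambda>x. log_weight (rad x) * f (- ln (rad x) / R))
    = integral {0..5} f * HI (\<lambda>x. log_weight (rad x) * g (- ln (rad x) / R))"
proof -
  define A B where "A = integral {0..5} f" and "B = integral {0..5} g"
  define k where "k s = B * f s - A * g s" for s
  have k: "smooth UNIV k" "\<And>s. s \<notin> {1<..<4} \<Longrightarrow> k s = 0"
    unfolding k_def[abs_def] using f g by (auto intro!: smooth_diff smooth_mult)
  have int: "f integrable_on {0..5}" "g integrable_on {0..5}"
    using smooth_continuous_on[OF f(1)] smooth_continuous_on[OF g(1)]
    by (auto intro!: integrable_continuous_interval intro: continuous_on_subset)
  have "integral {0..5} k = 0"
    unfolding k_def using int by (simp add: integral_diff integrable_cmul[where 'b = real, simplified] A_def B_def)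
  then obtain G where G: "smooth UNIV G" "\<And>s. (G has_real_derivative k s) (at s)" "\<And>s. s \<notin> {1<..<4} \<Longrightarrow> G s = 0"
    using antiderivative_compact_support[OF k] by blast
  have "HI (\<lambda>x. log_weight (rad x) * k (- ln (rad x) / R)) = 0"
    by (rule integral_log_weight_derivative[OF G(1,3) R G(2)])
  moreover have "HI (\<lambda>x. log_weight (rad x) * k (- ln (rad x) / R)) =
      B * HI (\<lambda>x. log_weight (rad x) * f (- ln (rad x) / R))
      + (- A) * HI (\<lambda>x. log_weight (rad x) * g (- ln (rad x) / R))"
  proof (rule HI_lin2[OF cpt_smooth_log[OF smooth_log_weight f R] cpt_smooth_log[OF smooth_log_weight g R]])
    show "log_weight (rad x) * k (- ln (rad x) / R) = B * (log_weight (rad x) * f (- ln (rad x) / R))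
        + - A * (log_weight (rad x) * g (- ln (rad x) / R))" for x
      unfolding k_def by (simp add: right_diff_distrib mult_ac)
  qed
  ultimately show ?thesis by (simp add: A_def B_def)
qed

section \<open>Sharpness\<close>

text \<open>Where the continuous integrand is nonzero there is a nonempty open set, which is not
  negligible.\<close>

lemma HI_pos:
  assumes f: "cpt_smooth x0 f" and nonneg: "\<And>x. x \<in> \<Omega> \<Longrightarrow> f x \<ge> 0" and y: "y \<in> \<Omega>" "f y > 0"
  shows "HI f > 0"
proof -
  let ?g = "\<lambda>x. conf_factor x ^ DIM('a) * f x"
  let ?G = "ext_zero x0 ?g"
  have "cpt_smooth x0 ?g"
    by (rule cpt_smooth_mult_left[OF f]) (intro smooth_power smooth_conf_factor open_punctured \<Omega>_ball)
  then obtain K where K: "compact K" "K \<subseteq> \<Omega>" "\<And>x. x \<in> \<Omega> - K \<Longrightarrow> ?g x = 0" and g: "smooth \<Omega> ?g"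
    unfolding cpt_smooth_def by blast
  have cont: "continuous_on UNIV ?G"
    by (rule smooth_continuous_on[OF smooth_ext_zero[OF g K]])
  have int: "integrable lborel ?G"
    by (rule integrable_lborel_compact_support[OF cont K(1)]) (use K in \<open>auto simp: ext_zero_def\<close>)
  have pos: "conf_factor x ^ DIM('a) > 0" if "x \<in> \<Omega>" for x
    using conf_factor_pos[of x] \<Omega>_D[OF that] by simp
  have G0: "?G x \<ge> 0" for x
    by (auto simp: ext_zero_def intro!: mult_nonneg_nonneg less_imp_le[OF pos] nonneg)
  have "HI f \<ge> 0" by (rule hyp_vol_integral_nonneg[OF f nonneg])
  moreover have "HI f \<noteq> 0"
  proof
    assume "HI f = 0"
    then have "AE x in lborel. ?G x = 0"
      using integral_nonneg_eq_0_iff_AE[OF int] G0 by (simp add: hyp_vol_integral_cpt_smooth(2)[OF f])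
    moreover have "{x. ?G x \<noteq> 0} \<in> sets lborel"
      using open_Collect_neq[OF cont continuous_on_const] by simp
    ultimately have "{x. ?G x \<noteq> 0} \<in> null_sets lborel"
      by (simp add: AE_iff_null)
    then have "negligible {x. ?G x \<noteq> 0}"
      using null_sets_completionI negligible_iff_null_sets by blast
    moreover have "open {x. ?G x \<noteq> 0}" by (rule open_Collect_neq[OF cont continuous_on_const])
    moreover have "?G y > 0"
      using y(1) mult_pos_pos[OF pos[OF y(1)] y(2)] by (simp only: ext_zero_def if_True)
    then have "y \<in> {x. ?G x \<noteq> 0}" by simp
    ultimately show False using open_not_negligible by blast
  qed
  ultimately show ?thesis by simp
qed

lemma HI_mono:
  assumes "cpt_smooth x0 f" "cpt_smooth x0 g" "\<And>x. x \<in> \<Omega> \<Longrightarrow> f x \<le> g x"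
  shows "HI f \<le> HI g"
  by (rule hyp_vol_integral_mono[OF assms cpt_smooth_diff[OF assms(2,1)]])

lemma powr_minus_dim: "t > 0 \<Longrightarrow> t powr (- real DIM('a)) = 1 / (t * t ^ (DIM('a) - 1))"
  by (simp add: powr_minus powr_realpow inverse_eq_divide power_eq_if[of t "DIM('a)"])

lemma log_weight_le: "t > 0 \<Longrightarrow> log_weight t \<le> t powr (- real DIM('a))"
  unfolding powr_minus_dim log_weight_def using sinh_bounds(1)[of t]
  by (intro divide_left_mono mult_left_mono power_mono mult_pos_pos) auto

lemma log_weight_ge:
  assumes t: "t > 0" "t \<le> 1"
  shows "t powr (- real DIM('a)) \<le> cosh 1 ^ (DIM('a) - 1) * log_weight t"
proof -
  have "sinh t \<le> t * cosh t" using sinh_bounds(2)[of t] t by simp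
  also have "\<dots> \<le> t * cosh 1" using t by (intro mult_left_mono) (auto simp: cosh_real_nonneg_le_iff)
  finally have "sinh t ^ (DIM('a) - 1) \<le> (t * cosh 1) ^ (DIM('a) - 1)"
    using t by (intro power_mono) auto
  then show ?thesis
    unfolding powr_minus_dim[OF t(1)] log_weight_def using t by (simp add: field_simps power_mult_distrib)
qed

text \<open>The leading coefficient is the one by which the Euclidean radial Laplacian acts on the
  power of exponent \<open>- a\<close>; its square is the sharp constant. Every other term carries a
  factor \<open>1 / R\<close> or \<open>t * coth t - 1\<close>.\<close>

lemma log_scaled_Lr:
  fixes f f1 f2 :: "real \<Rightarrow> real" and R :: real and x :: 'a
  assumes f: "smooth UNIV f" "\<And>s. (f has_real_derivative f1 s) (at s)" "\<And>s. (f1 has_real_derivative f2 s) (at s)"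
    and x: "x \<in> \<Omega>"
  defines "a \<equiv> (real DIM('a) - 4) / 2"
  defines "t \<equiv> rad x"
  defines "s \<equiv> - ln t / R"
  shows "Lr (\<lambda>y. log_scaled (- a) f R (rad y)) x = t powr (- a - 2) *
    (- (real DIM('a) * (real DIM('a) - 4) / 4) * f s - 2 * f1 s / R + f2 s / R\<^sup>2
      - (real DIM('a) - 1) * (t * coth t - 1) * (a * f s + f1 s / R))"
proof -
  let ?g = "\<lambda>s. - a * f s - f1 s / R"
  let ?k = "\<lambda>s. (- a - 1) * ?g s - (- a * f1 s - f2 s / R) / R"
  let ?F = "log_scaled (- a) f R" and ?F1 = "log_scaled (- a - 1) ?g R" and ?F2 = "log_scaled (- a - 1 - 1) ?k R"
  have t: "t > 0" using rad_pos[OF x] by (simp add: t_def)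
  have d1: "(?F has_real_derivative ?F1 t) (at t)" if "t > 0" for t
    by (rule log_scaled_has_derivative[OF f(2) that])
  have d2: "(?F1 has_real_derivative ?F2 t) (at t)" if "t > 0" for t
    by (rule log_scaled_has_derivative[OF DERIV_diff[OF DERIV_cmult[OF f(2)] DERIV_cdivide[OF f(3)]] that])
  have e1: "Xr (\<lambda>y. ?F (rad y)) y = ?F1 (rad y)" if "y \<in> \<Omega>" for y
    by (rule Xr_radial[OF that d1[OF rad_pos[OF that]]])
  have "Xr (Xr (\<lambda>y. ?F (rad y))) x = Xr (\<lambda>y. ?F1 (rad y)) x"
    by (rule Xr_cong[OF x e1])
  also have "\<dots> = ?F2 t"
    unfolding t_def by (rule Xr_radial[OF x d2[OF rad_pos[OF x]]])
  finally have "Lr (\<lambda>y. ?F (rad y)) x = ?F2 t + (real DIM('a) - 1) * coth t * ?F1 t"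
    by (simp add: Lr_def e1[OF x] t_def)
  also have "?F1 t = t powr (- a - 2) * t * ?g s"
    using t by (simp add: log_scaled_def s_def powr_diff powr_minus field_simps power2_eq_square)
  also have "?F2 t = t powr (- a - 2) * ?k s"
  proof -
    have "- a - 1 - 1 = - a - 2" by simp
    then show ?thesis unfolding log_scaled_def s_def by (simp only:)
  qed
  also have "t powr (- a - 2) * ?k s + (real DIM('a) - 1) * coth t * (t powr (- a - 2) * t * ?g s)
      = t powr (- a - 2) * (?k s + (real DIM('a) - 1) * (1 + (t * coth t - 1)) * ?g s)"
    by (simp add: algebra_simps add_divide_distrib diff_divide_distrib)
  also have "?k s + (real DIM('a) - 1) * (1 + (t * coth t - 1)) * ?g s
      = (a * (a + 1) - (real DIM('a) - 1) * a) * f s + (2 * a + 1 - (real DIM('a) - 1)) * (f1 s / R) + f2 s / R\<^sup>2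
      - (real DIM('a) - 1) * (t * coth t - 1) * (a * f s + f1 s / R)"
    by (simp add: algebra_simps power2_eq_square add_divide_distrib diff_divide_distrib)
  also have "a * (a + 1) - (real DIM('a) - 1) * a = - (real DIM('a) * (real DIM('a) - 4) / 4)"
    by (simp add: a_def field_simps)
  also have "2 * a + 1 - (real DIM('a) - 1) = - 2"
    by (simp add: a_def field_simps)
  finally show ?thesis by (simp add: algebra_simps add_divide_distrib diff_divide_distrib)
qed

text \<open>\<open>Op\<close> stands for either Laplacian: only its values on radial functions
  matter, and there the two agree. The Rayleigh quotient of the test function is shown to be at most
  the constant plus \<open>D / R\<close>, with \<open>D\<close> independent of
  \<open>R\<close>.\<close>

lemma rellich_constant_le:
  assumes N: "DIM('a) \<ge> 5" and ineq: "rellich_ineq x0 Op C"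
    and Op: "\<And>u F x. u \<in> test_functions x0 \<Longrightarrow> smooth {0<..} F \<Longrightarrow> (\<And>y. y \<in> \<Omega> \<Longrightarrow> u y = F (rad y)) \<Longrightarrow>
      x \<in> \<Omega> \<Longrightarrow> Op u x = Lr (\<lambda>y. F (rad y)) x"
  shows "C \<le> (real DIM('a))\<^sup>2 / 4 * ((real DIM('a) - 4) / 2)\<^sup>2"
proof -
  define n where "n = real DIM('a)"
  define a where "a = (n - 4) / 2"
  \<comment> \<open>\<open>- K\<close> is the leading coefficient in \<open>log_scaled_Lr\<close>,
    and \<open>K\<^sup>2\<close> is the claimed constant.\<close>
  define K where "K = n * (n - 4) / 4"
  have n5: "n \<ge> 5" using N by (simp add: n_def)
  have a0: "a > 0" and K0: "K > 0" using n5 by (simp_all add: a_def K_def)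
  define b1 where "b1 = pderiv_dir 1 bump"
  define b2 where "b2 = pderiv_dir 1 b1"
  have s1: "smooth UNIV b1" and s2: "smooth UNIV b2"
    unfolding b1_def b2_def by (auto intro!: smooth_pderiv_dir smooth_bump)
  have d1: "(bump has_real_derivative b1 s) (at s)" for s
    unfolding b1_def by (rule smooth_real_pderiv[OF smooth_bump]) simp
  have d2: "(b1 has_real_derivative b2 s) (at s)" for s
    unfolding b2_def by (rule smooth_real_pderiv[OF s1]) simp
  have z0: "bump s = 0" if "s \<notin> {2..3}" for s using bump_out[of s] that by auto
  have z1: "b1 s = 0" if "s \<notin> {2..3}" for s
    unfolding b1_def by (rule pderiv_dir_eq_0_outside[where K = "{2..3}" and F = bump]) (use that z0 in auto)
  have z2: "b2 s = 0" if "s \<notin> {2..3}" for s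
    unfolding b2_def by (rule pderiv_dir_eq_0_outside[where K = "{2..3}" and F = b1]) (use that z1 in auto)
  obtain M0 M1 M2 where M012: "\<And>s. \<bar>bump s\<bar> \<le> M0" "\<And>s. \<bar>b1 s\<bar> \<le> M1" "\<And>s. \<bar>b2 s\<bar> \<le> M2"
    using bounded_smooth_support[OF smooth_bump z0] bounded_smooth_support[OF s1 z1]
      bounded_smooth_support[OF s2 z2] by metis
  define M where "M = max 0 (max M0 (max M1 M2))"
  have M: "\<bar>bump s\<bar> \<le> M" "\<bar>b1 s\<bar> \<le> M" "\<bar>b2 s\<bar> \<le> M" "M \<ge> 0" for s
    using M012[of s] by (auto simp: M_def)
  \<comment> \<open>\<open>P\<close> will bound the rescaled error \<rho> defined below, and
    \<open>E\<close> the mixed and quadratic error terms in the square of the leading part plus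
    \<open>\<rho> / R\<close>.\<close>
  define P where "P = 3 * M + (n - 1) * ((a + 1) * M)"
  define E where "E = 2 * K * M * P + P\<^sup>2"
  have P0: "P \<ge> 0" using M(4) n5 a0 by (auto simp: P_def intro!: add_nonneg_nonneg mult_nonneg_nonneg)
  have E0: "E \<ge> 0" using P0 K0 M(4) by (auto simp: E_def intro!: add_nonneg_nonneg mult_nonneg_nonneg)
  define A where "A = integral {0..5} wide_bump"
  define B where "B = integral {0..5} (\<lambda>s. (bump s)\<^sup>2)"
  have B0: "B > 0" unfolding B_def by (rule integral_bump_sq_pos)
  have A0: "A \<ge> 0"
    unfolding A_def
    by (intro integral_nonneg integrable_continuous_interval continuous_on_subset[OF smooth_continuous_on[OF smooth_wide_bump]])
       (auto simp: wide_bump_nonneg)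
  define c1 where "c1 = (cosh 1 :: real) ^ (DIM('a) - 1)"
  have c1: "c1 \<ge> 0" by (simp add: c1_def)
  define D where "D = E * c1 * A / B"
  have D0: "D \<ge> 0" using E0 c1 A0 B0 by (simp add: D_def)
  have main: "C - K\<^sup>2 \<le> D / R" if R: "R \<ge> 1" for R
  proof -
    have R0: "R > 0" using R by simp
    let ?s = "\<lambda>x. - ln (rad x) / R"
    define F where "F = log_scaled (- a) bump R"
    have sF: "smooth {0<..} F" unfolding F_def by (rule smooth_log_scaled[OF smooth_bump])
    have bz: "bump s = 0" if "s \<notin> {1<..<4}" for s using bump_out[of s] that by auto
    have b2z: "(bump s)\<^sup>2 = 0" if "s \<notin> {1<..<4}" for s using bz[OF that] by simp
    have cU: "cpt_smooth x0 (\<lambda>x. F (rad x))"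
      unfolding F_def log_scaled_def by (rule cpt_smooth_log[OF smooth_powr_real smooth_bump bz R0])
    define u where "u = ext_zero x0 (\<lambda>x. F (rad x))"
    have u: "u \<in> test_functions x0" unfolding u_def by (rule test_ext_zero[OF cU])
    have ue: "u x = F (rad x)" if "x \<in> \<Omega>" for x using that by (simp add: u_def ext_zero_def)
    have sb2: "smooth UNIV (\<lambda>s. (bump s)\<^sup>2)" by (intro smooth_power smooth_bump open_UNIV)
    have cQ: "cpt_smooth x0 (\<lambda>x. rad x powr (- n) * (bump (?s x))\<^sup>2)"
      by (rule cpt_smooth_log[OF smooth_powr_real sb2 b2z R0])
    have cH: "cpt_smooth x0 (\<lambda>x. rad x powr (- n) * wide_bump (?s x))"
      by (rule cpt_smooth_log[OF smooth_powr_real smooth_wide_bump wide_bump_out R0])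
    define Q where "Q = HI (\<lambda>x. rad x powr (- n) * (bump (?s x))\<^sup>2)"
    define H where "H = HI (\<lambda>x. rad x powr (- n) * wide_bump (?s x))"
    have pw: "(rad x powr (- a - 2))\<^sup>2 = rad x powr (- n)" for x
      by (simp add: power2_eq_square powr_add[symmetric] a_def)
    have "C * HI (\<lambda>x. (u x)\<^sup>2 / hyp_dist x0 x ^ 4) \<le> HI (\<lambda>x. (Op u x)\<^sup>2)"
      using ineq u by (simp add: rellich_ineq_def)
    also have "HI (\<lambda>x. (u x)\<^sup>2 / hyp_dist x0 x ^ 4) = Q"
      unfolding Q_def
    proof (rule HI_cong[OF cQ])
      fix x assume x: "x \<in> \<Omega>"
      have t: "rad x > 0" by (rule rad_pos[OF x])
      have "(rad x powr (- a))\<^sup>2 / rad x ^ 4 = rad x powr (- n)"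
      proof -
        have "(rad x powr (- a))\<^sup>2 = rad x powr (- n + 4)"
          by (simp add: power2_eq_square powr_add[symmetric] a_def)
        also have "\<dots> = rad x powr (- n) * rad x ^ 4"
          using t by (simp only: powr_add) (simp add: powr_numeral)
        finally show ?thesis using t by simp
      qed
      then show "(u x)\<^sup>2 / hyp_dist x0 x ^ 4 = rad x powr (- n) * (bump (?s x))\<^sup>2"
        by (simp add: ue[OF x] F_def log_scaled_def power_mult_distrib rad_def[symmetric])
           (metis times_divide_eq_left)
    qed
    also have "HI (\<lambda>x. (Op u x)\<^sup>2) = HI (\<lambda>x. (Lr (\<lambda>y. F (rad y)) x)\<^sup>2)"
      by (rule HI_cong[OF cpt_smooth_power[OF cpt_smooth_Lr[OF cU]]]) (simp add: Op[OF u sF ue])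
    also have "\<dots> \<le> HI (\<lambda>x. K\<^sup>2 * (rad x powr (- n) * (bump (?s x))\<^sup>2) + E / R * (rad x powr (- n) * wide_bump (?s x)))"
    proof (rule HI_mono[OF cpt_smooth_power[OF cpt_smooth_Lr[OF cU]] cpt_smooth_add[OF cpt_smooth_cmult[OF cQ] cpt_smooth_cmult[OF cH]]])
      fix x assume x: "x \<in> \<Omega>"
      define t s where "t = rad x" and "s = - ln t / R"
      have t: "t > 0" using rad_pos[OF x] by (simp add: t_def)
      define \<delta> where "\<delta> = t * coth t - 1"
      \<comment> \<open>This is \<open>R\<close> times the deviation from the leading term. Its part
        \<open>R * \<delta>\<close> is not visibly bounded, and is controlled below through the
        location of the support.\<close>
      define \<rho> where "\<rho> = b2 s / R - 2 * b1 s - (n - 1) * (R * \<delta>) * (a * bump s + b1 s / R)"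
      have "Lr (\<lambda>y. F (rad y)) x = t powr (- a - 2) * (- K * bump s - 2 * b1 s / R + b2 s / R\<^sup>2
          - (n - 1) * \<delta> * (a * bump s + b1 s / R))"
        unfolding F_def \<delta>_def s_def t_def K_def a_def n_def
        by (rule log_scaled_Lr[OF smooth_bump d1 d2 x])
      also have "- K * bump s - 2 * b1 s / R + b2 s / R\<^sup>2 - (n - 1) * \<delta> * (a * bump s + b1 s / R)
          = - K * bump s + \<rho> / R"
        using R0 by (simp add: \<rho>_def field_simps power2_eq_square)
      finally have L: "(Lr (\<lambda>y. F (rad y)) x)\<^sup>2 = t powr (- n) * (- K * bump s + \<rho> / R)\<^sup>2"
        using pw[of x] by (simp add: power_mult_distrib t_def)
      have "(- K * bump s + \<rho> / R)\<^sup>2 \<le> K\<^sup>2 * (bump s)\<^sup>2 + E / R * wide_bump s"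
      proof (cases "s \<in> {2..3}")
        case False
        then have "- K * bump s + \<rho> / R = 0" by (simp add: \<rho>_def z0 z1 z2)
        then show ?thesis using E0 R0 wide_bump_nonneg by simp
      next
        case True
        \<comment> \<open>The support of \<open>bump\<close> starts at 2, beyond 1, so
          \<open>t \<le> exp (- R) \<le> 1 / R\<close>; hence the curvature error
          \<open>\<delta> \<le> t\<close> is also of order \<open>1 / R\<close>.\<close>
        have "t = exp (- (s * R))" using t R0 by (simp add: s_def)
        also have "\<dots> \<le> exp (- R)" using True R0 by simp
        also have "\<dots> \<le> 1 / R"
        proof -
          have "R \<le> exp R" using exp_ge_add_one_self[of R] by linarith
          then show ?thesis using R0 by (simp add: exp_minus field_simps)
        qed
        finally have tR: "R * t \<le> 1" using R0 by (simp add: field_simps)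
        have "\<delta> \<le> t"
          using sinh_bounds(3)[of t] t by (simp add: \<delta>_def coth_def field_simps)
        then have "R * \<delta> \<le> 1" using tR R0 by (meson mult_left_mono order_trans less_imp_le)
        moreover have "R * \<delta> \<ge> 0"
          using coth_ge_inverse[OF t] t R0 by (simp add: \<delta>_def field_simps)
        ultimately have Rd: "\<bar>R * \<delta>\<bar> \<le> 1" by simp
        have i1: "\<bar>b1 s / R\<bar> \<le> M" "\<bar>b2 s / R\<bar> \<le> M"
        proof -
          have "\<bar>b1 s\<bar> \<le> M * R" "\<bar>b2 s\<bar> \<le> M * R"
            using M(2,3)[of s] mult_left_mono[OF R M(4)] by linarith+
          then show "\<bar>b1 s / R\<bar> \<le> M" "\<bar>b2 s / R\<bar> \<le> M" using R0 by (simp_all add: divide_le_eq)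
        qed
        have i2: "\<bar>a * bump s + b1 s / R\<bar> \<le> (a + 1) * M"
        proof -
          have "\<bar>a * bump s\<bar> \<le> a * M" using M(1)[of s] a0 by (simp add: abs_mult)
          then show ?thesis
            using i1(1) abs_triangle_ineq[of "a * bump s" "b1 s / R"] unfolding distrib_right by linarith
        qed
        have "\<bar>(n - 1) * (R * \<delta>) * (a * bump s + b1 s / R)\<bar> \<le> (n - 1) * 1 * ((a + 1) * M)"
          unfolding abs_mult using n5 Rd i2 by (intro mult_mono) auto
        moreover have "\<bar>X - 2 * Y - Z\<bar> \<le> \<bar>X\<bar> + 2 * \<bar>Y\<bar> + \<bar>Z\<bar>" for X Y Z :: real
          by (simp add: abs_if)
        from this[of "b2 s / R" "b1 s" "(n - 1) * (R * \<delta>) * (a * bump s + b1 s / R)"]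
        have "\<bar>\<rho>\<bar> \<le> \<bar>b2 s / R\<bar> + 2 * \<bar>b1 s\<bar> + \<bar>(n - 1) * (R * \<delta>) * (a * bump s + b1 s / R)\<bar>"
          unfolding \<rho>_def .
        ultimately have rho: "\<bar>\<rho>\<bar> \<le> P"
          using i1(2) M(2)[of s] unfolding P_def by simp
        have "(- K * bump s + \<rho> / R)\<^sup>2 = K\<^sup>2 * (bump s)\<^sup>2 + (- 2 * K * bump s * \<rho> + \<rho>\<^sup>2 / R) / R"
          using R0 by (simp add: power2_eq_square field_simps)
        also have "\<dots> \<le> K\<^sup>2 * (bump s)\<^sup>2 + E / R"
        proof -
          have "\<bar>- 2 * K * bump s * \<rho>\<bar> \<le> 2 * K * M * P"
            unfolding abs_mult using K0 M rho by (intro mult_mono) auto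
          moreover have "\<rho>\<^sup>2 / R \<le> P\<^sup>2"
          proof -
            have "\<rho>\<^sup>2 \<le> P\<^sup>2" using rho P0 by (simp add: abs_le_square_iff[symmetric])
            also have "\<dots> \<le> P\<^sup>2 * R" using R by (simp add: mult_le_cancel_left1)
            finally show ?thesis using R0 by (simp add: divide_le_eq)
          qed
          ultimately have "- 2 * K * bump s * \<rho> + \<rho>\<^sup>2 / R \<le> E" unfolding E_def by linarith
          then show ?thesis using R0 by (simp add: divide_right_mono)
        qed
        also have "E / R \<le> E / R * wide_bump s"
          using mult_left_mono[OF wide_bump_ge_1[OF True], of "E / R"] E0 R0 by simp
        finally show ?thesis by simp
      qed
      then have "t powr (- n) * (- K * bump s + \<rho> / R)\<^sup>2 \<le> t powr (- n) * (K\<^sup>2 * (bump s)\<^sup>2 + E / R * wide_bump s)"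
        by (intro mult_left_mono) auto
      then show "(Lr (\<lambda>y. F (rad y)) x)\<^sup>2 \<le> K\<^sup>2 * (rad x powr (- n) * (bump (?s x))\<^sup>2)
          + E / R * (rad x powr (- n) * wide_bump (?s x))"
        unfolding L by (simp add: t_def s_def algebra_simps)
    qed
    also have "\<dots> = K\<^sup>2 * Q + E / R * H"
      unfolding Q_def H_def by (rule HI_lin2[OF cQ cH]) simp
    finally have CQ: "(C - K\<^sup>2) * Q \<le> E / R * H" by (simp add: algebra_simps)
    \<comment> \<open>The ratio of \<open>H\<close> to \<open>Q\<close> must be bounded
      independently of \<open>R\<close>. Exact proportionality is known only for
      \<open>log_weight\<close>, so both integrals are compared with it; on radii at most 1 the two
      weights agree up to the constant \<open>c1\<close>.\<close>
    define JH where "JH = HI (\<lambda>x. log_weight (rad x) * wide_bump (?s x))"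
    define JQ where "JQ = HI (\<lambda>x. log_weight (rad x) * (bump (?s x))\<^sup>2)"
    have cJH: "cpt_smooth x0 (\<lambda>x. log_weight (rad x) * wide_bump (?s x))"
      by (rule cpt_smooth_log[OF smooth_log_weight smooth_wide_bump wide_bump_out R0])
    have cJQ: "cpt_smooth x0 (\<lambda>x. log_weight (rad x) * (bump (?s x))\<^sup>2)"
      by (rule cpt_smooth_log[OF smooth_log_weight sb2 b2z R0])
    have BJ: "B * JH = A * JQ"
      unfolding A_def B_def JH_def JQ_def
      by (rule integral_log_weight_proportional[OF smooth_wide_bump wide_bump_out sb2 b2z R0])
    have "H \<le> HI (\<lambda>x. c1 * (log_weight (rad x) * wide_bump (?s x)))"
      unfolding H_def
    proof (rule HI_mono[OF cH cpt_smooth_cmult[OF cJH]])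
      fix x assume x: "x \<in> \<Omega>"
      have t: "rad x > 0" by (rule rad_pos[OF x])
      show "rad x powr (- n) * wide_bump (?s x) \<le> c1 * (log_weight (rad x) * wide_bump (?s x))"
      proof (cases "?s x \<in> {1<..<4}")
        case True
        then have "ln (rad x) \<le> 0" using R0 by (simp add: field_simps)
        then have "rad x \<le> 1" using t by simp
        then have "rad x powr (- n) \<le> c1 * log_weight (rad x)"
          unfolding n_def c1_def by (rule log_weight_ge[OF t])
        from mult_right_mono[OF this wide_bump_nonneg] show ?thesis by (simp add: mult.assoc)
      qed (simp add: wide_bump_out)
    qed
    then have HJ: "H \<le> c1 * JH" by (simp add: JH_def)
    have QJ: "JQ \<le> Q"
      unfolding JQ_def Q_def
    proof (rule HI_mono[OF cJQ cQ])
      fix x assume x: "x \<in> \<Omega>"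
      show "log_weight (rad x) * (bump (?s x))\<^sup>2 \<le> rad x powr (- n) * (bump (?s x))\<^sup>2"
        using log_weight_le[OF rad_pos[OF x]] by (intro mult_right_mono) (auto simp: n_def)
    qed
    have Q0: "Q > 0"
    proof -
      \<comment> \<open>The radius at which the profile is evaluated at 5/2, the middle of the
        support of \<open>bump\<close>.\<close>
      obtain y where y: "y \<in> \<Omega>" "rad y = exp (- (5 / 2 * R))"
        using exists_rad[of "exp (- (5 / 2 * R))"] by auto
      have "?s y = 5 / 2" using y R0 by simp
      then have "bump (?s y) > 0" by (simp only:) (simp add: bump_def flat_def)
      then have "0 < rad y powr (- n) * (bump (?s y))\<^sup>2" using rad_pos[OF y(1)] by simp
      then show ?thesis unfolding Q_def by (intro HI_pos[OF cQ _ y(1)]) auto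
    qed
    have "JH = A / B * JQ" using BJ B0 by (simp add: field_simps)
    also have "\<dots> \<le> A / B * Q" using A0 B0 QJ by (intro mult_left_mono) auto
    finally have "H \<le> c1 * (A / B * Q)" using HJ c1 by (meson mult_left_mono order_trans)
    then have "E / R * H \<le> E / R * (c1 * (A / B * Q))"
      using E0 R0 by (intro mult_left_mono) auto
    also have "\<dots> = D / R * Q" by (simp add: D_def mult_ac)
    finally show ?thesis using CQ Q0 by (meson mult_le_cancel_right_pos order_trans)
  qed
  have "C - K\<^sup>2 \<le> 0"
  proof (rule ccontr)
    assume "\<not> C - K\<^sup>2 \<le> 0"
    then have e: "C - K\<^sup>2 > 0" by simp
    \<comment> \<open>Large enough that \<open>D / R\<close> is at most half of the supposed
      excess.\<close>
    define R where "R = max 1 (2 * D / (C - K\<^sup>2))"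
    have R: "R \<ge> 1" "R > 0" by (simp_all add: R_def)
    have "2 * D / (C - K\<^sup>2) \<le> R" by (simp add: R_def)
    then have "2 * D \<le> R * (C - K\<^sup>2)" using e by (simp add: divide_le_eq)
    then have "D / R \<le> (C - K\<^sup>2) / 2" using R by (simp add: field_simps)
    from order_trans[OF main[OF R(1)] this] show False using e by simp
  qed
  then show ?thesis
    by (simp add: K_def n_def power2_eq_square mult_ac)
qed

lemma radial_coth_nonneg: "x \<in> \<Omega> \<Longrightarrow> rad x * coth (rad x) - 1 \<ge> 0"
  using coth_ge_inverse[OF rad_pos[of x]] rad_pos[of x] by (simp add: field_simps)

lemma rellich_radial:
  assumes u: "cpt_smooth x0 u" and N: "DIM('a) \<ge> 5"
  shows "HI (\<lambda>x. (Lr u x)\<^sup>2) \<ge>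
    (real DIM('a))\<^sup>2 / 4 * ((real DIM('a) - 4) / 2)\<^sup>2 * HI (\<lambda>x. (u x)\<^sup>2 / rad x ^ 4)"
proof -
  let ?n = "real DIM('a)"
  have P: "cpt_smooth x0 (Xr u)" by (rule cpt_smooth_Xr[OF u])
  have nonneg: "HI f \<ge> 0" if "cpt_smooth x0 f" "\<And>x. x \<in> \<Omega> \<Longrightarrow> f x \<ge> 0" for f
    by (rule hyp_vol_integral_nonneg[OF that])
  have h1: "HI (\<lambda>x. (rad x * coth (rad x) - 1) / rad x ^ 4 * (u x)\<^sup>2) \<ge> 0"
  proof (rule nonneg)
    show "cpt_smooth x0 (\<lambda>x. (rad x * coth (rad x) - 1) / rad x ^ 4 * (u x)\<^sup>2)"
      by (rule cpt_smooth_radial[OF cpt_smooth_power[OF u], of "\<lambda>t. (t * coth t - 1) / t ^ 4"])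
         (intro smooth_pos_intros, simp)
  qed (use radial_coth_nonneg in auto)
  have h2: "HI (\<lambda>x. (rad x * coth (rad x) - 1) / (rad x)\<^sup>2 * (Xr u x)\<^sup>2) \<ge> 0"
  proof (rule nonneg)
    show "cpt_smooth x0 (\<lambda>x. (rad x * coth (rad x) - 1) / (rad x)\<^sup>2 * (Xr u x)\<^sup>2)"
      by (rule cpt_smooth_radial[OF cpt_smooth_power[OF P], of "\<lambda>t. (t * coth t - 1) / t\<^sup>2"])
         (intro smooth_pos_intros, simp)
  qed (use radial_coth_nonneg in auto)
  have h3: "HI (\<lambda>x. (Xr u x + (?n - 4) / 2 / rad x * u x)\<^sup>2 / (rad x)\<^sup>2) \<ge> 0"
    "HI (\<lambda>x. (Lr u x - ?n / (2 * rad x) * Xr u x)\<^sup>2) \<ge> 0"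
    by (intro Bochner_Integration.integral_nonneg; simp)+
  have k: "?n\<^sup>2 * (?n - 4) * (?n - 1) / 8 \<ge> 0" "?n * (?n - 1) / 2 \<ge> 0" "?n\<^sup>2 / 4 \<ge> 0"
    using N by auto
  show ?thesis
    unfolding rellich_identity[OF u]
    using mult_nonneg_nonneg[OF k(1) h1] mult_nonneg_nonneg[OF k(2) h2] mult_nonneg_nonneg[OF k(3) h3(1)] h3(2)
    by linarith
qed

end

section \<open>Polar form of the statement\<close>

lemma weight_split: "(p * q + m / k) * z = p * (q * z) + m * (1 / k * z)" for p q m k z :: real
  by (simp add: distrib_right)

context hyp_pole
begin

abbreviation "pow_u u \<equiv> (\<lambda>y. rad y powr ((real DIM('a) - 4) / 2) * u y)"

abbreviation "last_u u \<equiv>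
  (\<lambda>y. sinh (rad y) ^ (DIM('a) - 1) * radial_deriv x0 u y / rad y powr (real DIM('a) / 2))"

lemma last_u_eq: "smooth \<Omega> u \<Longrightarrow> y \<in> \<Omega> \<Longrightarrow> last_u u y = last_weight (rad y) * Xr u y"
  by (simp add: radial_deriv_eq diff\<Omega> last_weight_def)

lemma smooth_pow_u: "smooth \<Omega> u \<Longrightarrow> smooth \<Omega> (pow_u u)"
  by (intro smooth_mult open_punctured smooth_radial[of "\<lambda>t. t powr _"] smooth_powr_real)

lemma smooth_last: "smooth \<Omega> u \<Longrightarrow> smooth \<Omega> (\<lambda>y. last_weight (rad y) * Xr u y)"
  by (intro smooth_mult open_punctured smooth_radial smooth_last_weight smooth_Xr)

lemma smooth_last_u:
  assumes "smooth \<Omega> u" shows "smooth \<Omega> (last_u u)"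
  by (rule smooth_cong[OF open_punctured smooth_last[OF assms]]) (rule last_u_eq[OF assms, symmetric])

lemma pow_term:
  assumes u: "smooth \<Omega> u" and x: "x \<in> \<Omega>" and N: "DIM('a) \<ge> 2"
  shows "1 / rad x ^ (DIM('a) - 2) * (Xr (pow_u u) x)\<^sup>2
      = (Xr u x + (real DIM('a) - 4) / 2 / rad x * u x)\<^sup>2 / (rad x)\<^sup>2"
    and "1 / rad x ^ (DIM('a) - 2) * grad_sq (pow_u u) x
      = (Xr u x + (real DIM('a) - 4) / 2 / rad x * u x)\<^sup>2 / (rad x)\<^sup>2 + 1 / (rad x)\<^sup>2 * (Gam u x / (sh x)\<^sup>2)"
proof -
  let ?p = "rad x powr ((real DIM('a) - 4) / 2)" and ?w = "1 / rad x ^ (DIM('a) - 2)"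
  have w: "?w * (?p\<^sup>2 * z) = 1 / (rad x)\<^sup>2 * z" for z
    unfolding mult.assoc[symmetric] powr_weight[OF rad_pos[OF x] N] ..
  have X: "?w * (Xr (pow_u u) x)\<^sup>2 = (Xr u x + (real DIM('a) - 4) / 2 / rad x * u x)\<^sup>2 / (rad x)\<^sup>2"
    unfolding Xr_powr_mult[OF u x] power_mult_distrib w by simp
  then show "?w * (Xr (pow_u u) x)\<^sup>2
      = (Xr u x + (real DIM('a) - 4) / 2 / rad x * u x)\<^sup>2 / (rad x)\<^sup>2" .
  have "(\<Sum>i\<in>Basis. (Dt i (pow_u u) x)\<^sup>2) = ?p\<^sup>2 * Gam u x"
    by (simp add: Dt_radial_mult[OF smooth_powr_real u x] Gam_def power_mult_distrib sum_distrib_left)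
  then have "?w * grad_sq (pow_u u) x = ?w * (Xr (pow_u u) x)\<^sup>2 + ?w * (?p\<^sup>2 * (Gam u x / (sh x)\<^sup>2))"
    unfolding grad_sq_polar[OF x diff\<Omega>[OF smooth_pow_u[OF u] x]] by (simp add: distrib_left)
  then show "?w * grad_sq (pow_u u) x = (Xr u x + (real DIM('a) - 4) / 2 / rad x * u x)\<^sup>2 / (rad x)\<^sup>2
      + 1 / (rad x)\<^sup>2 * (Gam u x / (sh x)\<^sup>2)"
    unfolding X w .
qed

text \<open>The radial factor passes through angular derivatives and its square cancels the outer
  weight. In the full gradient this leaves the angular energy of \<open>Xr u\<close> with
  coefficient exactly 1, one of the two copies supplied by the cross term.\<close>

lemma last_term:
  assumes u: "smooth \<Omega> u" and x: "x \<in> \<Omega>"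
  shows "rad x ^ DIM('a) / sinh (rad x) ^ (2 * (DIM('a) - 1)) * (Xr (last_u u) x)\<^sup>2
      = (Lr u x - real DIM('a) / (2 * rad x) * Xr u x)\<^sup>2"
    and "rad x ^ DIM('a) / sinh (rad x) ^ (2 * (DIM('a) - 1)) * grad_sq (last_u u) x
      = (Lr u x - real DIM('a) / (2 * rad x) * Xr u x)\<^sup>2 + Gam (Xr u) x / (sh x)\<^sup>2"
proof -
  let ?l = "last_weight (rad x)" and ?w = "rad x ^ DIM('a) / sinh (rad x) ^ (2 * (DIM('a) - 1))"
  have w: "?w * (?l\<^sup>2 * z) = z" for z
    unfolding mult.assoc[symmetric] last_weight_sq[OF rad_pos[OF x]] by simp
  have "Xr (last_u u) x = ?l * (Lr u x - real DIM('a) / (2 * rad x) * Xr u x)"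
    using Xr_cong[OF x last_u_eq[OF u]] Xr_last_weight_mult[OF u x] by simp
  then have X: "?w * (Xr (last_u u) x)\<^sup>2 = (Lr u x - real DIM('a) / (2 * rad x) * Xr u x)\<^sup>2"
    by (simp only: power_mult_distrib w)
  then show "?w * (Xr (last_u u) x)\<^sup>2 = (Lr u x - real DIM('a) / (2 * rad x) * Xr u x)\<^sup>2" .
  have "Dt i (last_u u) x = ?l * Dt i (Xr u) x" for i
    using Dt_cong[OF x last_u_eq[OF u]] Dt_radial_mult[OF smooth_last_weight smooth_Xr[OF u] x] by simp
  then have "(\<Sum>i\<in>Basis. (Dt i (last_u u) x)\<^sup>2) = ?l\<^sup>2 * Gam (Xr u) x"
    by (simp add: Gam_def power_mult_distrib sum_distrib_left)
  then have "?w * grad_sq (last_u u) x = ?w * (Xr (last_u u) x)\<^sup>2 + ?w * (?l\<^sup>2 * (Gam (Xr u) x / (sh x)\<^sup>2))"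
    unfolding grad_sq_polar[OF x diff\<Omega>[OF smooth_last_u[OF u] x]] by (simp add: distrib_left)
  then show "?w * grad_sq (last_u u) x
      = (Lr u x - real DIM('a) / (2 * rad x) * Xr u x)\<^sup>2 + Gam (Xr u) x / (sh x)\<^sup>2"
    unfolding X w .
qed

lemma cpt_smooth_terms:
  assumes u: "cpt_smooth x0 u"
  shows "cpt_smooth x0 (\<lambda>x. (rad x * coth (rad x) - 1) / (rad x)\<^sup>2 * (Xr u x)\<^sup>2)"
    and "cpt_smooth x0 (\<lambda>x. (rad x * coth (rad x) - 1) / (rad x)\<^sup>2 * (Gam u x / (sh x)\<^sup>2))"
    and "cpt_smooth x0 (\<lambda>x. 1 / (rad x)\<^sup>2 * (Gam u x / (sh x)\<^sup>2))"
    and "cpt_smooth x0 (\<lambda>x. (Xr u x + (real DIM('a) - 4) / 2 / rad x * u x)\<^sup>2 / (rad x)\<^sup>2)"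
    and "cpt_smooth x0 (\<lambda>x. (Lr u x - real DIM('a) / (2 * rad x) * Xr u x)\<^sup>2)"
    and "cpt_smooth x0 (\<lambda>x. Gam (Xr u) x / (sh x)\<^sup>2)"
    and "cpt_smooth x0 (\<lambda>x. (Lr u x + Tl u x / (sh x)\<^sup>2)\<^sup>2)"
proof -
  have X: "cpt_smooth x0 (Xr u)" by (rule cpt_smooth_Xr[OF u])
  have w: "smooth {0<..} (\<lambda>t::real. (t * coth t - 1) / t\<^sup>2)" "smooth {0<..} (\<lambda>t::real. 1 / t\<^sup>2)"
    "smooth {0<..} (\<lambda>t::real. 1 / (sinh t)\<^sup>2)" "smooth {0<..} (\<lambda>t::real. (real DIM('a) - 4) / 2 / t)"
    "smooth {0<..} (\<lambda>t::real. real DIM('a) / (2 * t))"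
    by (intro smooth_pos_intros, simp)+
  have S: "cpt_smooth x0 (\<lambda>x. f x / (sh x)\<^sup>2)" if "cpt_smooth x0 f" for f
    using cpt_smooth_radial[OF that w(3)] by (simp add: sh_def)
  show "cpt_smooth x0 (\<lambda>x. (rad x * coth (rad x) - 1) / (rad x)\<^sup>2 * (Xr u x)\<^sup>2)"
    by (rule cpt_smooth_radial[OF cpt_smooth_power[OF X] w(1)])
  show "cpt_smooth x0 (\<lambda>x. (rad x * coth (rad x) - 1) / (rad x)\<^sup>2 * (Gam u x / (sh x)\<^sup>2))"
    by (rule cpt_smooth_radial[OF S[OF cpt_smooth_Gam[OF u]] w(1)])
  show "cpt_smooth x0 (\<lambda>x. 1 / (rad x)\<^sup>2 * (Gam u x / (sh x)\<^sup>2))"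
    by (rule cpt_smooth_radial[OF S[OF cpt_smooth_Gam[OF u]] w(2)])
  have "cpt_smooth x0 (\<lambda>x. 1 / (rad x)\<^sup>2 * (Xr u x + (real DIM('a) - 4) / 2 / rad x * u x)\<^sup>2)"
    by (intro cpt_smooth_radial[OF _ w(2)] cpt_smooth_power cpt_smooth_add X cpt_smooth_radial[OF u w(4)])
  then show "cpt_smooth x0 (\<lambda>x. (Xr u x + (real DIM('a) - 4) / 2 / rad x * u x)\<^sup>2 / (rad x)\<^sup>2)"
    by simp
  show "cpt_smooth x0 (\<lambda>x. (Lr u x - real DIM('a) / (2 * rad x) * Xr u x)\<^sup>2)"
    by (intro cpt_smooth_power cpt_smooth_diff cpt_smooth_Lr u cpt_smooth_radial[OF X w(5)])
  show "cpt_smooth x0 (\<lambda>x. Gam (Xr u) x / (sh x)\<^sup>2)"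
    by (rule S[OF cpt_smooth_Gam[OF X]])
  show "cpt_smooth x0 (\<lambda>x. (Lr u x + Tl u x / (sh x)\<^sup>2)\<^sup>2)"
    by (intro cpt_smooth_power cpt_smooth_add cpt_smooth_Lr u S[OF cpt_smooth_Tl[OF u]])
qed

lemma radial_grad_sq_eq: "x \<in> \<Omega> \<Longrightarrow> smooth \<Omega> v \<Longrightarrow> radial_grad_sq x0 v x = (Xr v x)\<^sup>2"
  by (simp add: radial_grad_sq_def radial_deriv_eq diff\<Omega>)

lemma radial_identity:
  assumes u: "u \<in> test_functions x0" and N: "DIM('a) \<ge> 2"
  defines "n \<equiv> real DIM('a)"
  shows "HI (\<lambda>x. (radial_laplace x0 u x)\<^sup>2) =
      n\<^sup>2 / 4 * ((n - 4) / 2)\<^sup>2 * HI (\<lambda>x. (u x)\<^sup>2 / rad x ^ 4)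
    + n\<^sup>2 * (n - 4) * (n - 1) / 8 * HI (\<lambda>x. (rad x * coth (rad x) - 1) / rad x ^ 4 * (u x)\<^sup>2)
    + n * (n - 1) / 2 * HI (\<lambda>x. (rad x * coth (rad x) - 1) / (rad x)\<^sup>2 * radial_grad_sq x0 u x)
    + n\<^sup>2 / 4 * HI (\<lambda>x. 1 / rad x ^ (DIM('a) - 2) * radial_grad_sq x0 (pow_u u) x)
    + HI (\<lambda>x. rad x ^ DIM('a) / sinh (rad x) ^ (2 * (DIM('a) - 1)) * radial_grad_sq x0 (last_u u) x)"
proof -
  have c: "cpt_smooth x0 u" by (rule cpt_smooth_test[OF u])
  have s: "smooth \<Omega> u" by (rule cpt_smooth_smooth[OF c])
  note ct = cpt_smooth_terms[OF c]
  have e1: "HI (\<lambda>x. (radial_laplace x0 u x)\<^sup>2) = HI (\<lambda>x. (Lr u x)\<^sup>2)"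
    by (rule HI_cong[OF cpt_smooth_power[OF cpt_smooth_Lr[OF c]]]) (simp add: radial_laplace_eq s)
  have e3: "HI (\<lambda>x. (rad x * coth (rad x) - 1) / (rad x)\<^sup>2 * radial_grad_sq x0 u x)
      = HI (\<lambda>x. (rad x * coth (rad x) - 1) / (rad x)\<^sup>2 * (Xr u x)\<^sup>2)"
    by (rule HI_cong[OF ct(1)]) (simp add: radial_grad_sq_eq s)
  have e4: "HI (\<lambda>x. 1 / rad x ^ (DIM('a) - 2) * radial_grad_sq x0 (pow_u u) x)
      = HI (\<lambda>x. (Xr u x + (n - 4) / 2 / rad x * u x)\<^sup>2 / (rad x)\<^sup>2)"
    unfolding n_def
    by (rule HI_cong[OF ct(4)]) (simp only: radial_grad_sq_eq smooth_pow_u[OF s] pow_term(1)[OF s _ N])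
  have e5: "HI (\<lambda>x. rad x ^ DIM('a) / sinh (rad x) ^ (2 * (DIM('a) - 1)) * radial_grad_sq x0 (last_u u) x)
      = HI (\<lambda>x. (Lr u x - n / (2 * rad x) * Xr u x)\<^sup>2)"
    unfolding n_def
    by (rule HI_cong[OF ct(5)]) (simp only: radial_grad_sq_eq smooth_last_u[OF s] last_term(1)[OF s])
  show ?thesis
    unfolding e1 e3 e4 e5 unfolding n_def by (rule rellich_identity[OF c])
qed

lemma hyp_laplace_eq: "smooth \<Omega> u \<Longrightarrow> x \<in> \<Omega> \<Longrightarrow> hyp_laplace u x = Lr u x + Tl u x / (sh x)\<^sup>2"
  by (simp add: hyp_laplace_polar Lr_def Tl_def)

lemma full_inequality:
  assumes u: "u \<in> test_functions x0" and N: "DIM('a) \<ge> 5"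
  defines "n \<equiv> real DIM('a)"
  shows "HI (\<lambda>x. (hyp_laplace u x)\<^sup>2) \<ge>
      n\<^sup>2 / 4 * ((n - 4) / 2)\<^sup>2 * HI (\<lambda>x. (u x)\<^sup>2 / rad x ^ 4)
    + n\<^sup>2 * (n - 4) * (n - 1) / 8 * HI (\<lambda>x. (rad x * coth (rad x) - 1) / rad x ^ 4 * (u x)\<^sup>2)
    + n * (n - 1) / 2 * HI (\<lambda>x. (rad x * coth (rad x) - 1) / (rad x)\<^sup>2 * grad_sq u x)
    + n\<^sup>2 / 4 * HI (\<lambda>x. 1 / rad x ^ (DIM('a) - 2) * grad_sq (pow_u u) x)
    + HI (\<lambda>x. rad x ^ DIM('a) / sinh (rad x) ^ (2 * (DIM('a) - 1)) * grad_sq (last_u u) x)"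
proof -
  have N2: "DIM('a) \<ge> 2" using N by simp
  have c: "cpt_smooth x0 u" by (rule cpt_smooth_test[OF u])
  have s: "smooth \<Omega> u" by (rule cpt_smooth_smooth[OF c])
  note ct = cpt_smooth_terms[OF c]
  have e1: "HI (\<lambda>x. (hyp_laplace u x)\<^sup>2) = HI (\<lambda>x. (Lr u x + Tl u x / (sh x)\<^sup>2)\<^sup>2)"
    by (rule HI_cong[OF ct(7)]) (simp add: hyp_laplace_eq s)
  have e3: "HI (\<lambda>x. (rad x * coth (rad x) - 1) / (rad x)\<^sup>2 * grad_sq u x)
      = 1 * HI (\<lambda>x. (rad x * coth (rad x) - 1) / (rad x)\<^sup>2 * (Xr u x)\<^sup>2)
      + 1 * HI (\<lambda>x. (rad x * coth (rad x) - 1) / (rad x)\<^sup>2 * (Gam u x / (sh x)\<^sup>2))"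
    by (rule HI_lin2[OF ct(1,2)]) (simp add: grad_sq_polar diff\<Omega>[OF s] Gam_def distrib_left)
  have e4: "HI (\<lambda>x. 1 / rad x ^ (DIM('a) - 2) * grad_sq (pow_u u) x)
      = 1 * HI (\<lambda>x. (Xr u x + (n - 4) / 2 / rad x * u x)\<^sup>2 / (rad x)\<^sup>2)
      + 1 * HI (\<lambda>x. 1 / (rad x)\<^sup>2 * (Gam u x / (sh x)\<^sup>2))"
    unfolding n_def by (rule HI_lin2[OF ct(4,3)]) (simp only: pow_term(2)[OF s _ N2] mult_1)
  have e5: "HI (\<lambda>x. rad x ^ DIM('a) / sinh (rad x) ^ (2 * (DIM('a) - 1)) * grad_sq (last_u u) x)
      = 1 * HI (\<lambda>x. (Lr u x - n / (2 * rad x) * Xr u x)\<^sup>2) + 1 * HI (\<lambda>x. Gam (Xr u) x / (sh x)\<^sup>2)"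
    unfolding n_def by (rule HI_lin2[OF ct(5,6)]) (simp only: last_term(2)[OF s] mult_1)
  have w: "HI (\<lambda>x. (n * (n - 1) / 2 * ((rad x * coth (rad x) - 1) / (rad x)\<^sup>2) + n\<^sup>2 / 4 / (rad x)\<^sup>2) * (Gam u x / (sh x)\<^sup>2))
     = n * (n - 1) / 2 * HI (\<lambda>x. (rad x * coth (rad x) - 1) / (rad x)\<^sup>2 * (Gam u x / (sh x)\<^sup>2))
     + n\<^sup>2 / 4 * HI (\<lambda>x. 1 / (rad x)\<^sup>2 * (Gam u x / (sh x)\<^sup>2))"
    by (rule HI_lin2[OF ct(2,3)]) (rule weight_split)
  show ?thesis
    unfolding e1 e3 e4 e5
    using angular_inequality[OF c N] w rellich_identity[OF c]
    unfolding n_def by (simp add: distrib_left)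
qed

lemma sharp_radial:
  assumes N: "DIM('a) \<ge> 5"
  shows "sharp_rellich_constant x0 (radial_laplace x0) ((real DIM('a))\<^sup>2 / 4 * ((real DIM('a) - 4) / 2)\<^sup>2)"
  unfolding sharp_rellich_constant_def
proof (intro conjI allI impI)
  show "rellich_ineq x0 (radial_laplace x0) ((real DIM('a))\<^sup>2 / 4 * ((real DIM('a) - 4) / 2)\<^sup>2)"
    unfolding rellich_ineq_def rad_def[symmetric]
  proof
    fix u assume "u \<in> test_functions x0"
    then have c: "cpt_smooth x0 u" by (rule cpt_smooth_test)
    have "HI (\<lambda>x. (radial_laplace x0 u x)\<^sup>2) = HI (\<lambda>x. (Lr u x)\<^sup>2)"
      by (rule HI_cong[OF cpt_smooth_power[OF cpt_smooth_Lr[OF c]]])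
         (simp add: radial_laplace_eq cpt_smooth_smooth[OF c])
    then show "HI (\<lambda>x. (radial_laplace x0 u x)\<^sup>2) \<ge>
        (real DIM('a))\<^sup>2 / 4 * ((real DIM('a) - 4) / 2)\<^sup>2 * HI (\<lambda>x. (u x)\<^sup>2 / rad x ^ 4)"
      using rellich_radial[OF c N] by simp
  qed
  fix C assume "rellich_ineq x0 (radial_laplace x0) C"
  then show "C \<le> (real DIM('a))\<^sup>2 / 4 * ((real DIM('a) - 4) / 2)\<^sup>2"
  proof (rule rellich_constant_le[OF N])
    fix u F x assume u: "u \<in> test_functions x0" and eq: "\<And>y. y \<in> \<Omega> \<Longrightarrow> u y = F (rad y)" and x: "x \<in> \<Omega>"
    have "Xr u y = Xr (\<lambda>y. F (rad y)) y" if "y \<in> \<Omega>" for y by (rule Xr_cong[OF that eq])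
    then have "Lr u x = Lr (\<lambda>y. F (rad y)) x"
      using Xr_cong[OF x, of "Xr u"] x by (simp add: Lr_def)
    then show "radial_laplace x0 u x = Lr (\<lambda>y. F (rad y)) x"
      by (simp add: radial_laplace_eq[OF x cpt_smooth_smooth[OF cpt_smooth_test[OF u]]])
  qed
qed

text \<open>Validity: the terms that \<open>angular_inequality\<close> adds are nonnegative, which
  reduces the claim to \<open>rellich_radial\<close>. Optimality: on radial functions the angular
  derivatives vanish, so the test functions of the radial problem serve again.\<close>

lemma sharp_full:
  assumes N: "DIM('a) \<ge> 5"
  shows "sharp_rellich_constant x0 hyp_laplace ((real DIM('a))\<^sup>2 / 4 * ((real DIM('a) - 4) / 2)\<^sup>2)"
  unfolding sharp_rellich_constant_def
proof (intro conjI allI impI)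
  show "rellich_ineq x0 hyp_laplace ((real DIM('a))\<^sup>2 / 4 * ((real DIM('a) - 4) / 2)\<^sup>2)"
    unfolding rellich_ineq_def rad_def[symmetric]
  proof
    fix u assume "u \<in> test_functions x0"
    then have c: "cpt_smooth x0 u" by (rule cpt_smooth_test)
    let ?n = "real DIM('a)"
    have "HI (\<lambda>x. (hyp_laplace u x)\<^sup>2) = HI (\<lambda>x. (Lr u x + Tl u x / (sh x)\<^sup>2)\<^sup>2)"
      by (rule HI_cong[OF cpt_smooth_terms(7)[OF c]]) (simp add: hyp_laplace_eq cpt_smooth_smooth[OF c])
    moreover have "HI (\<lambda>x. Gam (Xr u) x / (sh x)\<^sup>2) \<ge> 0"
      by (rule hyp_vol_integral_nonneg[OF cpt_smooth_terms(6)[OF c]]) (simp add: Gam_def sum_nonneg)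
    moreover have "HI (\<lambda>x. (?n * (?n - 1) / 2 * ((rad x * coth (rad x) - 1) / (rad x)\<^sup>2) + ?n\<^sup>2 / 4 / (rad x)\<^sup>2)
        * (Gam u x / (sh x)\<^sup>2)) \<ge> 0"
    proof (rule hyp_vol_integral_nonneg)
      have "cpt_smooth x0 (\<lambda>x. ?n * (?n - 1) / 2 * ((rad x * coth (rad x) - 1) / (rad x)\<^sup>2 * (Gam u x / (sh x)\<^sup>2))
          + ?n\<^sup>2 / 4 * (1 / (rad x)\<^sup>2 * (Gam u x / (sh x)\<^sup>2)))"
        by (intro cpt_smooth_add cpt_smooth_cmult cpt_smooth_terms c)
      then show "cpt_smooth x0 (\<lambda>x. (?n * (?n - 1) / 2 * ((rad x * coth (rad x) - 1) / (rad x)\<^sup>2) + ?n\<^sup>2 / 4 / (rad x)\<^sup>2)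
          * (Gam u x / (sh x)\<^sup>2))"
        by (rule cpt_smooth_congD) (rule weight_split[symmetric])
      show "(?n * (?n - 1) / 2 * ((rad x * coth (rad x) - 1) / (rad x)\<^sup>2) + ?n\<^sup>2 / 4 / (rad x)\<^sup>2)
          * (Gam u x / (sh x)\<^sup>2) \<ge> 0" if "x \<in> \<Omega>" for x
        using radial_coth_nonneg[OF that] N
        by (intro mult_nonneg_nonneg add_nonneg_nonneg divide_nonneg_nonneg) (auto simp: Gam_def sum_nonneg)
    qed
    ultimately show "HI (\<lambda>x. (hyp_laplace u x)\<^sup>2) \<ge>
        (real DIM('a))\<^sup>2 / 4 * ((real DIM('a) - 4) / 2)\<^sup>2 * HI (\<lambda>x. (u x)\<^sup>2 / rad x ^ 4)"
      using rellich_radial[OF c N] angular_inequality[OF c N] by linarith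
  qed
  fix C assume "rellich_ineq x0 hyp_laplace C"
  then show "C \<le> (real DIM('a))\<^sup>2 / 4 * ((real DIM('a) - 4) / 2)\<^sup>2"
  proof (rule rellich_constant_le[OF N])
    fix u F x
    assume u: "u \<in> test_functions x0" and F: "smooth {0<..} F"
      and eq: "\<And>y. y \<in> \<Omega> \<Longrightarrow> u y = F (rad y)" and x: "x \<in> \<Omega>"
    have "Xr u y = Xr (\<lambda>y. F (rad y)) y" if "y \<in> \<Omega>" for y by (rule Xr_cong[OF that eq])
    then have L: "Lr u x = Lr (\<lambda>y. F (rad y)) x"
      using Xr_cong[OF x, of "Xr u"] x by (simp add: Lr_def)
    have D0: "Dt i u y = 0" if "y \<in> \<Omega>" for i y
      using Dt_cong[OF that eq] Dt_radial[OF that smooth_differentiable[OF F]] rad_pos[OF that] by simp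
    have "Dt i (Dt i u) x = Dt i (\<lambda>_. 0) x" for i
      by (rule Dt_cong[OF x D0])
    then have "Tl u x = 0" by (simp add: Tl_def) (simp add: Dt_def)
    then show "hyp_laplace u x = Lr (\<lambda>y. F (rad y)) x"
      by (simp add: hyp_laplace_eq[OF cpt_smooth_smooth[OF cpt_smooth_test[OF u]] x] L)
  qed
qed

end

theorem corollary2p3:
  fixes x0 :: "'a::euclidean_space" and N :: nat and r :: "'a \<Rightarrow> real"
  assumes "N = DIM('a)" and "N \<ge> 2"
    and "x0 \<in> hyp_space"
    and "r = hyp_dist x0"
  shows
    "(\<forall>u\<in>test_functions x0.
        (\<integral>x. (radial_laplace x0 u x)\<^sup>2 \<partial>hyp_vol) =
          (real N)\<^sup>2 / 4 * ((real N - 4) / 2)\<^sup>2 * (\<integral>x. (u x)\<^sup>2 / r x ^ 4 \<partial>hyp_vol)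
        + (real N)\<^sup>2 * (real N - 4) * (real N - 1) / 8
            * (\<integral>x. (r x * coth (r x) - 1) / r x ^ 4 * (u x)\<^sup>2 \<partial>hyp_vol)
        + real N * (real N - 1) / 2
            * (\<integral>x. (r x * coth (r x) - 1) / (r x)\<^sup>2 * radial_grad_sq x0 u x \<partial>hyp_vol)
        + (real N)\<^sup>2 / 4
            * (\<integral>x. 1 / r x ^ (N - 2)
                 * radial_grad_sq x0 (\<lambda>y. r y powr ((real N - 4) / 2) * u y) x \<partial>hyp_vol)
        + (\<integral>x. r x ^ N / sinh (r x) ^ (2 * (N - 1))
                 * radial_grad_sq x0
                     (\<lambda>y. sinh (r y) ^ (N - 1) * radial_deriv x0 u y / r y powr (real N / 2)) x
               \<partial>hyp_vol))
     \<and> (N \<ge> 5 \<longrightarrow>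
        (\<forall>u\<in>test_functions x0.
          (\<integral>x. (hyp_laplace u x)\<^sup>2 \<partial>hyp_vol) \<ge>
            (real N)\<^sup>2 / 4 * ((real N - 4) / 2)\<^sup>2 * (\<integral>x. (u x)\<^sup>2 / r x ^ 4 \<partial>hyp_vol)
          + (real N)\<^sup>2 * (real N - 4) * (real N - 1) / 8
              * (\<integral>x. (r x * coth (r x) - 1) / r x ^ 4 * (u x)\<^sup>2 \<partial>hyp_vol)
          + real N * (real N - 1) / 2
              * (\<integral>x. (r x * coth (r x) - 1) / (r x)\<^sup>2 * grad_sq u x \<partial>hyp_vol)
          + (real N)\<^sup>2 / 4
              * (\<integral>x. 1 / r x ^ (N - 2)
                   * grad_sq (\<lambda>y. r y powr ((real N - 4) / 2) * u y) x \<partial>hyp_vol)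
          + (\<integral>x. r x ^ N / sinh (r x) ^ (2 * (N - 1))
                   * grad_sq
                       (\<lambda>y. sinh (r y) ^ (N - 1) * radial_deriv x0 u y / r y powr (real N / 2)) x
                 \<partial>hyp_vol))
        \<and> sharp_rellich_constant x0 (radial_laplace x0) ((real N)\<^sup>2 / 4 * ((real N - 4) / 2)\<^sup>2)
        \<and> sharp_rellich_constant x0 hyp_laplace ((real N)\<^sup>2 / 4 * ((real N - 4) / 2)\<^sup>2))"
proof -
  have "norm x0 < 1" using \<open>x0 \<in> hyp_space\<close> by (simp add: hyp_space_def)
  then interpret hyp_pole x0 by unfold_locales
  have r: "r = rad" using \<open>r = hyp_dist x0\<close> by (simp add: rad_def)
  show ?thesis
    using radial_identity full_inequality sharp_radial sharp_full \<open>N \<ge> 2\<close>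
    unfolding r \<open>N = DIM('a)\<close> by blast
qed

end
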